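(* Let $(\mathcal{F},\mathcal{T}^X)$ be a dynamical system of trees of spheres, with $\mathcal{F}:\mathcal{T}^Y\to\mathcal{T}^Z$ of degree $\deg(\mathcal{F})$. Then the number of grand orbits containing a critical point with infinite forward orbit is at most $2\deg(\mathcal{F})-2$.
   Context: Graphs and trees. A graph consists of a finite set $V$ of vertices and a set $E$ of edges, each a $2$-element subset of $V$; $E_v$ is the set of edges containing $v$, $\mathrm{val}(v)=\mathrm{card}\,E_v$. A tree is a connected graph without cycles; valence-$1$ vertices are leaves, the others internal vertices ($IV$). For a vertex $v$ and $e\in E_v$, the branch $B_v(e)$ is the connected component of $T\setminus\{v\}$ containing $e$. A vertex $v$ separates $v_1,v_2,v_3$ if they lie in three distinct components of $T\setminus\{v\}$. A tree is stable if every internal vertex has valence $\ge3$; all trees here are stable. Trees of spheres. For a finite set $X$ with $\ge3$ elements, a tree marked by $X$ is a tree whose set of leaves is $X$. A tree of spheres $\mathcal{T}^X$ consists of such a tree $T^X$ and, for each internal vertex $v$, a topological $2$-sphere $\mathcal{S}_v$ and an injection $i_v:E_v\to\mathcal{S}_v$; $X_v:=i_v(E_v)$; $a_v:X\to\mathcal{S}_v$, $a_v(x)=i_v(e)$ if $x\in B_v(e)$. Covers. A trees map sends vertices to vertices and edges $\{v,w\}$ to edges $\{F(v),F(w)\}$. A cover $\mathcal{F}:\mathcal{T}^Y\to\mathcal{T}^Z$ is a trees map $F:T^Y\to T^Z$ with $F(Y)\subseteq Z$, $F(IV^Y)\subseteq IV^Z$, together with branched coverings $f_v:\mathcal{S}_v\to\mathcal{S}_{F(v)}$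 for $v\in IV^Y$ such that $f_v:\mathcal{S}_v\setminus Y_v\to\mathcal{S}_{F(v)}\setminus Z_{F(v)}$ is a covering map, $f_v\circ i_v=i_{F(v)}\circ F$ on $E_v$, and for an edge $e=\{v_1,v_2\}$ between internal vertices $\deg_{i_{v_1}(e)}f_{v_1}=\deg_{i_{v_2}(e)}f_{v_2}$. With $\deg(v)=\deg f_v$, the sum $\sum_{v'\in F^{-1}(w)}\deg(v')$ is independent of the vertex $w$ of $T^Z$ (for a leaf $y$, $\deg(y)$ is the local degree of $f_v$ at the attaching point of the edge of $y$); it is the degree $\deg(\mathcal{F})$. Dynamical systems. $T^X$ is compatible with $T^Y$ if $X\subseteq Y$, $IV^X\subseteq IV^Y$ and for all vertices $v,v_1,v_2,v_3$ of $T^X$, $v$ separates $v_1,v_2,v_3$ in $T^X$ iff in $T^Y$; $\mathcal{T}^X\triangleleft\mathcal{T}^Y$ if moreover $\mathcal{S}^X_v=\mathcal{S}^Y_v$ and $a^X_v=a^Y_v|_X$ for every internal vertex $v$ of $T^X$. A dynamical system of trees of spheres is a pair $(\mathcal{F},\mathcal{T}^X)$ with $\mathcal{F}:\mathcal{T}^Y\to\mathcal{T}^Z$ a cover, $X\subseteq Y\cap Z$, $\mathcal{T}^X\triangleleft\mathcal{T}^Y$, $\mathcal{T}^X\triangleleft\mathcal{T}^Z$. Orbits. $IV(F):=IV^X$, $IV(F^{k+1}):=\{v\in IV(F^k):F^k(v)\in IV^X\}$. For $v\in IV(F^k)$, $f_v^k:=f_{F^{k-1}(v)}\circ\cdots\circ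 f_v$. Let $\Sigma$ be the disjoint union of the spheres $\mathcal{S}_v$, $v\in IV^Y$. The orbit of $z\in\mathcal{S}_v\subseteq\Sigma$ is $\mathcal{O}(z)=\{f_v^k(z):k\ge0,\ v\in IV(F^k)\}$ (for $k=0$, $z$ itself). Two points of $\Sigma$ are in the same grand orbit if their orbits intersect (grand orbits are the classes of the equivalence relation so generated). A critical point is a point $x\in\mathcal{S}_v$, $v\in IV^Y$, with $\deg_x f_v\ge2$; it has infinite forward orbit if $\mathcal{O}(x)$ is infinite. *)

theory Defs
  imports "HOL-Analysis.Analysis"
begin

section \<open>Graphs and trees\<close>

text \<open>A graph is given by a vertex set V and a set E of 2-element subsets of V.\<close>

definition graph :: "'v set \<Rightarrow> 'v set set \<Rightarrow> bool" where
  "graph V E \<longleftrightarrow> finite V \<and> (\<forall>e\<in>E. \<exists>u w. e = {u, w} \<and> u \<noteq> w \<and> u \<in> V \<and> w \<in> V)"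

definition edges_at :: "'v set set \<Rightarrow> 'v \<Rightarrow> 'v set set" where
  "edges_at E v = {e\<in>E. v \<in> e}"

definition val :: "'v set set \<Rightarrow> 'v \<Rightarrow> nat" where
  "val E v = card (edges_at E v)"

definition leaves :: "'v set \<Rightarrow> 'v set set \<Rightarrow> 'v set" where
  "leaves V E = {v\<in>V. val E v = 1}"

definition IV :: "'v set \<Rightarrow> 'v set set \<Rightarrow> 'v set" where
  "IV V E = V - leaves V E"

text \<open>Adjacency relation of the subgraph induced on a vertex set A.\<close>
definition adj_in :: "'v set set \<Rightarrow> 'v set \<Rightarrow> ('v \<times> 'v) set" where
  "adj_in E A = {(a, b). a \<in> A \<and> b \<in> A \<and> {a, b} \<in> E}"

definition connected_graph :: "'v set \<Rightarrow> 'v set set \<Rightarrow> bool" where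
  "connected_graph V E \<longleftrightarrow> (\<forall>u\<in>V. \<forall>w\<in>V. (u, w) \<in> (adj_in E V)\<^sup>*)"

text \<open>A cycle: at least 3 distinct vertices, consecutive ones (cyclically) adjacent.\<close>
definition is_cycle :: "'v set set \<Rightarrow> 'v list \<Rightarrow> bool" where
  "is_cycle E c \<longleftrightarrow> length c \<ge> 3 \<and> distinct c \<and>
     (\<forall>i < length c. {c ! i, c ! ((i + 1) mod length c)} \<in> E)"

definition tree :: "'v set \<Rightarrow> 'v set set \<Rightarrow> bool" where
  "tree V E \<longleftrightarrow> graph V E \<and> connected_graph V E \<and> \<not> (\<exists>c. is_cycle E c)"

definition stable_tree :: "'v set \<Rightarrow> 'v set set \<Rightarrow> bool" where
  "stable_tree V E \<longleftrightarrow> tree V E \<and> (\<forall>v\<in>IV V E. val E v \<ge> 3)"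

text \<open>Branch \<open>B_v(e)\<close>: the component of \<open>T - {v}\<close> containing the edge e (i.e. its other endpoint).\<close>
definition branch :: "'v set \<Rightarrow> 'v set set \<Rightarrow> 'v \<Rightarrow> 'v set \<Rightarrow> 'v set" where
  "branch V E v e = {w. \<exists>u\<in>e - {v}. u \<in> V - {v} \<and> (u, w) \<in> (adj_in E (V - {v}))\<^sup>*}"

text \<open>v separates v1, v2, v3: they lie in three distinct components of \<open>T - {v}\<close>.\<close>
definition separates :: "'v set \<Rightarrow> 'v set set \<Rightarrow> 'v \<Rightarrow> 'v \<Rightarrow> 'v \<Rightarrow> 'v \<Rightarrow> bool" where
  "separates V E v v1 v2 v3 \<longleftrightarrow>
     v1 \<in> V - {v} \<and> v2 \<in> V - {v} \<and> v3 \<in> V - {v} \<and>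
     (v1, v2) \<notin> (adj_in E (V - {v}))\<^sup>* \<and>
     (v1, v3) \<notin> (adj_in E (V - {v}))\<^sup>* \<and>
     (v2, v3) \<notin> (adj_in E (V - {v}))\<^sup>*"

section \<open>Branched coverings of topological spheres\<close>

text \<open>Standard topological 2-sphere model.\<close>
abbreviation S2 :: "(real^3) set" where
  "S2 \<equiv> sphere 0 1"

text \<open>f is locally modelled at x on \<open>z \<mapsto> z^d\<close> (in topological charts onto the unit disc).\<close>
definition local_model :: "'p::topological_space set \<Rightarrow> 'p set \<Rightarrow> ('p \<Rightarrow> 'p) \<Rightarrow> 'p \<Rightarrow> nat \<Rightarrow> bool" where
  "local_model S S' f x d \<longleftrightarrow> d \<ge> 1 \<and>
     (\<exists>U W \<phi> \<phi>' \<psi> \<psi>'. openin (top_of_set S) U \<and> x \<in> U \<and> openin (top_of_set S') W \<and>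
        f ` U \<subseteq> W \<and>
        homeomorphism U (ball (0::complex) 1) \<phi> \<phi>' \<and>
        homeomorphism W (ball (0::complex) 1) \<psi> \<psi>' \<and>
        \<phi> x = 0 \<and> \<psi> (f x) = 0 \<and> (\<forall>y\<in>U. \<psi> (f y) = (\<phi> y) ^ d))"

definition local_degree :: "'p::topological_space set \<Rightarrow> 'p set \<Rightarrow> ('p \<Rightarrow> 'p) \<Rightarrow> 'p \<Rightarrow> nat" where
  "local_degree S S' f x = (THE d. local_model S S' f x d)"

definition branched_covering :: "'p::topological_space set \<Rightarrow> 'p set \<Rightarrow> ('p \<Rightarrow> 'p) \<Rightarrow> bool" where
  "branched_covering S S' f \<longleftrightarrow> continuous_on S f \<and> f ` S = S' \<and>
     (\<forall>x\<in>S. \<exists>d. local_model S S' f x d)"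

text \<open>Global degree: sum of local degrees over a fibre (independent of the point).\<close>
definition bc_degree :: "'p::topological_space set \<Rightarrow> 'p set \<Rightarrow> ('p \<Rightarrow> 'p) \<Rightarrow> nat" where
  "bc_degree S S' f = (let y = (SOME y. y \<in> S') in \<Sum>x\<in>{x\<in>S. f x = y}. local_degree S S' f x)"

section \<open>Trees of spheres\<close>

record ('v, 'p) tos =
  verts :: "'v set"
  edgs :: "'v set set"
  sph :: "'v \<Rightarrow> 'p set"
  inc :: "'v \<Rightarrow> 'v set \<Rightarrow> 'p"

definition lvs :: "('v, 'p) tos \<Rightarrow> 'v set" where
  "lvs T = leaves (verts T) (edgs T)"

definition ivs :: "('v, 'p) tos \<Rightarrow> 'v set" where
  "ivs T = IV (verts T) (edgs T)"

text \<open>A tree of spheres marked by X = its set of leaves (card X \<ge> 3).\<close>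
definition tree_of_spheres :: "('v, 'p::topological_space) tos \<Rightarrow> bool" where
  "tree_of_spheres T \<longleftrightarrow> stable_tree (verts T) (edgs T) \<and> card (lvs T) \<ge> 3 \<and>
     (\<forall>v\<in>ivs T. sph T v homeomorphic S2 \<and>
        inj_on (inc T v) (edges_at (edgs T) v) \<and>
        inc T v ` edges_at (edgs T) v \<subseteq> sph T v)"

text \<open>\<open>X_v = i_v(E_v)\<close>.\<close>
definition marked_pts :: "('v, 'p) tos \<Rightarrow> 'v \<Rightarrow> 'p set" where
  "marked_pts T v = inc T v ` edges_at (edgs T) v"

text \<open>\<open>a_v(x) = i_v(e)\<close> where x lies in the branch \<open>B_v(e)\<close>.\<close>
definition attach :: "('v, 'p) tos \<Rightarrow> 'v \<Rightarrow> 'v \<Rightarrow> 'p" where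
  "attach T v x = inc T v (THE e. e \<in> edges_at (edgs T) v \<and> x \<in> branch (verts T) (edgs T) v e)"

definition compatible :: "('v, 'p) tos \<Rightarrow> ('v, 'p) tos \<Rightarrow> bool" where
  "compatible TX TY \<longleftrightarrow> lvs TX \<subseteq> lvs TY \<and> ivs TX \<subseteq> ivs TY \<and>
     (\<forall>v\<in>verts TX. \<forall>v1\<in>verts TX. \<forall>v2\<in>verts TX. \<forall>v3\<in>verts TX.
        separates (verts TX) (edgs TX) v v1 v2 v3 \<longleftrightarrow> separates (verts TY) (edgs TY) v v1 v2 v3)"

definition tos_sub :: "('v, 'p::topological_space) tos \<Rightarrow> ('v, 'p) tos \<Rightarrow> bool" where
  "tos_sub TX TY \<longleftrightarrow> tree_of_spheres TX \<and> tree_of_spheres TY \<and> compatible TX TY \<and>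
     (\<forall>v\<in>ivs TX. sph TX v = sph TY v \<and> (\<forall>x\<in>lvs TX. attach TX v x = attach TY v x))"

section \<open>Covers\<close>

definition cover :: "('v, 'p::topological_space) tos \<Rightarrow> ('v, 'p) tos \<Rightarrow> ('v \<Rightarrow> 'v) \<Rightarrow> ('v \<Rightarrow> 'p \<Rightarrow> 'p) \<Rightarrow> bool" where
  "cover TY TZ F f \<longleftrightarrow> tree_of_spheres TY \<and> tree_of_spheres TZ \<and>
     F ` verts TY \<subseteq> verts TZ \<and>
     (\<forall>v w. {v, w} \<in> edgs TY \<longrightarrow> {F v, F w} \<in> edgs TZ) \<and>
     F ` lvs TY \<subseteq> lvs TZ \<and> F ` ivs TY \<subseteq> ivs TZ \<and>
     (\<forall>v\<in>ivs TY.
        branched_covering (sph TY v) (sph TZ (F v)) (f v) \<and>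
        (\<forall>x\<in>sph TY v - marked_pts TY v. f v x \<in> sph TZ (F v) - marked_pts TZ (F v)) \<and>
        covering_space (sph TY v - marked_pts TY v) (f v) (sph TZ (F v) - marked_pts TZ (F v)) \<and>
        (\<forall>e\<in>edges_at (edgs TY) v. f v (inc TY v e) = inc TZ (F v) (F ` e))) \<and>
     (\<forall>v1 v2. {v1, v2} \<in> edgs TY \<and> v1 \<in> ivs TY \<and> v2 \<in> ivs TY \<longrightarrow>
        local_degree (sph TY v1) (sph TZ (F v1)) (f v1) (inc TY v1 {v1, v2}) =
        local_degree (sph TY v2) (sph TZ (F v2)) (f v2) (inc TY v2 {v1, v2}))"

text \<open>deg(v): degree of \<open>f_v\<close> for internal v; for a leaf y, the local degree of \<open>f_w\<close>
  at the attaching point of the edge of y (w its neighbour).\<close>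
definition vdeg :: "('v, 'p::topological_space) tos \<Rightarrow> ('v, 'p) tos \<Rightarrow> ('v \<Rightarrow> 'v) \<Rightarrow> ('v \<Rightarrow> 'p \<Rightarrow> 'p) \<Rightarrow> 'v \<Rightarrow> nat" where
  "vdeg TY TZ F f v =
     (if v \<in> ivs TY then bc_degree (sph TY v) (sph TZ (F v)) (f v)
      else (let e = (THE e. e \<in> edges_at (edgs TY) v); w = (THE w. w \<in> e - {v}) in
            local_degree (sph TY w) (sph TZ (F w)) (f w) (inc TY w e)))"

text \<open>deg(F): the sum of deg(v') over \<open>F^{-1}(w)\<close>, for a vertex w of \<open>T^Z\<close> (independent of w).\<close>
definition cover_degree :: "('v, 'p::topological_space) tos \<Rightarrow> ('v, 'p) tos \<Rightarrow> ('v \<Rightarrow> 'v) \<Rightarrow> ('v \<Rightarrow> 'p \<Rightarrow> 'p) \<Rightarrow> nat" where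
  "cover_degree TY TZ F f =
     (let w = (SOME w. w \<in> verts TZ) in \<Sum>v\<in>{v\<in>verts TY. F v = w}. vdeg TY TZ F f v)"

section \<open>Dynamical systems and orbits\<close>

definition dyn_system :: "('v, 'p::topological_space) tos \<Rightarrow> ('v, 'p) tos \<Rightarrow> ('v, 'p) tos \<Rightarrow> ('v \<Rightarrow> 'v) \<Rightarrow> ('v \<Rightarrow> 'p \<Rightarrow> 'p) \<Rightarrow> bool" where
  "dyn_system TX TY TZ F f \<longleftrightarrow> cover TY TZ F f \<and>
     lvs TX \<subseteq> lvs TY \<inter> lvs TZ \<and> tos_sub TX TY \<and> tos_sub TX TZ"

text \<open>\<open>IV_iter IVX F k = IV(F^(k+1))\<close>.\<close>
primrec IV_iter :: "'v set \<Rightarrow> ('v \<Rightarrow> 'v) \<Rightarrow> nat \<Rightarrow> 'v set" where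
  "IV_iter IVX F 0 = IVX"
| "IV_iter IVX F (Suc k) = {v\<in>IV_iter IVX F k. (F ^^ Suc k) v \<in> IVX}"

text \<open>Points of \<open>\<Sigma>\<close> are pairs (v, z) with z in \<open>S_v\<close>; one dynamical step.\<close>
definition dstep :: "('v \<Rightarrow> 'v) \<Rightarrow> ('v \<Rightarrow> 'p \<Rightarrow> 'p) \<Rightarrow> 'v \<times> 'p \<Rightarrow> 'v \<times> 'p" where
  "dstep F f p = (F (fst p), f (fst p) (snd p))"

definition Sigma_pts :: "('v, 'p) tos \<Rightarrow> ('v \<times> 'p) set" where
  "Sigma_pts TY = {(v, z). v \<in> ivs TY \<and> z \<in> sph TY v}"

definition orbit :: "('v, 'p) tos \<Rightarrow> ('v \<Rightarrow> 'v) \<Rightarrow> ('v \<Rightarrow> 'p \<Rightarrow> 'p) \<Rightarrow> 'v \<times> 'p \<Rightarrow> ('v \<times> 'p) set" where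
  "orbit TX F f p = {p} \<union> {(dstep F f ^^ Suc k) p | k. fst p \<in> IV_iter (ivs TX) F k}"

text \<open>Grand orbits: classes of the equivalence relation on \<open>\<Sigma>\<close> generated by "orbits intersect".\<close>
definition grand_orbits :: "('v, 'p) tos \<Rightarrow> ('v, 'p) tos \<Rightarrow> ('v \<Rightarrow> 'v) \<Rightarrow> ('v \<Rightarrow> 'p \<Rightarrow> 'p) \<Rightarrow> ('v \<times> 'p) set set" where
  "grand_orbits TX TY F f = Sigma_pts TY //
     ({(p, q). p \<in> Sigma_pts TY \<and> q \<in> Sigma_pts TY \<and> orbit TX F f p \<inter> orbit TX F f q \<noteq> {}}\<^sup>+)"

definition critical_pt :: "('v, 'p::topological_space) tos \<Rightarrow> ('v, 'p) tos \<Rightarrow> ('v \<Rightarrow> 'v) \<Rightarrow> ('v \<Rightarrow> 'p \<Rightarrow> 'p) \<Rightarrow> 'v \<times> 'p \<Rightarrow> bool" where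
  "critical_pt TY TZ F f p \<longleftrightarrow> p \<in> Sigma_pts TY \<and>
     local_degree (sph TY (fst p)) (sph TZ (F (fst p))) (f (fst p)) (snd p) \<ge> 2"

end

theory Submission
  imports Defs
begin

text \<open>
  All critical points are marked points, so they correspond to edges of the source tree. Call an edge
  \<open>e\<close> at \<open>v\<close> folding if the branch of the target tree at \<open>F v\<close> in the direction of \<open>F e\<close> contains
  the image of a critical leaf. Off these edges \<open>F\<close> maps branches into branches and has degree one:
  working inwards from the leaves, a branched covering of spheres that ramifies over one point only
  has degree one. Take the last folding point on an infinite critical orbit. The target branch at its
  image contains a critical value but no vertex whose orbit stays in the tree of \<open>X\<close> forever, since
  such a vertex would keep the orbit inside the finite set of marked points. Hence the branches
  obtained from different grand orbits are disjoint, and there are at most as many grand orbits as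
  critical leaves. The latter number is at most \<open>2 deg(F) - 2\<close> by the Riemann--Hurwitz inequality on
  each sphere, summed over the tree.

  On a sphere the inequality comes from Euler's formula: pull back an arc through the branch values.
  The complement of the arc is connected, so the preimage has at most \<open>deg f\<close> complementary
  components, whereas by the Jordan curve theorem every arc that closes a cycle creates a new one.
\<close>

section \<open>Faces of planar graphs\<close>

text \<open>The trees \<open>TY\<close> and \<open>TZ\<close> are tied together only through
  \<open>TX\<close>: a marked point of \<open>TZ\<close> at a vertex of \<open>TX\<close> need not
  be marked in \<open>TY\<close>, so the next step of an orbit of marked points is in general
  uncontrolled. It is controlled when the branch of \<open>TZ\<close> at that point contains a
  vertex of \<open>TX\<close>. The component of \<open>TX\<close> around that vertex, off the base,
  then contains a leaf of \<open>TX\<close>, and agreement of the attaching maps at this leaf makes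
  the point marked in \<open>TY\<close> too, in the direction of the same vertex. An immortal vertex
  in the branch is what allows this step to be repeated forever.

  The global bound is Riemann-Hurwitz for a single sphere marked by the leaves: in a tree the sum of
  \<open>val - 2\<close> over the internal vertices is the number of leaves minus 2, so the
  contributions of inner edges cancel. An inequality on each sphere suffices for this, hence only a
  lower bound for the number of faces of a planar graph enters, not the exact Euler formula.\<close>

text \<open>Having at least \<open>k\<close> complementary components, stated through representatives because
  finiteness of the set of components is not known beforehand.\<close>

definition has_faces :: "complex set \<Rightarrow> nat \<Rightarrow> bool" where
  "has_faces G k \<longleftrightarrow> (\<exists>R. finite R \<and> card R = k \<and> R \<subseteq> - G \<and>
      pairwise (\<lambda>x y. \<not> connected_component (- G) x y) R)"

text \<open>Components of the complement of \<open>H\<close> refine those of \<open>G\<close>, and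
  by \<open>ex\<close> every old face still has a point off \<open>H\<close>, so representatives can
  be moved inside their faces without merging. If a face of \<open>G\<close> splits into those of
  \<open>y1\<close> and \<open>y2\<close>, its own representative, if there is one, is exchanged for
  these two points.\<close>

lemma has_faces_superset:
  assumes "has_faces G k" "G \<subseteq> H"
    and ex: "\<And>x. x \<notin> G \<Longrightarrow> \<exists>x'. connected_component (- G) x x' \<and> x' \<notin> H"
  shows "has_faces H k"
    and "\<lbrakk>y1 \<notin> H; y2 \<notin> H; connected_component (- G) y1 y2; \<not> connected_component (- H) y1 y2\<rbrakk>
         \<Longrightarrow> has_faces H (Suc k)"
proof -
  obtain R where R: "finite R" "card R = k" "R \<subseteq> - G"
      "pairwise (\<lambda>x y. \<not> connected_component (- G) x y) R"
    using assms(1) unfolding has_faces_def by blast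
  obtain h where h: "\<And>x. x \<notin> G \<Longrightarrow> connected_component (- G) x (h x) \<and> h x \<notin> H"
    using ex by metis
  have mono: "connected_component (- H) x y \<Longrightarrow> connected_component (- G) x y" for x y
    using assms(2) connected_component_of_subset[of "- H" x y "- G"] by auto
  have inj: "x = y" if "x \<in> R" "y \<in> R" "connected_component (- G) (h x) (h y)" for x y
  proof (rule ccontr)
    assume "x \<noteq> y"
    have "connected_component (- G) x y"
      using that h R(3) by (meson ComplD connected_component_sym connected_component_trans subsetD)
    then show False using R(4) that \<open>x \<noteq> y\<close> by (auto simp: pairwise_def)
  qed
  have hG: "h x \<notin> G" if "x \<in> R" for x using h R(3) that assms(2) by blast
  have injh: "inj_on h R"
    by (rule inj_onI) (metis inj hG connected_component_refl ComplI)
  have pw: "pairwise (\<lambda>x y. \<not> connected_component (- H) x y) (h ` R)"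
    unfolding pairwise_def using inj mono by blast
  show "has_faces H k"
    unfolding has_faces_def using R pw h
    by (intro exI[of _ "h ` R"]) (auto simp: card_image injh)
  show "has_faces H (Suc k)" if y: "y1 \<notin> H" "y2 \<notin> H" "connected_component (- G) y1 y2"
      "\<not> connected_component (- H) y1 y2"
  proof -
    define R0 where "R0 = {x\<in>R. \<not> connected_component (- G) (h x) y1}"
    have "x = x'" if "x \<in> R - R0" "x' \<in> R - R0" for x x'
      using that inj unfolding R0_def
      by (metis (no_types, lifting) DiffD1 DiffD2 connected_component_sym connected_component_trans mem_Collect_eq)
    then have "card (R - R0) \<le> 1"
      using card_le_Suc0_iff_eq[of "R - R0"] R(1) by fastforce
    then have c: "k \<le> card R0 + 1"
      using R(1,2) card_Diff_subset[of R0 R] unfolding R0_def by (auto simp: card_Diff_subset)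
    define Q where "Q = insert y1 (insert y2 (h ` R0))"
    have notcc: "\<not> connected_component (- G) (h x) y" if "x \<in> R0" "y \<in> {y1,y2}" for x y
      using that y(3) unfolding R0_def by (auto dest: connected_component_trans connected_component_sym)
    have yG: "y1 \<notin> G" "y2 \<notin> G" using y assms(2) by auto
    have "y1 \<noteq> y2" using y(1) y(4) by (auto simp: connected_component_refl)
    moreover have "y1 \<notin> h ` R0" "y2 \<notin> h ` R0"
      using notcc yG by (metis ComplI connected_component_refl imageE insertCI)+
    moreover have "finite R0" using R(1) unfolding R0_def by auto
    moreover have "card (h ` R0) = card R0"
      by (rule card_image, rule inj_on_subset[OF injh]) (auto simp: R0_def)
    ultimately have "card Q = card R0 + 2" "finite Q" unfolding Q_def by auto
    \<comment> \<open>\<open>Q\<close> has k + 2 points when no representative lay in the split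
      face, whereas \<open>has_faces\<close> demands an exact number.\<close>
    then obtain Q' where Q': "Q' \<subseteq> Q" "card Q' = Suc k" "finite Q'"
      using c obtain_subset_with_card_n[of "Suc k" Q] by (metis Suc_eq_plus1 Suc_le_mono add_2_eq_Suc' finite_subset)
    have pw2: "pairwise (\<lambda>x y. \<not> connected_component (- H) x y) Q"
      unfolding pairwise_def
    proof (intro ballI impI)
      fix a b assume "a \<in> Q" "b \<in> Q" "a \<noteq> b"
      then consider "a \<in> h ` R0" "b \<in> h ` R0" | "a \<in> {y1,y2}" "b \<in> h ` R0" | "b \<in> {y1,y2}" "a \<in> h ` R0"
        | "a = y1 \<and> b = y2 \<or> a = y2 \<and> b = y1"
        unfolding Q_def by blast
      then show "\<not> connected_component (- H) a b"
      proof cases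
        case 1
        then show ?thesis using pw \<open>a \<noteq> b\<close> unfolding pairwise_def R0_def by blast
      next
        case 2
        then show ?thesis using notcc mono connected_component_sym by blast
      next
        case 3
        then show ?thesis using notcc mono by blast
      next
        case 4
        then show ?thesis using y(4) connected_component_sym by blast
      qed
    qed
    have "Q \<subseteq> - H" unfolding Q_def R0_def using y h R by auto
    then show ?thesis unfolding has_faces_def
      using Q' pairwise_subset[OF pw2 Q'(1)] by (intro exI[of _ Q']) auto
  qed
qed

text \<open>An arc has empty interior by invariance of dimension, since the inverse of its
  parametrisation would embed an open set of the plane into the reals. Hence it cannot swallow an
  open component.\<close>

lemma arc_image_component_escape:
  fixes e :: "real \<Rightarrow> complex"
  assumes "closed G" "arc e" "x \<notin> G"
  shows "\<exists>x'. connected_component (- G) x x' \<and> x' \<notin> G \<union> path_image e"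
proof -
  let ?K = "connected_component_set (- G) x"
  have o: "open ?K" using assms(1) by (intro open_connected_component) auto
  have "x \<in> ?K" using assms by (simp add: connected_component_refl)
  have "interior (path_image e) = {}"
  proof (rule ccontr)
    assume "interior (path_image e) \<noteq> {}"
    moreover obtain h where "homeomorphism {0..1} (path_image e) e h"
      using homeomorphism_arc[OF assms(2)] by metis
    then have "continuous_on (path_image e) h" "inj_on h (path_image e)"
      by (auto simp: homeomorphism_def intro: inj_on_inverseI)
    then have "continuous_on (interior (path_image e)) h" "inj_on h (interior (path_image e))"
      using interior_subset continuous_on_subset inj_on_subset by blast+
    ultimately have "DIM(complex) \<le> DIM(real)"
      using invariance_of_dimension[of "interior (path_image e)" h] by blast
    then show False by simp
  qed
  then have "\<not> ?K \<subseteq> path_image e"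
    using o \<open>x \<in> ?K\<close> interior_maximal by blast
  then show ?thesis using connected_component_subset[of "- G" x] by blast
qed

text \<open>A path joining the ends inside \<open>G\<close> is reduced to an arc and closes
  \<open>e\<close> to a Jordan curve. Near the midpoint of \<open>e\<close> there are points on both
  sides of the curve, and a small ball there misses \<open>G\<close>, so it is \<open>e\<close> that
  cuts them apart.\<close>

lemma closing_arc_separates:
  fixes e :: "real \<Rightarrow> complex"
  assumes "closed G" "arc e"
    and disj: "(path_image e - {pathstart e, pathfinish e}) \<inter> G = {}"
    and pc: "path_component G (pathstart e) (pathfinish e)"
  obtains y1 y2 where "y1 \<notin> G \<union> path_image e" "y2 \<notin> G \<union> path_image e"
    "connected_component (- G) y1 y2" "\<not> connected_component (- (G \<union> path_image e)) y1 y2"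
proof -
  have ne: "pathfinish e \<noteq> pathstart e" using assms(2) arc_distinct_ends by blast
  obtain p where p: "path p" "path_image p \<subseteq> G" "pathstart p = pathfinish e" "pathfinish p = pathstart e"
    using path_component_sym[OF pc] unfolding path_component_def by auto
  obtain q where q: "arc q" "path_image q \<subseteq> G" "pathstart q = pathfinish e" "pathfinish q = pathstart e"
    using path_contains_arc[OF p(1,3,4) ne] p(2) by (metis subset_trans)
  define c where "c = e +++ q"
  have "path_image e \<inter> path_image q \<subseteq> {pathstart e, pathstart q}"
    using disj q by auto
  then have sc: "simple_path c" "pathfinish c = pathstart c"
    unfolding c_def using simple_path_join_loop[OF assms(2) q(1)] q by auto
  have imc: "path_image c = path_image e \<union> path_image q"
    unfolding c_def by (rule path_image_join) (use q in auto)
  let ?J = "path_image c"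
  note J = Jordan_inside_outside[OF sc]
  define m where "m = e (1/2)"
  have inj: "inj_on e {0..1}" using assms(2) by (simp add: arc_def)
  have m: "m \<in> path_image e" "m \<noteq> pathstart e" "m \<noteq> pathfinish e"
    using inj unfolding m_def path_image_def pathstart_def pathfinish_def
    by (auto simp: inj_on_eq_iff[OF inj])
  then have "m \<notin> G" using disj by auto
  then obtain r where r: "r > 0" "ball m r \<subseteq> - G"
    using assms(1) openE[of "- G" m] by auto
  have "m \<in> frontier (inside ?J)" "m \<in> frontier (outside ?J)" using J imc m by auto
  then have "m \<in> closure (inside ?J)" "m \<in> closure (outside ?J)" by (auto simp: frontier_def)
  then have "ball m r \<inter> inside ?J \<noteq> {}" "ball m r \<inter> outside ?J \<noteq> {}"
    using r(1) by (metis Int_commute open_Int_closure_eq_empty open_ball centre_in_ball disjoint_iff)+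
  then obtain y1 y2 where y: "y1 \<in> ball m r" "y1 \<in> inside ?J" "y2 \<in> ball m r" "y2 \<in> outside ?J"
    by blast
  have nJ: "y1 \<notin> ?J" "y2 \<notin> ?J" using y J by (auto simp: inside_def outside_def)
  show ?thesis
  proof
    show "y1 \<notin> G \<union> path_image e" "y2 \<notin> G \<union> path_image e" using nJ imc y r(2) by auto
    show "connected_component (- G) y1 y2"
      unfolding connected_component_def using y r(2) connected_ball by blast
    show "\<not> connected_component (- (G \<union> path_image e)) y1 y2"
    proof
      assume "connected_component (- (G \<union> path_image e)) y1 y2"
      then obtain T where T: "connected T" "T \<subseteq> - (G \<union> path_image e)" "y1 \<in> T" "y2 \<in> T"
        unfolding connected_component_def by blast
      have "T \<subseteq> - ?J" using T(2) imc q(2) by blast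
      moreover have io: "inside ?J \<inter> outside ?J = {}" "inside ?J \<union> outside ?J = - ?J"
        "open (inside ?J)" "open (outside ?J)" using J by auto
      ultimately have "T \<subseteq> inside ?J \<union> outside ?J" by simp
      then show False using connectedD[OF T(1) io(3,4)] io(1) T(3,4) y(2,4) by blast
    qed
  qed
qed

text \<open>The half V - E + F >= 2 of Euler's formula, by adding one arc at a time: a new arc
  either merges two classes of vertices or closes a cycle, and in the second case the Jordan curve
  argument supplies a face.\<close>

lemma planar_graph_faces:
  fixes g :: "'i \<Rightarrow> real \<Rightarrow> complex"
  assumes "finite I" "finite A" "A \<noteq> {}"
    and "\<And>i. i \<in> I \<Longrightarrow> arc (g i)"
    and "\<And>i. i \<in> I \<Longrightarrow> pathstart (g i) \<in> A \<and> pathfinish (g i) \<in> A"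
    and "\<And>i. i \<in> I \<Longrightarrow> (path_image (g i) - {pathstart (g i), pathfinish (g i)}) \<inter> A = {}"
    and "\<And>i j. \<lbrakk>i \<in> I; j \<in> I; i \<noteq> j\<rbrakk> \<Longrightarrow>
         (path_image (g i) - {pathstart (g i), pathfinish (g i)}) \<inter>
         (path_image (g j) - {pathstart (g j), pathfinish (g j)}) = {}"
  shows "\<exists>k. has_faces (A \<union> (\<Union>i\<in>I. path_image (g i))) k \<and> card I + 2 \<le> k + card A"
proof -
  \<comment> \<open>The labelling \<open>l\<close> groups vertices already known to be joined by
    paths in the graph built so far. Every arc removes a label or adds a face, which preserves E + 1
    + labels <= F + V.\<close>
  have "\<exists>k l. has_faces (A \<union> (\<Union>i\<in>I. path_image (g i))) k \<and>
          (\<forall>x\<in>A. l x \<in> A) \<and>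
          (\<forall>x\<in>A. \<forall>y\<in>A. l x = l y \<longrightarrow> path_component (A \<union> (\<Union>i\<in>I. path_image (g i))) x y) \<and>
          card I + 1 + card (l ` A) \<le> k + card A"
    using assms(1) assms(4-)
  proof (induction I rule: finite_induct)
    case empty
    obtain x where "x \<notin> A" using assms(2) by (metis ex_new_if_finite infinite_UNIV_char_0)
    then have "has_faces A 1" unfolding has_faces_def
      by (intro exI[of _ "{x}"]) auto
    then show ?case
      by (intro exI[of _ 1] exI[of _ id]) (auto simp: path_component_refl)
  next
    case (insert i I)
    define G where "G = A \<union> (\<Union>i\<in>I. path_image (g i))"
    have G': "A \<union> (\<Union>i\<in>insert i I. path_image (g i)) = G \<union> path_image (g i)"
      unfolding G_def by auto
    obtain k l where k: "has_faces G k" "\<And>x. x\<in>A \<Longrightarrow> l x \<in> A"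
        "\<And>x y. \<lbrakk>x\<in>A; y\<in>A; l x = l y\<rbrakk> \<Longrightarrow> path_component G x y"
        "card I + 1 + card (l ` A) \<le> k + card A"
    proof -
      have "\<exists>k l. has_faces G k \<and> (\<forall>x\<in>A. l x \<in> A) \<and>
          (\<forall>x\<in>A. \<forall>y\<in>A. l x = l y \<longrightarrow> path_component G x y) \<and>
          card I + 1 + card (l ` A) \<le> k + card A"
        unfolding G_def by (rule insert.IH) (rule insert.prems; simp)+
      then show ?thesis using that by blast
    qed
    let ?a = "pathstart (g i)" and ?b = "pathfinish (g i)"
    have ab: "?a \<in> A" "?b \<in> A" and arci: "arc (g i)" using insert.prems by auto
    have clG: "closed G" unfolding G_def using insert.prems insert.hyps assms(2)
      by (intro closed_Un closed_UN) (auto simp: finite_imp_closed closed_arc_image)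
    have disj: "(path_image (g i) - {?a, ?b}) \<inter> G = {}"
    proof -
      have "x \<notin> path_image (g j)" if x: "x \<in> path_image (g i) - {?a,?b}" and j: "j \<in> I" for x j
      proof
        assume "x \<in> path_image (g j)"
        moreover have "i \<noteq> j" using insert.hyps j by auto
        ultimately have "x = pathstart (g j) \<or> x = pathfinish (g j)"
          using insert.prems(4)[of i j] x j by blast
        then have "x \<in> A" using insert.prems(2) j by auto
        then show False using insert.prems(3)[of i] x by auto
      qed
      then show ?thesis unfolding G_def using insert.prems(3)[of i] by blast
    qed
    have escape: "\<exists>x'. connected_component (- G) x x' \<and> x' \<notin> G \<union> path_image (g i)" if "x \<notin> G" for x
      using arc_image_component_escape[OF clG arci that] .
    note fmono = has_faces_superset[OF k(1) Un_upper1 escape]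
    have pmono: "path_component G x y \<Longrightarrow> path_component (G \<union> path_image (g i)) x y" for x y
      by (rule path_component_of_subset) auto
    have cI: "card (insert i I) = card I + 1" using insert.hyps by simp
    show ?case
    proof (cases "l ?a = l ?b")
      case True
      then have "path_component G ?a ?b" using k(3) ab by auto
      then obtain y1 y2 where y: "y1 \<notin> G \<union> path_image (g i)" "y2 \<notin> G \<union> path_image (g i)"
        "connected_component (- G) y1 y2" "\<not> connected_component (- (G \<union> path_image (g i))) y1 y2"
        using closing_arc_separates[OF clG arci disj] by metis
      have "has_faces (G \<union> path_image (g i)) (Suc k)"
        by (rule fmono(2)[OF _ y]) auto
      then show ?thesis unfolding G'
        using k pmono cI by (intro exI[of _ "Suc k"] exI[of _ l]) auto
    next
      case False
      \<comment> \<open>The new arc joins the two classes, so the label of its start is replaced by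
        that of its end.\<close>
      define l' where "l' = (\<lambda>x. if l x = l ?a then l ?b else l x)"
      have "l' ` A \<subseteq> l ` A - {l ?a}" unfolding l'_def using ab False by auto
      then have "card (l' ` A) \<le> card (l ` A - {l ?a})" using assms(2) by (intro card_mono) auto
      moreover have "card (l ` A - {l ?a}) < card (l ` A)" using ab assms(2) by (intro psubset_card_mono) auto
      ultimately have c: "card (l' ` A) + 1 \<le> card (l ` A)" by simp
      have pab: "path_component (G \<union> path_image (g i)) ?a ?b"
        unfolding path_component_def using arc_imp_path[OF arci] by blast
      have "path_component (G \<union> path_image (g i)) x y" if xy: "x \<in> A" "y \<in> A" "l' x = l' y" for x y
      proof -
        consider "l x = l y" | "l x = l ?a" "l y = l ?b" | "l y = l ?a" "l x = l ?b"
          using xy(3) unfolding l'_def by (auto split: if_splits)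
        then show ?thesis
          by cases (metis k(3) xy ab pmono pab path_component_sym path_component_trans)+
      qed
      moreover have "has_faces (G \<union> path_image (g i)) k"
        by (rule fmono(1)) auto
      ultimately show ?thesis unfolding G'
        using k c ab cI by (intro exI[of _ k] exI[of _ l']) (auto simp: l'_def)
    qed
  qed
  then obtain k and l :: "complex \<Rightarrow> complex" where "has_faces (A \<union> (\<Union>i\<in>I. path_image (g i))) k"
    "card I + 1 + card (l ` A) \<le> k + card A" by blast
  moreover have "card (l ` A) \<ge> 1" using assms(2,3) by (simp add: Suc_leI card_gt_0_iff)
  ultimately show ?thesis by (intro exI[of _ k]) auto
qed

section \<open>Local degrees\<close>

lemma openin_homeomorphism_image:
  assumes "homeomorphism U B \<phi> \<phi>'" "openin (top_of_set S) U" "openin (top_of_set B) V"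
  shows "openin (top_of_set S) (U \<inter> \<phi> -` V)"
proof -
  have "openin (top_of_set U) (U \<inter> \<phi> -` V)"
    using assms continuous_openin_preimage[of U \<phi> B V] by (auto simp: homeomorphism_def)
  then show ?thesis using assms(2) openin_trans by blast
qed

text \<open>The map z ^ d pulls the disc of radius r ^ d back to the disc of radius r. So when the
  source disc is shrunk to fit into \<open>N\<close> and the target disc accordingly, all d roots of
  a nearby value remain in \<open>U\<close>. Away from 0 the power map is a covering, hence locally
  injective.\<close>

lemma local_model_nbhd:
  assumes lm: "local_model S S' f x d" and N: "openin (top_of_set S) N" "x \<in> N"
  obtains U W where "openin (top_of_set S) U" "x \<in> U" "U \<subseteq> N"
    "openin (top_of_set S') W" "f x \<in> W" "f ` U \<subseteq> W"
    "\<And>y. \<lbrakk>y \<in> W; y \<noteq> f x\<rbrakk> \<Longrightarrow> card {x'\<in>U. f x' = y} = d"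
    "\<And>x'. \<lbrakk>x' \<in> U; f x' = f x\<rbrakk> \<Longrightarrow> x' = x"
    "\<And>x'. \<lbrakk>x' \<in> U; x' \<noteq> x\<rbrakk> \<Longrightarrow> \<exists>N'. openin (top_of_set S) N' \<and> x' \<in> N' \<and> inj_on f N'"
    "d = 1 \<Longrightarrow> \<exists>k. homeomorphism U W f k"
proof -
  have d1: "d \<ge> 1" using lm by (simp add: local_model_def)
  from lm obtain U0 W0 \<phi> \<phi>' \<psi> \<psi>' where
    U0: "openin (top_of_set S) U0" "x \<in> U0" and W0: "openin (top_of_set S') W0"
    and fU: "f ` U0 \<subseteq> W0"
    and \<phi>: "homeomorphism U0 (ball (0::complex) 1) \<phi> \<phi>'"
    and \<psi>: "homeomorphism W0 (ball (0::complex) 1) \<psi> \<psi>'"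
    and 0: "\<phi> x = 0" "\<psi> (f x) = 0" and pw: "\<And>y. y\<in>U0 \<Longrightarrow> \<psi> (f y) = (\<phi> y) ^ d"
    unfolding local_model_def by blast
  have \<phi>': "\<And>u. u \<in> U0 \<Longrightarrow> \<phi>' (\<phi> u) = u \<and> norm (\<phi> u) < 1" "\<And>z. norm z < 1 \<Longrightarrow> \<phi> (\<phi>' z) = z \<and> \<phi>' z \<in> U0"
    using \<phi> by (auto simp: homeomorphism_def)
  have \<psi>': "\<And>u. u \<in> W0 \<Longrightarrow> \<psi>' (\<psi> u) = u \<and> norm (\<psi> u) < 1" "\<And>z. norm z < 1 \<Longrightarrow> \<psi> (\<psi>' z) = z \<and> \<psi>' z \<in> W0"
    using \<psi> by (auto simp: homeomorphism_def)
  have feq: "f u = y \<longleftrightarrow> \<phi> u ^ d = \<psi> y" if "u \<in> U0" "y \<in> W0" for u y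
    using that pw fU \<psi>'(1) by (metis image_subset_iff)
  have fx: "f x \<in> W0" using U0 fU by auto
  have "openin (top_of_set (ball 0 1)) (\<phi> ` (U0 \<inter> N))"
    by (rule homeomorphism_imp_open_map[OF \<phi>]) (metis U0(1) N(1) openin_Int Int_lower1 openin_imp_subset openin_subset_trans)
  then have "open (\<phi> ` (U0 \<inter> N))" by (simp add: openin_open_eq)
  moreover have "0 \<in> \<phi> ` (U0 \<inter> N)" using 0 U0 N by force
  ultimately obtain r0 where r0: "r0 > 0" "ball 0 r0 \<subseteq> \<phi> ` (U0 \<inter> N)" by (meson openE)
  define r where "r = min r0 1"
  have r: "r > 0" "r \<le> 1" "ball 0 r \<subseteq> \<phi> ` (U0 \<inter> N)" using r0 by (auto simp: r_def)
  have rd: "r ^ d > 0" "r ^ d \<le> 1" using r by (auto intro: power_le_one)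
  define U where "U = U0 \<inter> \<phi> -` ball 0 r"
  define W where "W = W0 \<inter> \<psi> -` ball 0 (r ^ d)"
  have root: "norm z < r" if "norm (z ^ d) < r ^ d" for z :: complex
    using that r d1 by (metis norm_power power_less_imp_less_base less_imp_le)
  show ?thesis
  proof
    show "openin (top_of_set S) U" unfolding U_def
      by (rule openin_homeomorphism_image[OF \<phi> U0(1)]) (use r in \<open>auto simp: openin_open_eq\<close>)
    show "openin (top_of_set S') W" unfolding W_def
      by (rule openin_homeomorphism_image[OF \<psi> W0(1)]) (use rd in \<open>auto simp: openin_open_eq\<close>)
    show "x \<in> U" "f x \<in> W" unfolding U_def W_def using U0 0 r rd fx by auto
    show "U \<subseteq> N"
    proof
      fix u assume "u \<in> U"
      then obtain n where "n \<in> U0" "n \<in> N" "\<phi> u = \<phi> n" "u \<in> U0" using r(3) unfolding U_def by blast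
      then show "u \<in> N" using \<phi>' by metis
    qed
    show "f ` U \<subseteq> W"
      unfolding U_def W_def using fU pw d1 by (auto simp: norm_power intro!: power_strict_mono)
    show "card {x'\<in>U. f x' = y} = d" if y: "y \<in> W" "y \<noteq> f x" for y
    proof -
      have yW: "y \<in> W0" "norm (\<psi> y) < r ^ d" using y unfolding W_def by auto
      have n0: "\<psi> y \<noteq> 0" using y yW fx 0 \<psi>' by metis
      have "bij_betw \<phi> {x'\<in>U. f x' = y} {z. z ^ d = \<psi> y}"
      proof (rule bij_betw_byWitness[where f' = \<phi>'])
        show "\<forall>a\<in>{x' \<in> U. f x' = y}. \<phi>' (\<phi> a) = a" using \<phi>' by (auto simp: U_def)
        have lt: "norm z < r" "norm z < 1" if "z ^ d = \<psi> y" for z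
          using root[of z] that yW r by auto
        then show "\<forall>a'\<in>{z. z ^ d = \<psi> y}. \<phi> (\<phi>' a') = a'" using \<phi>' by auto
        show "\<phi> ` {x' \<in> U. f x' = y} \<subseteq> {z. z ^ d = \<psi> y}" using pw unfolding U_def by force
        show "\<phi>' ` {z. z ^ d = \<psi> y} \<subseteq> {x' \<in> U. f x' = y}"
          using lt \<phi>' feq yW unfolding U_def by auto
      qed
      then have "card {x'\<in>U. f x' = y} = card {z. z ^ d = \<psi> y}" by (rule bij_betw_same_card)
      then show ?thesis using card_nth_roots[OF n0, of d] d1 by auto
    qed
    show "x' = x" if "x' \<in> U" "f x' = f x" for x'
    proof -
      have "\<phi> x' ^ d = 0" using that feq[of x' "f x"] fx 0 unfolding U_def by auto
      then have "\<phi> x' = \<phi> x" using 0 by auto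
      then show ?thesis using that U0 \<phi>' unfolding U_def by (metis IntD1)
    qed
    show "\<exists>N'. openin (top_of_set S) N' \<and> x' \<in> N' \<and> inj_on f N'" if x': "x' \<in> U" "x' \<noteq> x" for x'
    proof -
      have x'0: "x' \<in> U0" using x' unfolding U_def by auto
      have c: "\<phi> x' \<noteq> 0" using x' x'0 U0 \<phi>' 0 by metis
      have "covering_space (- {0::complex}) (\<lambda>z. z ^ d) (- {0})"
        using covering_space_power_punctured_plane[of d] d1 by auto
      then obtain T u q where T: "\<phi> x' \<in> T" "openin (top_of_set (- {0})) T" "homeomorphism T u (\<lambda>z. z ^ d) q"
        using c covering_space_local_homeomorphism by (metis ComplI singletonD)
      have oT: "open T" using T(2) by (rule openin_open_trans) auto
      have "inj_on (\<lambda>z. z ^ d) T" using T(3) by (auto simp: homeomorphism_def intro: inj_on_inverseI)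
      then have "inj_on f (U0 \<inter> \<phi> -` (T \<inter> ball 0 1))"
        using pw \<phi>' unfolding inj_on_def by (metis IntD1 IntD2 vimageE)
      moreover have "openin (top_of_set S) (U0 \<inter> \<phi> -` (T \<inter> ball 0 1))"
        by (rule openin_homeomorphism_image[OF \<phi> U0(1)]) (use oT in \<open>auto simp: openin_open_eq\<close>)
      ultimately show ?thesis using x'0 T(1) \<phi>' by (intro exI[of _ "U0 \<inter> \<phi> -` (T \<inter> ball 0 1)"]) auto
    qed
    show "\<exists>k. homeomorphism U W f k" if "d = 1"
    proof -
      have "continuous_on W (\<lambda>w. \<phi>' (\<psi> w))"
        by (rule continuous_on_compose2[of "ball 0 1" \<phi>']) (use \<phi> \<psi> \<psi>' in \<open>auto simp: homeomorphism_def W_def intro: continuous_on_subset\<close>)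
      moreover have fe: "f u = \<psi>' (\<phi> u)" if "u \<in> U0" for u using pw[OF that] \<psi>'(1)[of "f u"] fU \<open>d = 1\<close> that by auto
      moreover have "continuous_on U (\<lambda>u. \<psi>' (\<phi> u))"
        by (rule continuous_on_compose2[of "ball 0 1" \<psi>']) (use \<phi> \<psi> \<phi>' in \<open>auto simp: homeomorphism_def U_def intro: continuous_on_subset\<close>)
      moreover have "continuous_on U f"
        using calculation(3) by (rule continuous_on_eq) (simp add: fe U_def)
      ultimately have "homeomorphism U W f (\<lambda>w. \<phi>' (\<psi> w))"
        by (intro homeomorphismI) (use \<phi>' \<psi>' r that in \<open>auto simp: U_def W_def fe\<close>)
      then show ?thesis by blast
    qed
  qed
qed

text \<open>The target is locally a disc, where single points are not open. This supplies the nearby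
  value at which preimages are counted.\<close>

lemma local_model_not_isolated:
  assumes lm: "local_model S S' f x d" and V: "openin (top_of_set S') V" "f x \<in> V"
  shows "\<exists>y\<in>V. y \<noteq> f x"
proof -
  from lm obtain U0 W0 \<psi> \<psi>' where
    "x \<in> U0" "f ` U0 \<subseteq> W0" and W0: "openin (top_of_set S') W0"
    and \<psi>: "homeomorphism W0 (ball (0::complex) 1) \<psi> \<psi>'"
    unfolding local_model_def by blast
  then have "f x \<in> W0" by auto
  have "openin (top_of_set (ball 0 1)) (\<psi> ` (W0 \<inter> V))"
    by (rule homeomorphism_imp_open_map[OF \<psi>]) (metis W0(1) V(1) openin_Int Int_lower1 openin_imp_subset openin_subset_trans)
  then have "open (\<psi> ` (W0 \<inter> V))" by (simp add: openin_open_eq)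
  then have "\<psi> ` (W0 \<inter> V) \<noteq> {\<psi> (f x)}" using not_open_singleton by metis
  moreover have "W0 \<inter> V = {f x}" if "\<forall>y\<in>V. y = f x" using that \<open>f x \<in> W0\<close> V(2) by blast
  ultimately show ?thesis by fastforce
qed

lemma local_model_inj:
  assumes lm: "local_model S S' f x d" and N: "openin (top_of_set S) N" "x \<in> N" "inj_on f N"
  shows "d = 1"
proof -
  have d1: "d \<ge> 1" using lm by (simp add: local_model_def)
  obtain U W where UW: "U \<subseteq> N" "openin (top_of_set S') W" "f x \<in> W"
    "\<And>y. \<lbrakk>y \<in> W; y \<noteq> f x\<rbrakk> \<Longrightarrow> card {x'\<in>U. f x' = y} = d"
    using local_model_nbhd[OF lm N(1,2)] by metis
  obtain y where y: "y \<in> W" "y \<noteq> f x" using local_model_not_isolated[OF lm UW(2,3)] by blast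
  have "\<forall>a\<in>{x'\<in>U. f x' = y}. \<forall>b\<in>{x'\<in>U. f x' = y}. a = b"
    using N(3) UW(1) by (auto simp: inj_on_def)
  moreover have "card {x'\<in>U. f x' = y} = d" using UW y by auto
  ultimately show ?thesis using d1
    by (metis (mono_tags, lifting) One_nat_def card_le_Suc0_iff_eq card.infinite le_antisym not_one_le_zero)
qed

text \<open>The exponent can be read off as the number of preimages of a nearby value, and the
  second neighbourhood can be taken inside the first. Applied in both directions, this gives the
  uniqueness that the \<open>THE\<close> in \<open>local_degree\<close> relies on.\<close>

lemma local_model_unique_le:
  assumes lm: "local_model S S' f x d" "local_model S S' f x d'"
  shows "d' \<le> d"
proof -
  have d1: "d \<ge> 1" using lm by (simp add: local_model_def)
  obtain U0 where U0: "openin (top_of_set S) U0" "x \<in> U0" using lm(1) unfolding local_model_def by metis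
  obtain U W where UW: "openin (top_of_set S) U" "x \<in> U" "openin (top_of_set S') W" "f x \<in> W"
    "\<And>y. \<lbrakk>y \<in> W; y \<noteq> f x\<rbrakk> \<Longrightarrow> card {x'\<in>U. f x' = y} = d"
    using local_model_nbhd[OF lm(1) U0] by metis
  obtain U' W' where UW': "U' \<subseteq> U" "openin (top_of_set S') W'" "f x \<in> W'"
    "\<And>y. \<lbrakk>y \<in> W'; y \<noteq> f x\<rbrakk> \<Longrightarrow> card {x'\<in>U'. f x' = y} = d'"
    using local_model_nbhd[OF lm(2) UW(1,2)] by metis
  obtain y where y: "y \<in> W" "y \<in> W'" "y \<noteq> f x"
    using local_model_not_isolated[OF lm(1), of "W \<inter> W'"] UW UW' by auto
  have c: "card {x'\<in>U. f x' = y} = d" "card {x'\<in>U'. f x' = y} = d'" using y UW UW' by auto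
  moreover have "finite {x'\<in>U. f x' = y}" using c(1) d1 by (intro card_ge_0_finite) simp
  then have "card {x'\<in>U'. f x' = y} \<le> card {x'\<in>U. f x' = y}" using UW'(1) by (intro card_mono) auto
  ultimately show ?thesis by simp
qed

lemma local_degree_eq: "local_model S S' f x d \<Longrightarrow> local_degree S S' f x = d"
  unfolding local_degree_def by (rule the_equality) (auto intro: le_antisym local_model_unique_le)

lemma local_model_local_degree:
  assumes "branched_covering S S' f" "x \<in> S"
  shows "local_model S S' f x (local_degree S S' f x)"
  using assms local_degree_eq unfolding branched_covering_def by metis

lemma local_degree_ge_1:
  assumes "branched_covering S S' f" "x \<in> S"
  shows "local_degree S S' f x \<ge> 1"
  using local_model_local_degree[OF assms] by (simp add: local_model_def)

lemma local_degree_locally_injective: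
  assumes "branched_covering S S' f" "openin (top_of_set S) N" "x \<in> N" "inj_on f N"
  shows "local_degree S S' f x = 1"
  using assms local_model_inj local_model_local_degree openin_imp_subset by blast

section \<open>Fibres of branched coverings\<close>

text \<open>An infinite fibre in a compact set accumulates at some point, which belongs to the
  closed fibre again; but the local model isolates every point in its fibre.\<close>

lemma branched_covering_finite_fibre:
  fixes S S' :: "'a::metric_space set"
  assumes "compact S" "branched_covering S S' f"
  shows "finite {x\<in>S. f x = y}"
proof (rule ccontr)
  assume "infinite {x\<in>S. f x = y}"
  then obtain l where l: "l \<in> S" "l islimpt {x\<in>S. f x = y}"
    using Heine_Borel_imp_Bolzano_Weierstrass[OF assms(1), of "{x\<in>S. f x = y}"] by auto
  have cont: "continuous_on S f" using assms(2) by (simp add: branched_covering_def)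
  have "closed {x\<in>S. f x = y}"
    using continuous_closed_preimage_constant[OF cont] assms(1) compact_imp_closed by blast
  then have fl: "f l = y" using l closed_limpt by blast
  have "openin (top_of_set S) S" by simp
  from local_model_nbhd[OF local_model_local_degree[OF assms(2) l(1)] this l(1)]
  obtain U where U: "openin (top_of_set S) U" "l \<in> U" "\<And>x'. \<lbrakk>x' \<in> U; f x' = f l\<rbrakk> \<Longrightarrow> x' = l"
    by metis
  then obtain O' where "open O'" "U = S \<inter> O'" by (auto simp: openin_open)
  then obtain x' where "x' \<in> S" "f x' = y" "x' \<in> O'" "x' \<noteq> l"
    using l(2) U(2) unfolding islimpt_def by auto
  then show False using U(3) fl \<open>U = S \<inter> O'\<close> by auto
qed

text \<open>Tube lemma for the compact \<open>S\<close>: the image of \<open>S - N\<close> is closed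
  and misses \<open>y\<close>.\<close>

lemma fibre_tube:
  fixes S S' :: "'a::metric_space set"
  assumes "compact S" "continuous_on S f" "y \<in> S'" "openin (top_of_set S) N" "{x\<in>S. f x = y} \<subseteq> N"
  obtains W where "openin (top_of_set S') W" "y \<in> W" "S \<inter> f -` W \<subseteq> N"
proof
  have "compact (S - N)" using assms(1,4)
    by (metis Diff_Diff_Int closedin_compact closedin_diff closedin_subtopology_refl inf.absorb_iff2 topspace_euclidean_subtopology subset_UNIV topspace_euclidean)
  then have "compact (f ` (S - N))"
    using assms(2) by (metis compact_continuous_image continuous_on_subset Diff_subset)
  then show "openin (top_of_set S') (S' - f ` (S - N))"
    by (metis Diff_eq compact_imp_closed open_Compl openin_open_Int)
  show "y \<in> S' - f ` (S - N)" using assms by auto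
  show "S \<inter> f -` (S' - f ` (S - N)) \<subseteq> N" by auto
qed

lemma finite_separating_radius:
  fixes P :: "'a::metric_space set"
  assumes "finite P"
  obtains r where "r > 0" "\<And>x y. \<lbrakk>x \<in> P; y \<in> P; x \<noteq> y\<rbrakk> \<Longrightarrow> ball x r \<inter> ball y r = {}"
proof -
  have "\<forall>a\<in>P. \<exists>\<delta>>0. \<forall>x\<in>P. x \<noteq> a \<longrightarrow> \<delta> \<le> dist a x" using finite_set_avoid[OF assms] by blast
  then obtain \<delta> where \<delta>: "\<And>a. a \<in> P \<Longrightarrow> \<delta> a > 0 \<and> (\<forall>x\<in>P. x \<noteq> a \<longrightarrow> \<delta> a \<le> dist a x)"
    by metis
  define r where "r = Min (insert 1 (\<delta> ` P)) / 2"
  have r: "r > 0" "\<And>a. a \<in> P \<Longrightarrow> 2 * r \<le> \<delta> a"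
    using assms \<delta> by (auto simp: r_def)
  show ?thesis
  proof (rule that[OF r(1)])
    fix x y assume xy: "x \<in> P" "y \<in> P" "x \<noteq> y"
    then have "2 * r \<le> dist x y" using r(2)[of x] \<delta>[of x] by force
    then show "ball x r \<inter> ball y r = {}"
      by (auto simp: disjoint_iff) (metis dist_commute dist_triangle_half_r dist_triangle_less_add not_le mult_2 add_less_cancel_left linorder_not_less)
  qed
qed

text \<open>The fibre is finite, so local models can be placed on disjoint sheets, and the tube
  lemma leaves no preimage of \<open>W\<close> outside them. As \<open>W\<close> is cut down to
  serve all sheets at once, a sheet of degree one is only claimed to be homeomorphic to some
  \<open>V\<close> containing \<open>W\<close>.\<close>

lemma branched_covering_nbhd:
  fixes S S' :: "'a::metric_space set"
  assumes cS: "compact S" and bc: "branched_covering S S' f" and y: "y \<in> S'"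
  obtains U W where "openin (top_of_set S') W" "y \<in> W"
    "\<And>x. \<lbrakk>x \<in> S; f x = y\<rbrakk> \<Longrightarrow> openin (top_of_set S) (U x) \<and> x \<in> U x"
    "\<And>x x'. \<lbrakk>x \<in> S; f x = y; x' \<in> S; f x' = y; x \<noteq> x'\<rbrakk> \<Longrightarrow> U x \<inter> U x' = {}"
    "S \<inter> f -` W \<subseteq> (\<Union>x\<in>{x\<in>S. f x = y}. U x)"
    "\<And>x y'. \<lbrakk>x \<in> S; f x = y; y' \<in> W; y' \<noteq> y\<rbrakk> \<Longrightarrow> card {x'\<in>U x. f x' = y'} = local_degree S S' f x"
    "\<And>x x'. \<lbrakk>x \<in> S; f x = y; x' \<in> U x; f x' \<noteq> y\<rbrakk> \<Longrightarrow> local_degree S S' f x' = 1"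
    "\<And>x. \<lbrakk>x \<in> S; f x = y; local_degree S S' f x = 1\<rbrakk> \<Longrightarrow> \<exists>V k. W \<subseteq> V \<and> homeomorphism (U x) V f k"
proof -
  define P where "P = {x\<in>S. f x = y}"
  have fin: "finite P" unfolding P_def by (rule branched_covering_finite_fibre[OF cS bc])
  have cont: "continuous_on S f" using bc by (simp add: branched_covering_def)
  obtain r where r: "r > 0" "\<And>x y. \<lbrakk>x \<in> P; y \<in> P; x \<noteq> y\<rbrakk> \<Longrightarrow> ball x r \<inter> ball y r = {}"
    using finite_separating_radius[OF fin] by metis
  define Q where "Q = (\<lambda>x U W. openin (top_of_set S) U \<and> x \<in> U \<and> U \<subseteq> S \<inter> ball x r \<and> openin (top_of_set S') W \<and> y \<in> W \<and>
      (\<forall>y'\<in>W. y' \<noteq> y \<longrightarrow> card {x'\<in>U. f x' = y'} = local_degree S S' f x) \<and>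
      (\<forall>x'\<in>U. x' \<noteq> x \<longrightarrow> local_degree S S' f x' = 1) \<and>
      (local_degree S S' f x = 1 \<longrightarrow> (\<exists>k. homeomorphism U W f k)))"
  have "\<exists>U W. Q x U W" if "x \<in> P" for x
  proof -
    have x: "x \<in> S" "f x = y" using that by (auto simp: P_def)
    have op: "openin (top_of_set S) (S \<inter> ball x r)" "x \<in> S \<inter> ball x r" using x r by auto
    obtain U W where UW: "openin (top_of_set S) U" "x \<in> U" "U \<subseteq> S \<inter> ball x r"
    "openin (top_of_set S') W" "f x \<in> W" "f ` U \<subseteq> W"
    "\<And>y. \<lbrakk>y \<in> W; y \<noteq> f x\<rbrakk> \<Longrightarrow> card {x'\<in>U. f x' = y} = local_degree S S' f x"
    "\<And>x'. \<lbrakk>x' \<in> U; f x' = f x\<rbrakk> \<Longrightarrow> x' = x"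
    "\<And>x'. \<lbrakk>x' \<in> U; x' \<noteq> x\<rbrakk> \<Longrightarrow> \<exists>N'. openin (top_of_set S) N' \<and> x' \<in> N' \<and> inj_on f N'"
    "local_degree S S' f x = 1 \<Longrightarrow> \<exists>k. homeomorphism U W f k"
      by (rule local_model_nbhd[OF local_model_local_degree[OF bc x(1)] op]) (rule that)
    have ld: "local_degree S S' f x' = 1" if "x' \<in> U" "x' \<noteq> x" for x'
      using UW(9)[OF that] local_degree_locally_injective[OF bc] by blast
    show ?thesis unfolding Q_def
      by (intro exI[of _ U] exI[of _ W] conjI ballI impI) (rule UW[unfolded x(2)] ld; assumption)+
  qed
  then obtain U Wf where Q: "\<And>x. x \<in> P \<Longrightarrow> Q x (U x) (Wf x)" by metis
  have UW: "\<And>x. x \<in> P \<Longrightarrow> openin (top_of_set S) (U x) \<and> x \<in> U x \<and> U x \<subseteq> S \<inter> ball x r \<and>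
      openin (top_of_set S') (Wf x) \<and> y \<in> Wf x \<and>
      (\<forall>y'\<in>Wf x. y' \<noteq> y \<longrightarrow> card {x'\<in>U x. f x' = y'} = local_degree S S' f x) \<and>
      (\<forall>x'\<in>U x. x' \<noteq> x \<longrightarrow> local_degree S S' f x' = 1) \<and>
      (local_degree S S' f x = 1 \<longrightarrow> (\<exists>k. homeomorphism (U x) (Wf x) f k))" for x
    using Q unfolding Q_def by blast
  have "openin (top_of_set S) (\<Union>x\<in>P. U x)" using UW by blast
  moreover have "{x\<in>S. f x = y} \<subseteq> (\<Union>x\<in>P. U x)" using UW by (auto simp: P_def)
  ultimately obtain W0 where W0: "openin (top_of_set S') W0" "y \<in> W0" "S \<inter> f -` W0 \<subseteq> (\<Union>x\<in>P. U x)"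
    using fibre_tube[OF cS cont y] by metis
  have "P \<noteq> {}" using bc y by (auto simp: branched_covering_def P_def)
  define W where "W = W0 \<inter> (\<Inter>x\<in>P. Wf x)"
  have "openin (top_of_set S') (\<Inter>x\<in>P. Wf x)"
    using fin \<open>P \<noteq> {}\<close> UW by (intro openin_Inter) auto
  then have 1: "openin (top_of_set S') W" unfolding W_def using W0 by auto
  have 2: "y \<in> W" unfolding W_def using W0 UW by auto
  have 3: "U x \<inter> U x' = {}" if "x \<in> P" "x' \<in> P" "x \<noteq> x'" for x x'
    using UW[OF that(1)] UW[OF that(2)] r(2)[OF that] by blast
  have 4: "S \<inter> f -` W \<subseteq> (\<Union>x\<in>P. U x)" using W0(3) unfolding W_def by blast
  have 5: "\<exists>V k. W \<subseteq> V \<and> homeomorphism (U x) V f k" if "x \<in> P" "local_degree S S' f x = 1" for x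
    using UW[OF that(1)] that unfolding W_def by (intro exI[of _ "Wf x"]) auto
  have 6: "card {x'\<in>U x. f x' = y'} = local_degree S S' f x" if "x \<in> P" "y' \<in> W" "y' \<noteq> y" for x y'
    using UW[OF that(1)] that unfolding W_def by blast
  have 7: "local_degree S S' f x' = 1" if "x \<in> P" "x' \<in> U x" "f x' \<noteq> y" for x x'
  proof -
    have "x' \<noteq> x" using that by (auto simp: P_def)
    then show ?thesis using UW[OF that(1)] that(2) by blast
  qed
  have 8: "openin (top_of_set S) (U x) \<and> x \<in> U x" if "x \<in> P" for x
    using UW[OF that] by blast
  have PI: "x \<in> P" if "x \<in> S" "f x = y" for x using that by (simp add: P_def)
  show ?thesis
  proof (rule that[of W U])
    show "openin (top_of_set S') W" by (fact 1)
    show "y \<in> W" by (fact 2)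
    show "S \<inter> f -` W \<subseteq> (\<Union>x\<in>{x\<in>S. f x = y}. U x)" using 4 unfolding P_def .
  qed (rule 8[OF PI] 3[OF PI PI] 5[OF PI] 6[OF PI] 7[OF PI]; assumption)+
qed

text \<open>On passing from \<open>a\<close> to a nearby value, a fibre point of local degree d is
  replaced by d points of local degree 1, so the sum is locally constant. Hence the point chosen by
  \<open>SOME\<close> in \<open>bc_degree\<close> does not matter.\<close>

lemma fibre_sum_constant:
  fixes S S' :: "'a::metric_space set"
  assumes cS: "compact S" and bc: "branched_covering S S' f" and conn: "connected S'"
    and y: "y \<in> S'"
  shows "(\<Sum>x\<in>{x\<in>S. f x = y}. local_degree S S' f x) = bc_degree S S' f"
proof -
  let ?n = "\<lambda>y. \<Sum>x\<in>{x\<in>S. f x = y}. local_degree S S' f x"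
  have "?n constant_on S'"
  proof (rule locally_constant_imp_constant[OF conn])
    fix a assume a: "a \<in> S'"
    obtain U W where UW: "openin (top_of_set S') W" "a \<in> W"
      "\<And>x. \<lbrakk>x \<in> S; f x = a\<rbrakk> \<Longrightarrow> openin (top_of_set S) (U x) \<and> x \<in> U x"
      "\<And>x x'. \<lbrakk>x \<in> S; f x = a; x' \<in> S; f x' = a; x \<noteq> x'\<rbrakk> \<Longrightarrow> U x \<inter> U x' = {}"
      "S \<inter> f -` W \<subseteq> (\<Union>x\<in>{x\<in>S. f x = a}. U x)"
      "\<And>x y'. \<lbrakk>x \<in> S; f x = a; y' \<in> W; y' \<noteq> a\<rbrakk> \<Longrightarrow> card {x'\<in>U x. f x' = y'} = local_degree S S' f x"
      "\<And>x x'. \<lbrakk>x \<in> S; f x = a; x' \<in> U x; f x' \<noteq> a\<rbrakk> \<Longrightarrow> local_degree S S' f x' = 1"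
      "\<And>x. \<lbrakk>x \<in> S; f x = a; local_degree S S' f x = 1\<rbrakk> \<Longrightarrow> \<exists>V k. W \<subseteq> V \<and> homeomorphism (U x) V f k"
      by (rule branched_covering_nbhd[OF cS bc a]) (rule that)
    have "?n b = ?n a" if b: "b \<in> W" for b
    proof (cases "b = a")
      case False
      have US: "U x \<subseteq> S" if "x \<in> S" "f x = a" for x using UW(3) that openin_imp_subset by blast
      have eq: "{x\<in>S. f x = b} = (\<Union>x\<in>{x\<in>S. f x = a}. {x'\<in>U x. f x' = b})"
        using UW(5) b US by blast
      have fin: "finite {x\<in>S. f x = b}" "finite {x\<in>S. f x = a}"
        using branched_covering_finite_fibre[OF cS bc] by auto
      have "?n b = (\<Sum>x\<in>{x\<in>S. f x = a}. \<Sum>x'\<in>{x'\<in>U x. f x' = b}. local_degree S S' f x')"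
        unfolding eq
      proof (rule sum.UNION_disjoint[OF fin(2)])
        show "\<forall>i\<in>{x \<in> S. f x = a}. finite {x' \<in> U i. f x' = b}"
        proof
          fix i assume "i \<in> {x \<in> S. f x = a}"
          then have "{x' \<in> U i. f x' = b} \<subseteq> {x\<in>S. f x = b}" using US by blast
          then show "finite {x' \<in> U i. f x' = b}" using fin(1) finite_subset by blast
        qed
        show "\<forall>i\<in>{x \<in> S. f x = a}. \<forall>j\<in>{x \<in> S. f x = a}. i \<noteq> j \<longrightarrow> {x' \<in> U i. f x' = b} \<inter> {x' \<in> U j. f x' = b} = {}"
          using UW(4) by blast
      qed
      also have "\<dots> = (\<Sum>x\<in>{x\<in>S. f x = a}. \<Sum>x'\<in>{x'\<in>U x. f x' = b}. 1)"
        using UW(7) False by (intro sum.cong refl) auto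
      also have "\<dots> = ?n a" using UW(6) b False by (intro sum.cong refl) auto
      finally show ?thesis .
    qed simp
    then show "\<exists>T. openin (top_of_set S') T \<and> a \<in> T \<and> (\<forall>x\<in>T. ?n x = ?n a)"
      using UW(1,2) by blast
  qed
  then obtain c where c: "\<And>z. z \<in> S' \<Longrightarrow> ?n z = c" by (auto simp: constant_on_def)
  have "(SOME y. y \<in> S') \<in> S'" using y by (rule someI)
  then show ?thesis using c y unfolding bc_degree_def Let_def by auto
qed

lemma branched_covering_unramified:
  fixes S S' :: "'a::metric_space set"
  assumes cS: "compact S" and bc: "branched_covering S S' f" and T: "openin (top_of_set S') T"
    and deg: "\<And>x. \<lbrakk>x \<in> S; f x \<in> T\<rbrakk> \<Longrightarrow> local_degree S S' f x = 1"
  shows "covering_space (S \<inter> f -` T) f T"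
proof
  have cont: "continuous_on S f" and im: "f ` S = S'" using bc by (auto simp: branched_covering_def)
  have TS: "T \<subseteq> S'" using T openin_imp_subset by blast
  show "continuous_on (S \<inter> f -` T) f" using cont continuous_on_subset by blast
  show "f ` (S \<inter> f -` T) = T" using im TS by auto
  fix y assume y: "y \<in> T"
  then have yS: "y \<in> S'" using TS by auto
  obtain U W where UW: "openin (top_of_set S') W" "y \<in> W"
      "\<And>x. \<lbrakk>x \<in> S; f x = y\<rbrakk> \<Longrightarrow> openin (top_of_set S) (U x) \<and> x \<in> U x"
      "\<And>x x'. \<lbrakk>x \<in> S; f x = y; x' \<in> S; f x' = y; x \<noteq> x'\<rbrakk> \<Longrightarrow> U x \<inter> U x' = {}"
      "S \<inter> f -` W \<subseteq> (\<Union>x\<in>{x\<in>S. f x = y}. U x)"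
      "\<And>x y'. \<lbrakk>x \<in> S; f x = y; y' \<in> W; y' \<noteq> y\<rbrakk> \<Longrightarrow> card {x'\<in>U x. f x' = y'} = local_degree S S' f x"
      "\<And>x x'. \<lbrakk>x \<in> S; f x = y; x' \<in> U x; f x' \<noteq> y\<rbrakk> \<Longrightarrow> local_degree S S' f x' = 1"
      "\<And>x. \<lbrakk>x \<in> S; f x = y; local_degree S S' f x = 1\<rbrakk> \<Longrightarrow> \<exists>V k. W \<subseteq> V \<and> homeomorphism (U x) V f k"
    by (rule branched_covering_nbhd[OF cS bc yS]) (rule that)
  let ?T = "W \<inter> T"
  have oT: "openin (top_of_set S') ?T" using UW T by auto
  have oTT: "openin (top_of_set T) ?T" by (rule openin_subset_trans[OF oT]) (use TS in auto)
  have US: "U x \<subseteq> S" if "x \<in> S" "f x = y" for x using UW(3) that openin_imp_subset by blast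
  \<comment> \<open>The sheets may have images of different sizes; trimming each to the preimage of
    \<open>?T\<close> gives them a common image.\<close>
  let ?v = "(\<lambda>x. U x \<inter> f -` ?T) ` {x\<in>S. f x = y}"
  have "\<Union>?v = S \<inter> f -` T \<inter> f -` ?T"
  proof
    show "\<Union>?v \<subseteq> S \<inter> f -` T \<inter> f -` ?T" using US by fast
    show "S \<inter> f -` T \<inter> f -` ?T \<subseteq> \<Union>?v"
    proof
      fix z assume z: "z \<in> S \<inter> f -` T \<inter> f -` ?T"
      then obtain x where "x \<in> S" "f x = y" "z \<in> U x" using UW(5) by fast
      then show "z \<in> \<Union>?v" using z by fast
    qed
  qed
  moreover have "openin (top_of_set (S \<inter> f -` T)) u" if u: "u \<in> ?v" for u
  proof -
    obtain x where x: "x \<in> S" "f x = y" "u = U x \<inter> f -` ?T" using u by blast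
    have "openin (top_of_set S) (S \<inter> f -` ?T)"
      by (rule continuous_openin_preimage[OF cont _ oT]) (use im in auto)
    then have "openin (top_of_set S) (U x \<inter> (S \<inter> f -` ?T))" using UW(3) x by auto
    moreover have "U x \<inter> (S \<inter> f -` ?T) = u" using x US by auto
    ultimately have "openin (top_of_set S) u" by simp
    then show ?thesis by (rule openin_subset_trans) (use x US in auto)
  qed
  moreover have "pairwise disjnt ?v"
    unfolding pairwise_def disjnt_def using UW(4) by blast
  moreover have "\<exists>q. homeomorphism u ?T f q" if u: "u \<in> ?v" for u
  proof -
    obtain x where x: "x \<in> S" "f x = y" "u = U x \<inter> f -` ?T" using u by blast
    obtain V k where k: "W \<subseteq> V" "homeomorphism (U x) V f k" using UW(8) x deg y by blast
    have "homeomorphism u ?T f k"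
    proof (rule homeomorphism_of_subsets[OF k(2)])
      show "u \<subseteq> U x" "?T \<subseteq> V" using x k by auto
      have "f ` U x = V" using k(2) by (simp add: homeomorphism_def)
      then show "f ` u = ?T" unfolding x(3) using k(1) by blast
    qed
    then show ?thesis by blast
  qed
  ultimately show "\<exists>T'. y \<in> T' \<and> openin (top_of_set T) T' \<and>
      (\<exists>v. \<Union>v = S \<inter> f -` T \<inter> f -` T' \<and> (\<forall>u\<in>v. openin (top_of_set (S \<inter> f -` T)) u) \<and>
         pairwise disjnt v \<and> (\<forall>u\<in>v. \<exists>q. homeomorphism u T' f q))"
    using UW(2) y oTT by (intro exI[of _ ?T] conjI exI[of _ ?v]) auto
qed

text \<open>A path between two points of one fibre projects to a loop, which contracts; by monodromy
  the path itself is closed.\<close>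

lemma covering_space_simply_connected_inj:
  fixes p :: "'a::real_normed_vector \<Rightarrow> 'b::real_normed_vector"
  assumes cov: "covering_space C p S" and sc: "simply_connected S" and pc: "path_connected C"
    and ab: "a \<in> C" "b \<in> C" "p a = p b"
  shows "a = b"
proof -
  obtain h where h: "path h" "path_image h \<subseteq> C" "pathstart h = a" "pathfinish h = b"
    using pc ab unfolding path_connected_def by blast
  have cont: "continuous_on C p" and im: "p ` C = S" using cov by (auto simp: covering_space_def)
  let ?g = "p \<circ> h"
  have g: "path ?g" "path_image ?g \<subseteq> S" "pathstart ?g = p a" "pathfinish ?g = p a"
    using h cont im ab by (auto simp: path_image_compose pathstart_compose pathfinish_compose intro!: path_continuous_image intro: continuous_on_subset)
  let ?c = "linepath (p a) (p a)"
  have hom: "homotopic_paths S ?g ?c"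
    using sc g unfolding simply_connected_eq_contractible_path by metis
  have "pathfinish h = pathfinish (linepath a a)"
  proof (rule covering_space_monodromy[OF cov g(1,2) _ _ hom h(1,2)])
    show "path_image ?c \<subseteq> S" "path_image (linepath a a) \<subseteq> C" using ab im by auto
    show "path ?c" "path (linepath a a)" "pathstart h = pathstart (linepath a a)"
      using h by simp_all
  qed (auto simp: linepath_def algebra_simps simp flip: scaleR_add_left)
  then show ?thesis using h by auto
qed

section \<open>The Riemann--Hurwitz inequality on the sphere\<close>

lemma punctured_S2_homeomorphic_complex:
  assumes "p \<in> S2"
  shows "(S2 - {p}) homeomorphic (UNIV :: complex set)"
proof -
  have "(S2 - {p}) homeomorphic {x::real^3. axis 1 1 \<bullet> x = 0}"
    by (rule homeomorphic_punctured_sphere_hyperplane) (use assms in \<open>auto simp: axis_eq_0_iff\<close>)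
  also have "{x::real^3. axis 1 1 \<bullet> x = 0} homeomorphic (UNIV :: complex set)"
    by (subst homeomorphic_affine_sets_eq) (auto simp: affine_hyperplane axis_eq_0_iff)
  finally show ?thesis .
qed

lemma compact_S2: "compact S2" and connected_S2: "connected S2"
  by (auto intro!: connected_sphere)

lemma infinite_S2: "infinite S2"
proof
  assume "finite S2"
  have "axis 1 1 \<in> S2" by simp
  then have "(S2 - {axis 1 1}) homeomorphic (UNIV :: complex set)"
    by (rule punctured_S2_homeomorphic_complex)
  then show False using \<open>finite S2\<close> unfolding homeomorphic_def homeomorphism_def
    by (metis finite_Diff finite_imageI infinite_UNIV_char_0)
qed

text \<open>One point of \<open>A\<close> is sent to infinity; in the plane, the complement of the
  remaining countable set is path connected.\<close>

lemma path_connected_S2_diff_finite: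
  assumes "finite A" "a \<in> A" "A \<subseteq> S2"
  shows "path_connected (S2 - A)"
proof -
  obtain h k where hk: "homeomorphism (S2 - {a}) (UNIV :: complex set) h k"
    using punctured_S2_homeomorphic_complex[of a] assms unfolding homeomorphic_def by blast
  have "countable (h ` (A - {a}))" using assms by (simp add: countable_finite)
  then have "path_connected (- h ` (A - {a}))"
    by (intro path_connected_complement_countable) auto
  moreover have ck: "continuous_on UNIV k" using hk by (simp add: homeomorphism_def)
  ultimately have "path_connected (k ` (- h ` (A - {a})))"
    using path_connected_continuous_image continuous_on_subset by blast
  moreover have "k ` (- h ` (A - {a})) = S2 - A"
  proof -
    have kh: "\<And>x. x \<in> S2 \<Longrightarrow> x \<noteq> a \<Longrightarrow> k (h x) = x" "\<And>z. h (k z) = z" "\<And>z. k z \<in> S2 \<and> k z \<noteq> a"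
      using hk unfolding homeomorphism_def by blast+
    show ?thesis
    proof
      show "k ` (- h ` (A - {a})) \<subseteq> S2 - A"
      proof
        fix y assume "y \<in> k ` (- h ` (A - {a}))"
        then obtain z where "z \<notin> h ` (A - {a})" "y = k z" by blast
        then show "y \<in> S2 - A" using kh(2)[of z] kh(3)[of z] by (metis DiffI image_eqI singletonD)
      qed
      show "S2 - A \<subseteq> k ` (- h ` (A - {a}))"
      proof
        fix x assume x: "x \<in> S2 - A"
        then have "x \<noteq> a" using assms by auto
        moreover have "h x \<notin> h ` (A - {a})"
        proof
          assume "h x \<in> h ` (A - {a})"
          then obtain c where c: "c \<in> A" "c \<noteq> a" "h x = h c" by blast
          have "x = c" using kh(1)[of x] kh(1)[of c] c x \<open>x \<noteq> a\<close> assms(3) by (metis DiffD1 subsetD)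
          then show False using x c by simp
        qed
        ultimately show "x \<in> k ` (- h ` (A - {a}))" using kh(1)[of x] x by (metis ComplI DiffD1 image_eqI)
      qed
    qed
  qed
  ultimately show ?thesis by simp
qed

text \<open>Off \<open>b\<close> the map is a covering of a plane, which is simply connected, and
  its total space, a sphere minus a finite nonempty fibre, is path connected. So the covering is
  injective and a fibre other than that of \<open>b\<close> is one point of local degree 1.\<close>

lemma S2_ramified_over_one_point:
  assumes bc: "branched_covering S2 S2 f" and b: "b \<in> S2"
    and deg: "\<And>x. \<lbrakk>x \<in> S2; f x \<noteq> b\<rbrakk> \<Longrightarrow> local_degree S2 S2 f x = 1"
  shows "bc_degree S2 S2 f = 1"
proof -
  have im: "f ` S2 = S2" using bc by (simp add: branched_covering_def)
  have op: "openin (top_of_set S2) (S2 - {b})" by (simp add: openin_delete)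
  have cov: "covering_space (S2 \<inter> f -` (S2 - {b})) f (S2 - {b})"
    by (rule branched_covering_unramified[OF compact_S2 bc op]) (use deg in auto)
  have "simply_connected (S2 - {b})"
    using homeomorphic_simply_connected_eq[OF punctured_S2_homeomorphic_complex[OF b]]
      convex_imp_simply_connected[OF convex_UNIV] by simp
  moreover have "path_connected (S2 \<inter> f -` (S2 - {b}))"
  proof -
    have "finite {x\<in>S2. f x = b}" by (rule branched_covering_finite_fibre[OF compact_S2 bc])
    moreover obtain a where "a \<in> {x\<in>S2. f x = b}" using imageE[of b f S2] b unfolding im by (metis (mono_tags, lifting) mem_Collect_eq)
    ultimately have "path_connected (S2 - {x\<in>S2. f x = b})"
      by (intro path_connected_S2_diff_finite) auto
    moreover have "S2 - {x\<in>S2. f x = b} = S2 \<inter> f -` (S2 - {b})" using im by auto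
    ultimately show ?thesis by simp
  qed
  ultimately have inj: "\<And>a c. \<lbrakk>a \<in> S2 \<inter> f -` (S2 - {b}); c \<in> S2 \<inter> f -` (S2 - {b}); f a = f c\<rbrakk> \<Longrightarrow> a = c"
    using covering_space_simply_connected_inj[OF cov] by blast
  obtain y where y: "y \<in> S2" "y \<noteq> b" using infinite_S2 by (metis finite.emptyI finite_insert finite_subset insertI1 subsetI)
  obtain x where x: "x \<in> S2" "f x = y" using im y by (metis imageE)
  have "{x\<in>S2. f x = y} = {x}" using inj x y by auto
  then have "bc_degree S2 S2 f = local_degree S2 S2 f x"
    using fibre_sum_constant[OF compact_S2 bc connected_S2 y(1)] by simp
  then show ?thesis using deg x y by simp
qed

section \<open>Lifting arcs whose ends may be branch values\<close>

lemma lift_limit_at_end: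
  fixes S S' :: "'a::real_normed_vector set"
  assumes cS: "compact S" and bc: "branched_covering S S' f"
    and \<sigma>: "continuous_on {0..1::real} \<sigma>" "\<sigma> ` {0..1} \<subseteq> S'"
    and L: "continuous_on {0<..<1} L" "\<And>t. t \<in> {0<..<1} \<Longrightarrow> L t \<in> S \<and> f (L t) = \<sigma> t"
  obtains l where "l \<in> S" "f l = \<sigma> 1" "(L \<longlongrightarrow> l) (at_left 1)"
proof -
  define P where "P = {x\<in>S. f x = \<sigma> 1}"
  have fin: "finite P" unfolding P_def by (rule branched_covering_finite_fibre[OF cS bc])
  have cont: "continuous_on S f" using bc by (simp add: branched_covering_def)
  obtain r where r: "r > 0" "\<And>x y. \<lbrakk>x \<in> P; y \<in> P; x \<noteq> y\<rbrakk> \<Longrightarrow> ball x r \<inter> ball y r = {}"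
    using finite_separating_radius[OF fin] by metis
  have s1: "\<sigma> 1 \<in> S'" using \<sigma> by auto
  \<comment> \<open>Nothing is assumed about \<open>L\<close> at time 1, but shortly before it the
    lift stays in small disjoint balls around the finitely many points over
    \<open>\<sigma> 1\<close>, and connectedness confines it to one of them.\<close>
  have key: "\<exists>x\<in>P. \<exists>c\<in>{0<..<1}. \<forall>t\<in>{c<..<1}. L t \<in> ball x e" if e: "0 < e" "e \<le> r" for e
  proof -
    have "openin (top_of_set S) (S \<inter> (\<Union>x\<in>P. ball x e))" by auto
    moreover have "{x\<in>S. f x = \<sigma> 1} \<subseteq> S \<inter> (\<Union>x\<in>P. ball x e)" using e by (auto simp: P_def)
    ultimately obtain W where W: "openin (top_of_set S') W" "\<sigma> 1 \<in> W" "S \<inter> f -` W \<subseteq> S \<inter> (\<Union>x\<in>P. ball x e)"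
      using fibre_tube[OF cS cont s1] by metis
    obtain O' where O': "open O'" "W = S' \<inter> O'" using W(1) by (auto simp: openin_open)
    have "eventually (\<lambda>t. \<sigma> t \<in> O') (at 1 within {0..1})"
      using \<sigma>(1) O' W(2) unfolding continuous_on_def by (auto elim!: ballE[where x=1] dest!: topological_tendstoD[of _ _ _ O'])
    then have "eventually (\<lambda>t. \<sigma> t \<in> O') (at_left (1::real))"
      by (simp add: at_within_Icc_at_left)
    then obtain c0 where c0: "c0 < 1" "\<And>t. c0 < t \<Longrightarrow> t < 1 \<Longrightarrow> \<sigma> t \<in> O'"
      unfolding eventually_at_left_field by auto
    define c where "c = max c0 (1/2)"
    have c: "0 < c" "c < 1" "c0 \<le> c" using c0 by (auto simp: c_def)
    have Lin: "L t \<in> (\<Union>x\<in>P. ball x e)" if "t \<in> {c<..<1}" for t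
    proof -
      have t: "t \<in> {0<..<1}" using that c by auto
      have "\<sigma> t \<in> W" using c0(2)[of t] that c \<sigma>(2) O' by auto
      then show ?thesis using W(3) L(2)[OF t] by blast
    qed
    define t0 where "t0 = (c + 1) / 2"
    have t0: "t0 \<in> {c<..<1}" using c by (auto simp: t0_def)
    obtain x where x: "x \<in> P" "L t0 \<in> ball x e" using Lin[OF t0] by auto
    have 1: "connected (L ` {c<..<1})"
      using c by (intro connected_continuous_image continuous_on_subset[OF L(1)]) auto
    have 2: "open (ball x e)" "open (\<Union>x'\<in>P - {x}. ball x' e)" by auto
    have "ball x e \<inter> ball x' e = {}" if "x' \<in> P - {x}" for x'
      using r(2)[of x x'] x that e(2) subset_ball[OF e(2)] by blast
    then have 3: "ball x e \<inter> (\<Union>x'\<in>P - {x}. ball x' e) \<inter> L ` {c<..<1} = {}" by blast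
    have 4: "L ` {c<..<1} \<subseteq> ball x e \<union> (\<Union>x'\<in>P - {x}. ball x' e)" using Lin by blast
    have "ball x e \<inter> L ` {c<..<1} \<noteq> {}" using x t0 by blast
    then have "(\<Union>x'\<in>P - {x}. ball x' e) \<inter> L ` {c<..<1} = {}"
      using connectedD[OF 1 2 3 4] by blast
    then have "\<forall>t\<in>{c<..<1}. L t \<in> ball x e" using Lin by blast
    then show ?thesis using x(1) c by (intro bexI[of _ x] bexI[of _ c]) auto
  qed
  obtain l c where l: "l \<in> P" "c \<in> {0<..<1}" "\<And>t. t\<in>{c<..<1} \<Longrightarrow> L t \<in> ball l r"
    using key[of r] r(1) by auto
  have "(L \<longlongrightarrow> l) (at_left 1)"
  proof (rule tendstoI)
    fix e :: real assume "e > 0"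
    define e' where "e' = min e r"
    obtain x c' where x: "x \<in> P" "c' \<in> {0<..<1}" "\<And>t. t\<in>{c'<..<1} \<Longrightarrow> L t \<in> ball x e'"
      using key[of e'] \<open>e > 0\<close> r(1) by (auto simp: e'_def)
    \<comment> \<open>A time in both tails shows that the small ball and the ball of radius
      \<open>r\<close> have the same centre.\<close>
    define t where "t = (max c c' + 1) / 2"
    have "t \<in> {c<..<1}" "t \<in> {c'<..<1}" using l(2) x(2) by (auto simp: t_def max_def)
    then have "L t \<in> ball l r" "L t \<in> ball x r" using l(3) x(3) by (auto simp: e'_def)
    then have "x = l" using r(2)[OF x(1) l(1)] by blast
    then have "\<And>t. c' < t \<Longrightarrow> t < 1 \<Longrightarrow> dist (L t) l < e" using x(3) by (auto simp: e'_def dist_commute)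
    then show "\<forall>\<^sub>F t in at_left 1. dist (L t) l < e"
      unfolding eventually_at_left_field using x(2) by (intro exI[of _ c']) auto
  qed
  then show ?thesis using that l(1) by (auto simp: P_def)
qed

text \<open>The covering lifts the path over the open interval only; the end values are limits, and
  the one at 0 is obtained from the reversed path.\<close>

lemma lift_path_interior:
  fixes S S' :: "'a::real_normed_vector set"
  assumes cS: "compact S" and bc: "branched_covering S S' f"
    and cov: "covering_space C f D" "C \<subseteq> S"
    and \<sigma>: "continuous_on {0..1::real} \<sigma>" "\<sigma> ` {0..1} \<subseteq> S'" "\<And>t. t \<in> {0<..<1} \<Longrightarrow> \<sigma> t \<in> D"
    and t0: "t0 \<in> {0<..<1}" and x: "x \<in> C" "f x = \<sigma> t0"
  obtains \<tau> where "path \<tau>" "path_image \<tau> \<subseteq> S" "\<tau> t0 = x" "\<And>t. t \<in> {0..1} \<Longrightarrow> f (\<tau> t) = \<sigma> t"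
    "\<And>t. t \<in> {0<..<1} \<Longrightarrow> \<tau> t \<in> C"
proof -
  have c\<sigma>: "continuous_on {0<..<1} \<sigma>" using \<sigma>(1) by (rule continuous_on_subset) auto
  obtain L where L: "continuous_on {0<..<1} L" "L \<in> {0<..<1} \<rightarrow> C" "L t0 = x"
      "\<And>t. t \<in> {0<..<1} \<Longrightarrow> f (L t) = \<sigma> t"
    by (rule covering_space_lift_strong[OF cov(1) x(1) t0, of \<sigma>])
       (use c\<sigma> \<sigma>(3) x in \<open>auto simp: convex_imp_simply_connected convex_imp_locally_path_connected\<close>)
  have LS: "L t \<in> S \<and> f (L t) = \<sigma> t" "L t \<in> C" if "t \<in> {0<..<1}" for t
    using L(2,4) that cov(2) by auto
  obtain l1 where l1: "l1 \<in> S" "f l1 = \<sigma> 1" "(L \<longlongrightarrow> l1) (at_left 1)"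
    using lift_limit_at_end[OF cS bc \<sigma>(1,2) L(1) LS(1)] by metis
  have rev: "continuous_on {0..1} (\<lambda>t. \<sigma> (1 - t))" "(\<lambda>t. \<sigma> (1 - t)) ` {0..1} \<subseteq> S'"
    "continuous_on {0<..<1} (\<lambda>t. L (1 - t))"
    using \<sigma>(2) by (auto intro!: continuous_on_compose2[OF \<sigma>(1)] continuous_on_compose2[OF L(1)] continuous_intros)
  obtain l0 where l0: "l0 \<in> S" "f l0 = \<sigma> 0" "((\<lambda>t. L (1 - t)) \<longlongrightarrow> l0) (at_left 1)"
    using lift_limit_at_end[OF cS bc rev] LS by auto
  have "((\<lambda>t. L (1 - (1 - t))) \<longlongrightarrow> l0) (at_right 0)"
  proof -
    have "filterlim (\<lambda>t::real. 1 - t) (at_left 1) (at_right 0)"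
      by (rule filterlim_at_withinI) (auto intro!: tendsto_eq_intros simp: eventually_at_right_field intro: exI[of _ 1])
    from filterlim_compose[OF l0(3) this] show ?thesis .
  qed
  then have l0': "(L \<longlongrightarrow> l0) (at_right 0)" by simp
  define \<tau> where "\<tau> = (\<lambda>t. if t = 0 then l0 else if t = 1 then l1 else L t)"
  have \<tau>01: "\<tau> 0 = l0" "\<tau> 1 = l1" by (auto simp: \<tau>_def)
  have "continuous_on {0..1} \<tau>"
  proof (rule continuous_on_IccI)
    show "(\<tau> \<longlongrightarrow> \<tau> 0) (at_right 0)"
      using l0' unfolding \<tau>01 by (rule Lim_transform_eventually) (auto simp: \<tau>_def eventually_at_right_field intro!: exI[of _ 1])
    show "(\<tau> \<longlongrightarrow> \<tau> 1) (at_left 1)"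
      using l1(3) unfolding \<tau>01 by (rule Lim_transform_eventually) (auto simp: \<tau>_def eventually_at_left_field intro!: exI[of _ 0])
    fix t :: real assume t: "0 < t" "t < 1"
    have "L \<midarrow>t\<rightarrow> L t" using L(1) t by (simp add: continuous_on_eq_continuous_at continuous_at)
    moreover have "eventually (\<lambda>s. L s = \<tau> s) (at t)"
      using eventually_at_in_open[of "{0<..<1}" t] t by (auto simp: \<tau>_def elim!: eventually_mono)
    ultimately show "\<tau> \<midarrow>t\<rightarrow> \<tau> t" using t Lim_transform_eventually by (fastforce simp: \<tau>_def)
  qed auto
  moreover have \<tau>in: "\<tau> t = L t" if "t \<in> {0<..<1}" for t using that by (auto simp: \<tau>_def)
  moreover have \<tau>S: "\<tau> t \<in> S \<and> f (\<tau> t) = \<sigma> t" if "t \<in> {0..1}" for t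
  proof (cases "t \<in> {0<..<1}")
    case True then show ?thesis using \<tau>in LS by simp
  next
    case False
    then have "t = 0 \<or> t = 1" using that by auto
    then show ?thesis using \<tau>01 l0 l1 by auto
  qed
  moreover have "path_image \<tau> \<subseteq> S" using \<tau>S by (auto simp: path_image_def)
  ultimately show ?thesis
    using t0 L(3) LS(2) by (intro that[of \<tau>]) (auto simp: path_def)
qed

text \<open>With the branch values placed at 0, ..., n - 1, an arc through all of them is just a
  real segment with its standard parametrisation.\<close>

lemma S2_homeomorphism_ordering_points:
  assumes "finite B" "B \<subseteq> S2" "p \<in> S2" "p \<notin> B"
  obtains h k b where "homeomorphism (S2 - {p}) (UNIV :: complex set) h k"
    "bij_betw b {..<card B} B" "\<And>i. i < card B \<Longrightarrow> h (b i) = of_nat i"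
proof -
  obtain h0 k0 where hk0: "homeomorphism (S2 - {p}) (UNIV :: complex set) h0 k0"
    using punctured_S2_homeomorphic_complex[of p] assms unfolding homeomorphic_def by blast
  obtain b where b: "bij_betw b {..<card B} B" using assms(1) ex_bij_betw_nat_finite by (metis atLeast0LessThan)
  have inj: "inj_on (h0 \<circ> b) {..<card B}"
  proof (rule comp_inj_on)
    show "inj_on b {..<card B}" using b by (auto simp: bij_betw_def)
    have "inj_on h0 (S2 - {p})" using hk0 unfolding homeomorphism_def by (metis inj_on_inverseI)
    then show "inj_on h0 (b ` {..<card B})" by (rule inj_on_subset) (use b assms in \<open>auto simp: bij_betw_def\<close>)
  qed
  obtain u v where uv: "homeomorphism (UNIV::complex set) (UNIV::complex set) u v" "\<And>i. i \<in> {..<card B} \<Longrightarrow> u (h0 (b i)) = of_nat i"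
  proof (rule homeomorphism_moving_points_exists[of "UNIV :: complex set" UNIV "{..<card B}" "h0 \<circ> b" "of_nat :: nat \<Rightarrow> complex"])
    show "pairwise (\<lambda>i j. (h0 \<circ> b) i \<noteq> (h0 \<circ> b) j \<and> (of_nat i :: complex) \<noteq> of_nat j) {..<card B}"
      using inj by (auto simp: pairwise_def inj_on_def)
    fix u v :: "complex \<Rightarrow> complex"
    assume "homeomorphism UNIV UNIV u v" "\<And>i. i \<in> {..<card B} \<Longrightarrow> u ((h0 \<circ> b) i) = of_nat i"
    then show thesis by (intro that[of u v]) auto
  qed auto
  show ?thesis
    by (rule that[OF homeomorphism_compose[OF hk0 uv(1)] b]) (use uv in auto)
qed

text \<open>The preimage of an arc through the n points of \<open>B\<close> is a graph with
  \<open>card A\<close> vertices, (n - 1) * D edges and at most D faces, so Euler's inequality reads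
  (n - 1) * D + 2 <= D + card A.\<close>

lemma S2_hurwitz_inequality:
  assumes bc: "branched_covering S2 S2 g" and B: "finite B" "B \<subseteq> S2" "B \<noteq> {}"
    and A: "A = {x\<in>S2. g x \<in> B}" and cov: "covering_space (S2 - A) g (S2 - B)"
  shows "bc_degree S2 S2 g * card B + 2 \<le> card A + 2 * bc_degree S2 S2 g"
proof -
  note [simp del] = mem_sphere mem_sphere_0
  define D where "D = bc_degree S2 S2 g"
  define n where "n = card B"
  have n1: "n \<ge> 1" using B by (simp add: n_def Suc_leI card_gt_0_iff)
  have cont: "continuous_on S2 g" and im: "g ` S2 = S2" using bc by (auto simp: branched_covering_def)
  have surj: "\<exists>x\<in>S2. g x = y" if "y \<in> S2" for y using im that by (metis imageE)
  have gS: "g x \<in> S2" if "x \<in> S2" for x using im that by (metis imageI)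
  have ff: "finite {x\<in>S2. g x = y}" for y by (rule branched_covering_finite_fibre[OF compact_S2 bc])
  have finA: "finite A"
  proof -
    have "A = (\<Union>y\<in>B. {x\<in>S2. g x = y})" unfolding A by auto
    then show ?thesis using ff B by auto
  qed
  obtain b0 where b0: "b0 \<in> B" using B(3) by blast
  then obtain a0 where "a0 \<in> S2" "g a0 = b0" using surj B(2) by (metis subsetD)
  then have "a0 \<in> A" using b0 by (simp add: A)
  then have "A \<noteq> {}" by blast
  have deg1: "local_degree S2 S2 g x = 1" if xA: "x \<in> S2 - A" for x
  proof -
    obtain T u q where T: "x \<in> T" "openin (top_of_set (S2 - A)) T" "homeomorphism T u g q"
      using covering_space_local_homeomorphism[OF cov xA] by metis
    have "openin (top_of_set S2) (S2 - A)" using finite_imp_closed[OF finA] by (simp add: Diff_eq openin_open_Int open_Compl)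
    then have "openin (top_of_set S2) T" using T(2) openin_trans by blast
    moreover have "inj_on g T" using T(3) unfolding homeomorphism_def by (metis inj_on_inverseI)
    ultimately show ?thesis using local_degree_locally_injective[OF bc] T(1) by blast
  qed
  have cardD: "card {x\<in>S2. g x = y} = D" if "y \<in> S2 - B" for y
  proof -
    have "D = (\<Sum>x\<in>{x\<in>S2. g x = y}. local_degree S2 S2 g x)"
      unfolding D_def using fibre_sum_constant[OF compact_S2 bc connected_S2] that by simp
    also have "\<dots> = (\<Sum>x\<in>{x\<in>S2. g x = y}. 1)" using deg1 that by (intro sum.cong) (auto simp: A)
    finally show ?thesis by simp
  qed
  \<comment> \<open>The point at infinity of the target, chosen off \<open>B\<close> so that the arc
    can be drawn in the plane.\<close>
  obtain p where p: "p \<in> S2" "p \<notin> B" using infinite_S2 B by (meson finite_subset subsetI)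
  obtain h h' b where hh: "homeomorphism (S2 - {p}) (UNIV :: complex set) h h'"
    "bij_betw b {..<card B} B" "\<And>i. i < card B \<Longrightarrow> h (b i) = of_nat i"
    using S2_homeomorphism_ordering_points[OF B(1,2) p] by metis
  have h': "\<And>x. x \<in> S2 \<Longrightarrow> x \<noteq> p \<Longrightarrow> h' (h x) = x" "\<And>z. h (h' z) = z" "\<And>z. h' z \<in> S2" "\<And>z. h' z \<noteq> p"
      and ch': "continuous_on UNIV h'"
    using hh(1) unfolding homeomorphism_def by blast+
  have inj_h': "h' z = h' w \<longleftrightarrow> z = w" for z w using h'(2) by metis
  have bB: "h' (of_nat i) \<in> B" if "i < n" for i
  proof -
    have "b i \<in> B" using hh(2) that by (auto simp: bij_betw_def n_def)
    moreover have "h' (of_nat i) = b i"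
      using hh(3)[of i] that h'(1)[of "b i"] calculation B(2) p by (metis n_def subsetD)
    ultimately show ?thesis by simp
  qed
  have Bb: "\<exists>i<n. z = of_nat i" if zB: "h' z \<in> B" for z
  proof -
    obtain i where "i < n" "h' z = b i" using hh(2) zB by (metis bij_betw_def imageE lessThan_iff n_def)
    then show ?thesis using hh(3) h'(2) by (metis n_def)
  qed
  \<comment> \<open>The j-th edge of the arc, running from branch value j to branch value j + 1; the
    graph uses only \<open>j < n - 1\<close>.\<close>
  define \<sigma> where "\<sigma> j t = h' (of_real (real j + t))" for j and t :: real
  have c\<sigma>: "continuous_on {0..1} (\<sigma> j)" for j unfolding \<sigma>_def
    by (intro continuous_on_compose2[OF ch'] continuous_intros) auto
  have \<sigma>S: "\<sigma> j ` {0..1} \<subseteq> S2" for j using h'(3) by (auto simp: \<sigma>_def)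
  have \<sigma>inj: "j = j' \<and> t = t'" if "\<sigma> j t = \<sigma> j' t'" "t \<in> {0<..<1}" "t' \<in> {0<..<1}" for j j' t t'
  proof -
    have "real j + t = real j' + t'" using that(1) by (simp add: \<sigma>_def inj_h' del: of_real_add)
    moreover have "\<lfloor>real j + t\<rfloor> = int j" "\<lfloor>real j' + t'\<rfloor> = int j'" using that by (auto intro!: floor_unique)
    ultimately show ?thesis by auto
  qed
  have \<sigma>B: "\<sigma> j t \<in> S2 - B" if "t \<in> {0<..<1}" for j t
  proof -
    have "\<sigma> j t \<notin> B"
    proof
      assume "\<sigma> j t \<in> B"
      then obtain i where "of_real (real j + t) = (of_nat i :: complex)" using Bb unfolding \<sigma>_def by blast
      then have "real j + t = real i" by (metis of_real_eq_iff of_real_of_nat_eq)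
      moreover have "\<lfloor>real j + t\<rfloor> = int j" using that by (auto intro!: floor_unique)
      ultimately have "i = j" by simp
      then show False using \<open>real j + t = real i\<close> that by simp
    qed
    then show ?thesis using h'(3) by (simp add: \<sigma>_def)
  qed
  have \<sigma>end: "\<sigma> j 0 \<in> B" "\<sigma> j 1 \<in> B" if "j < n - 1" for j
    using bB[of j] bB[of "Suc j"] that by (simp_all add: \<sigma>_def add.commute)
  have "\<forall>t0 x j. t0 \<in> {0<..<1} \<and> x \<in> S2 \<and> g x = \<sigma> j t0 \<longrightarrow> (\<exists>\<tau>. path \<tau> \<and> path_image \<tau> \<subseteq> S2 \<and> \<tau> t0 = x \<and>
      (\<forall>t\<in>{0..1}. g (\<tau> t) = \<sigma> j t))"
  proof (intro allI impI)
    fix t0 x j assume a: "t0 \<in> {0<..<1} \<and> x \<in> S2 \<and> g x = \<sigma> j t0"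
    then have t0: "t0 \<in> {0<..<1}" and x: "x \<in> S2 - A" "g x = \<sigma> j t0" using \<sigma>B[of t0 j] by (auto simp: A)
    show "\<exists>\<tau>. path \<tau> \<and> path_image \<tau> \<subseteq> S2 \<and> \<tau> t0 = x \<and> (\<forall>t\<in>{0..1}. g (\<tau> t) = \<sigma> j t)"
      by (rule lift_path_interior[OF compact_S2 bc cov _ c\<sigma>[of j] \<sigma>S[of j] \<sigma>B t0 x]) blast+
  qed
  then obtain \<tau>0 where \<tau>0: "\<And>t0 x j. \<lbrakk>t0 \<in> {0<..<1}; x \<in> S2; g x = \<sigma> j t0\<rbrakk> \<Longrightarrow>
      path (\<tau>0 t0 x j) \<and> path_image (\<tau>0 t0 x j) \<subseteq> S2 \<and> \<tau>0 t0 x j t0 = x \<and> (\<forall>t\<in>{0..1}. g (\<tau>0 t0 x j t) = \<sigma> j t)"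
    by metis
  have uniq: "\<tau> s = \<tau>' s" if "path \<tau>" "path_image \<tau> \<subseteq> S2" "\<And>t. t\<in>{0..1} \<Longrightarrow> g (\<tau> t) = \<sigma> j t"
      "path \<tau>'" "path_image \<tau>' \<subseteq> S2" "\<And>t. t\<in>{0..1} \<Longrightarrow> g (\<tau>' t) = \<sigma> j t"
      "\<tau> t0 = \<tau>' t0" "t0 \<in> {0<..<1}" "s \<in> {0<..<1}" for \<tau> \<tau>' s t0 j
  proof (rule covering_space_lift_unique[OF cov, of \<tau> t0 \<tau>' "{0<..<1}" "\<sigma> j"])
    have io: "\<rho> \<in> {0<..<1} \<rightarrow> S2 - A" "continuous_on {0<..<1} \<rho>"
      if "path \<rho>" "path_image \<rho> \<subseteq> S2" "\<And>t. t\<in>{0..1} \<Longrightarrow> g (\<rho> t) = \<sigma> j t" for \<rho>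
    proof -
      show "continuous_on {0<..<1} \<rho>" using that(1) unfolding path_def by (rule continuous_on_subset) auto
      show "\<rho> \<in> {0<..<1} \<rightarrow> S2 - A"
      proof
        fix t :: real assume t: "t \<in> {0<..<1}"
        then have "\<rho> t \<in> S2" using that(2) by (auto simp: path_image_def)
        moreover have "g (\<rho> t) \<notin> B" using that(3)[of t] t \<sigma>B[OF t] by auto
        ultimately show "\<rho> t \<in> S2 - A" by (auto simp: A)
      qed
    qed
    show "\<tau> \<in> {0<..<1} \<rightarrow> S2 - A" "continuous_on {0<..<1} \<tau>" using io[OF that(1,2,3)] by blast+
    show "\<tau>' \<in> {0<..<1} \<rightarrow> S2 - A" "continuous_on {0<..<1} \<tau>'" using io[OF that(4,5,6)] by blast+
    show "continuous_on {0<..<1} (\<sigma> j)" using c\<sigma> by (rule continuous_on_subset) auto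
    show "\<sigma> j \<in> {0<..<1} \<rightarrow> S2 - B" using \<sigma>B by blast
  qed (use that in auto)
  \<comment> \<open>A lift of the j-th edge is determined by its point over the midpoint, which lies
    off the branch values. This gives D lifts for each j.\<close>
  define I where "I = (SIGMA j:{..<n-1}. {x\<in>S2. g x = \<sigma> j (1/2)})"
  define \<tau> where "\<tau> i = \<tau>0 (1/2) (snd i) (fst i)" for i
  have half: "1/2 \<in> {0<..<1::real}" by simp
  have \<tau>: "path (\<tau> i)" "path_image (\<tau> i) \<subseteq> S2" "\<tau> i (1/2) = snd i" "\<And>t. t\<in>{0..1} \<Longrightarrow> g (\<tau> i t) = \<sigma> (fst i) t"
    if "i \<in> I" for i
    using \<tau>0[OF half, of "snd i" "fst i"] that unfolding I_def \<tau>_def by auto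
  have cardI: "card I = (n - 1) * D" and finI: "finite I"
  proof -
    have "card I = (\<Sum>j<n-1. card {x\<in>S2. g x = \<sigma> j (1/2)})" unfolding I_def
      by (subst card_SigmaI) (use ff in auto)
    also have "\<dots> = (\<Sum>j<n-1. D)" using cardD \<sigma>B[OF half] by (intro sum.cong) auto
    finally show "card I = (n - 1) * D" by simp
    show "finite I" unfolding I_def using ff by (intro finite_SigmaI) auto
  qed
  \<comment> \<open>One point over \<open>p\<close> serves as infinity in the source. Other
    preimages of \<open>p\<close> may remain in the plane and have to be avoided below.\<close>
  obtain p' where p': "p' \<in> S2" "g p' = p" using surj p by blast
  obtain k k' where kk: "homeomorphism (S2 - {p'}) (UNIV :: complex set) k k'"
    using punctured_S2_homeomorphic_complex[OF p'(1)] unfolding homeomorphic_def by blast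
  have k': "\<And>x. x \<in> S2 \<Longrightarrow> x \<noteq> p' \<Longrightarrow> k' (k x) = x" "\<And>z. k (k' z) = z" "\<And>z. k' z \<in> S2" "\<And>z. k' z \<noteq> p'"
      and ck: "continuous_on (S2 - {p'}) k" and ck': "continuous_on UNIV k'"
    using kk unfolding homeomorphism_def by blast+
  have inj_k: "k x = k y \<longleftrightarrow> x = y" if "x \<in> S2 - {p'}" "y \<in> S2 - {p'}" for x y using k'(1) that by (metis DiffE singletonI)
  have \<tau>p: "\<tau> i t \<in> S2 - {p'}" if "i \<in> I" "t \<in> {0..1}" for i t
  proof -
    have "\<sigma> (fst i) t \<noteq> p" using h'(4) by (simp add: \<sigma>_def)
    then show ?thesis using \<tau>[OF that(1)] that(2) p' by (auto simp: path_image_def)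
  qed
  have \<tau>inj: "i = i' \<and> t = t'" if "i \<in> I" "i' \<in> I" "t \<in> {0<..<1}" "t' \<in> {0<..<1}" "\<tau> i t = \<tau> i' t'" for i i' t t'
  proof -
    have "\<sigma> (fst i) t = \<sigma> (fst i') t'" using \<tau>(4)[OF that(1), of t] \<tau>(4)[OF that(2), of t'] that by auto
    then have e: "fst i = fst i'" "t = t'" using \<sigma>inj that by blast+
    have "\<tau> i (1/2) = \<tau> i' (1/2)"
      by (rule uniq[of "\<tau> i" "fst i" "\<tau> i'" t])
         (use \<tau>[OF that(1)] \<tau>[OF that(2)] e that half in auto)
    then show ?thesis using e \<tau>(3) that by (simp add: prod_eq_iff)
  qed
  have \<tau>A: "\<tau> i t \<in> A \<longleftrightarrow> t \<notin> {0<..<1}" if "i \<in> I" "t \<in> {0..1}" for i t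
  proof (cases "t \<in> {0<..<1}")
    case True
    then show ?thesis using \<tau>(4)[OF that] \<sigma>B[OF True, of "fst i"] by (auto simp: A)
  next
    case False
    then have "t = 0 \<or> t = 1" using that by auto
    moreover have "fst i < n - 1" using that(1) by (auto simp: I_def)
    ultimately have "\<sigma> (fst i) t \<in> B" using \<sigma>end by auto
    then show ?thesis using \<tau>(4)[OF that] \<tau>p[OF that] False by (auto simp: A)
  qed
  define \<gamma> where "\<gamma> i = k \<circ> \<tau> i" for i
  have ends: "pathstart (\<gamma> i) = k (\<tau> i 0)" "pathfinish (\<gamma> i) = k (\<tau> i 1)" for i
    by (auto simp: \<gamma>_def pathstart_def pathfinish_def)
  have int\<gamma>: "\<exists>t\<in>{0<..<1}. z = k (\<tau> i t)" if zi: "z \<in> path_image (\<gamma> i) - {pathstart (\<gamma> i), pathfinish (\<gamma> i)}" for i z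
  proof -
    obtain t where t: "t \<in> {0..1}" "z = k (\<tau> i t)" using zi by (auto simp: path_image_def \<gamma>_def)
    then have "t \<noteq> 0" "t \<noteq> 1" using zi ends by auto
    then show ?thesis using t by (intro bexI[of _ t]) auto
  qed
  have pA: "A \<subseteq> S2 - {p'}" using p' p by (auto simp: A)
  have arc\<gamma>: "arc (\<gamma> i)" if i: "i \<in> I" for i
  proof -
    have "path (\<gamma> i)" unfolding \<gamma>_def
      by (rule path_continuous_image[OF \<tau>(1)[OF i]], rule continuous_on_subset[OF ck]) (use \<tau>p[OF i] in \<open>unfold path_image_def, blast\<close>)
    moreover have "inj_on (\<gamma> i) {0..1}"
    proof (rule inj_onI)
      fix s t :: real assume st: "s \<in> {0..1}" "t \<in> {0..1}" "\<gamma> i s = \<gamma> i t"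
      then have "\<tau> i s = \<tau> i t" using inj_k \<tau>p[OF i] by (auto simp: \<gamma>_def)
      then have "\<sigma> (fst i) s = \<sigma> (fst i) t" using \<tau>(4)[OF i] st by metis
      then show "s = t" by (simp add: \<sigma>_def inj_h' del: of_real_add)
    qed
    ultimately show ?thesis by (simp add: arc_def)
  qed
  let ?G = "k ` A \<union> (\<Union>i\<in>I. path_image (\<gamma> i))"
  have "\<exists>m. has_faces ?G m \<and> card I + 2 \<le> m + card (k ` A)"
  proof (rule planar_graph_faces[OF finI])
    show "finite (k ` A)" "k ` A \<noteq> {}" using finA \<open>A \<noteq> {}\<close> by auto
    fix i assume i: "i \<in> I"
    show "arc (\<gamma> i)" by (rule arc\<gamma>[OF i])
    show "pathstart (\<gamma> i) \<in> k ` A \<and> pathfinish (\<gamma> i) \<in> k ` A" unfolding ends using \<tau>A[OF i] by auto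
    show "(path_image (\<gamma> i) - {pathstart (\<gamma> i), pathfinish (\<gamma> i)}) \<inter> k ` A = {}"
    proof -
      have False if z: "z \<in> path_image (\<gamma> i) - {pathstart (\<gamma> i), pathfinish (\<gamma> i)}" "z \<in> k ` A" for z
      proof -
        obtain t a where "t \<in> {0<..<1}" "a \<in> A" "k (\<tau> i t) = k a" using int\<gamma>[OF z(1)] z(2) by auto
        moreover have "t \<in> {0..1}" using calculation by auto
        ultimately have "\<tau> i t = a" using inj_k[of "\<tau> i t" a] \<tau>p[OF i, of t] pA by blast
        then show False using \<tau>A[OF i \<open>t \<in> {0..1}\<close>] \<open>a \<in> A\<close> \<open>t \<in> {0<..<1}\<close> by blast
      qed
      then show ?thesis by blast
    qed
    fix j assume j: "j \<in> I" "i \<noteq> j"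
    show "(path_image (\<gamma> i) - {pathstart (\<gamma> i), pathfinish (\<gamma> i)}) \<inter> (path_image (\<gamma> j) - {pathstart (\<gamma> j), pathfinish (\<gamma> j)}) = {}"
    proof -
      have False if z: "z \<in> path_image (\<gamma> i) - {pathstart (\<gamma> i), pathfinish (\<gamma> i)}"
          "z \<in> path_image (\<gamma> j) - {pathstart (\<gamma> j), pathfinish (\<gamma> j)}" for z
      proof -
        obtain t s where ts: "t \<in> {0<..<1}" "s \<in> {0<..<1}" "k (\<tau> i t) = k (\<tau> j s)" using int\<gamma>[OF z(1)] int\<gamma>[OF z(2)] by auto
        then have "\<tau> i t = \<tau> j s" using inj_k[of "\<tau> i t" "\<tau> j s"] \<tau>p[OF i, of t] \<tau>p[OF j(1), of s] by auto
        then show False using \<tau>inj[OF i j(1) ts(1,2)] j(2) by blast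
      qed
      then show ?thesis by blast
    qed
  qed
  then obtain m where m: "has_faces ?G m" "card I + 2 \<le> m + card (k ` A)" by blast
  have ckA: "card (k ` A) \<le> card A" using finA by (rule card_image_le)
  \<comment> \<open>The whole arc in the chart \<open>h\<close>. For n = 1 it degenerates to the
    point 0 and the graph has no edges.\<close>
  define seg where "seg = complex_of_real ` {0..real (n - 1)}"
  have seg: "bounded seg" "convex seg"
  proof -
    have "closed_segment (of_real 0) (of_real (real (n-1)) :: complex) = of_real ` closed_segment 0 (real (n-1))"
      by (rule closed_segment_of_real)
    then have "seg = closed_segment (of_real 0) (of_real (real (n-1)))" unfolding seg_def
      by (simp add: closed_segment_eq_real_ivl)
    then show "bounded seg" "convex seg"
      by (simp_all add: compact_imp_bounded compact_segment)
  qed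
  have pcseg: "path_connected (- seg)" by (rule path_connected_complement_bounded_convex[OF seg]) auto
  \<comment> \<open>Together with \<open>Gseg\<close> this says that the graph consists exactly of
    the points over the arc. A point over time \<open>t\<close> of the j-th edge lies on some lift
    of that edge, and by uniqueness this lift agrees with the one indexed by its midpoint.\<close>
  have segG: "k x \<in> ?G" if x: "x \<in> S2" "x \<noteq> p'" "z \<in> seg" "g x = h' z" for x z
  proof (cases "x \<in> A")
    case False
    obtain s where s: "z = of_real s" "0 \<le> s" "s \<le> real (n - 1)" using x(3) unfolding seg_def by auto
    define j where "j = nat \<lfloor>s\<rfloor>"
    define t where "t = s - real j"
    have jt: "s = real j + t" "0 \<le> t" "t < 1" using s(2) by (auto simp: j_def t_def) linarith
    have "h' (of_nat j) \<notin> B" if "t = 0" using that False x s jt by (auto simp: A)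
    moreover have "j \<le> n - 1" using jt s by linarith
    moreover have "t = 0" if "j = n - 1" using that jt s by simp
    ultimately have "t \<noteq> 0" "j < n - 1" using bB[of j] n1 by (cases "j = n - 1"; force)+
    then have t: "t \<in> {0<..<1}" using jt by auto
    have gx: "g x = \<sigma> j t" using x s jt by (simp add: \<sigma>_def)
    note T = \<tau>0[OF t x(1) gx]
    define x0 where "x0 = \<tau>0 t x j (1/2)"
    have "g x0 = \<sigma> j (1/2)" "x0 \<in> S2" using T unfolding x0_def by (auto simp: path_image_def)
    then have i: "(j, x0) \<in> I" using \<open>j < n - 1\<close> by (auto simp: I_def)
    have "\<tau> (j, x0) t = \<tau>0 t x j t"
      by (rule uniq[of _ j _ "1/2"]) (use \<tau>[OF i] T t half in \<open>auto simp: x0_def\<close>)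
    then have "x = \<tau> (j, x0) t" using T by simp
    then have "k x \<in> path_image (\<gamma> (j, x0))" using t by (auto simp: path_image_def \<gamma>_def)
    then show ?thesis using i by blast
  qed auto
  have Gseg: "\<exists>z\<in>seg. g x = h' z" if xG: "k x \<in> ?G" "x \<in> S2" "x \<noteq> p'" for x
  proof -
    consider "x \<in> A" | i t where "i \<in> I" "t \<in> {0..1}" "x = \<tau> i t"
    proof -
      have xp: "x \<in> S2 - {p'}" using xG by blast
      consider a where "a \<in> A" "k x = k a" | i t where "i \<in> I" "t \<in> {0..1}" "k x = k (\<tau> i t)"
        using xG(1) by (auto simp: path_image_def \<gamma>_def)
      then show ?thesis
        by cases (use inj_k[OF xp] pA \<tau>p that in blast)+
    qed
    then show ?thesis
    proof cases
      case 1
      then have "g x \<in> B" by (simp add: A)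
      then have "g x = h' (h (g x))" using h'(1)[of "g x"] B(2) p by (metis subsetD)
      moreover obtain i where "i < n" "h (g x) = of_nat i" using Bb[of "h (g x)"] calculation \<open>g x \<in> B\<close> by metis
      ultimately show ?thesis unfolding seg_def by (intro bexI[of _ "h (g x)"]) (auto intro!: image_eqI[of _ _ "real i"])
    next
      case 2
      then have "fst i < n - 1" by (auto simp: I_def)
      then have "real (fst i) + t \<in> {0..real (n - 1)}" using 2 by auto
      then show ?thesis using \<tau>(4)[OF 2(1,2)] 2(3) unfolding seg_def \<sigma>_def by blast
    qed
  qed
  have clG: "closed ?G"
    using finA finI arc\<gamma> by (intro closed_Un closed_UN) (auto simp: finite_imp_closed closed_arc_image)
  \<comment> \<open>A target for paths off the arc: the arc lies over nonnegative reals, so -1 is in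
    the complement of \<open>seg\<close>.\<close>
  define q where "q = h' (-1)"
  have qseg: "-1 \<notin> seg" unfolding seg_def by (auto simp: complex_eq_iff)
  have qB: "q \<in> S2 - B" using Bb[of "-1"] h'(3) unfolding q_def by (auto simp: complex_eq_iff)
  \<comment> \<open>The complement of the arc is path connected, so a path from the image of a face
    point to \<open>q\<close> lifts to a path off the graph. Thus every face contains one of the D
    points over \<open>q\<close>.\<close>
  have reach: "\<exists>x\<in>{x\<in>S2. g x = q}. connected_component (- ?G) r (k x)" if r: "r \<notin> ?G" for r
  proof -
    let ?K = "connected_component_set (- ?G) r"
    have "open ?K" by (rule open_connected_component[OF open_Compl[OF clG]])
    moreover have "r \<in> ?K" using r connected_component_refl[of r "- ?G"] by blast
    ultimately have "infinite ?K" using finite_imp_not_open by blast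
    \<comment> \<open>The start is moved within its open face off the finitely many points over
      \<open>p\<close>, since the chart \<open>h\<close> says nothing there.\<close>
    then obtain r0 where r0: "r0 \<in> ?K" "r0 \<notin> k ` {x\<in>S2. g x = p}"
      using ff[of p] by (meson finite_imageI finite_subset subsetI)
    define x where "x = k' r0"
    have x: "x \<in> S2" "x \<noteq> p'" "k x = r0" using k' by (auto simp: x_def)
    have gxp: "g x \<noteq> p" using r0(2) x by auto
    have gxS: "g x \<in> S2" using gS x by blast
    have r0G: "r0 \<notin> ?G" using r0(1) connected_component_subset[of "- ?G" r] by blast
    have hx: "h (g x) \<notin> seg" using segG[OF x(1,2), of "h (g x)"] h'(1)[OF gxS gxp] r0G x(3) by auto
    obtain w where w: "path w" "path_image w \<subseteq> - seg" "pathstart w = h (g x)" "pathfinish w = -1"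
      using pcseg hx qseg unfolding path_connected_def by blast
    have Bseg: "h' z \<notin> B" if "z \<notin> seg" for z
    proof
      assume "h' z \<in> B"
      then obtain i where "i < n" "z = of_nat i" using Bb by blast
      then have "z \<in> seg" unfolding seg_def by (intro image_eqI[of _ _ "real i"]) auto
      then show False using that by blast
    qed
    obtain P where P: "path P" "path_image P \<subseteq> S2 - A" "pathstart P = x" "\<And>t. t \<in> {0..1} \<Longrightarrow> g (P t) = (h' \<circ> w) t"
    proof (rule covering_space_lift_path_strong[OF cov, of x "h' \<circ> w"])
      show "x \<in> S2 - A" using x r0G by auto
      show "path (h' \<circ> w)" by (rule path_continuous_image[OF w(1)]) (rule continuous_on_subset[OF ch'], simp)
      show "path_image (h' \<circ> w) \<subseteq> S2 - B" using w(2) Bseg h'(3) unfolding path_image_compose by blast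
      show "pathstart (h' \<circ> w) = g x" using w h'(1)[OF gxS gxp] by (simp add: pathstart_compose)
    qed (rule that)
    have Pt: "P t \<in> S2 \<and> P t \<noteq> p' \<and> k (P t) \<notin> ?G" if t: "t \<in> {0..1}" for t
    proof -
      have 1: "P t \<in> S2" using P(2) t unfolding path_image_def by blast
      have 2: "g (P t) = h' (w t)" using P(4)[OF t] by simp
      then have 3: "P t \<noteq> p'" using p'(2) h'(4)[of "w t"] by auto
      have "w t \<notin> seg" using w(2) t unfolding path_image_def by blast
      then have "k (P t) \<notin> ?G" using Gseg[OF _ 1 3] 2 inj_h' by metis
      then show ?thesis using 1 3 by blast
    qed
    have "path (k \<circ> P)"
      by (rule path_continuous_image[OF P(1)], rule continuous_on_subset[OF ck]) (use Pt in \<open>unfold path_image_def, blast\<close>)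
    moreover have "path_image (k \<circ> P) \<subseteq> - ?G"
    proof
      fix z assume "z \<in> path_image (k \<circ> P)"
      then obtain t where "t \<in> {0..1}" "z = k (P t)" unfolding path_image_def comp_def by blast
      then show "z \<in> - ?G" using Pt[of t] by (metis ComplI)
    qed
    moreover have "pathstart (k \<circ> P) = r0" using P(3) x by (simp add: pathstart_compose)
    moreover have "pathfinish (k \<circ> P) = k (pathfinish P)" by (rule pathfinish_compose)
    ultimately have "path_component (- ?G) r0 (k (pathfinish P))"
      unfolding path_component_def by blast
    then have "connected_component (- ?G) r0 (k (pathfinish P))"
      using path_component_subset_connected_component[of "- ?G" r0] by (metis mem_Collect_eq subsetD)
    then have "connected_component (- ?G) r (k (pathfinish P))"
      using r0(1) connected_component_trans by blast
    moreover have "pathfinish P \<in> {x\<in>S2. g x = q}"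
      using P(4)[of 1] Pt[of 1] w(4) by (auto simp: pathfinish_def q_def)
    ultimately show ?thesis by blast
  qed
  have "m \<le> D"
  proof -
    obtain R where R: "finite R" "card R = m" "R \<subseteq> - ?G" "pairwise (\<lambda>x y. \<not> connected_component (- ?G) x y) R"
      using m(1) unfolding has_faces_def by blast
    define \<rho> where "\<rho> r = (SOME x. x \<in> {x\<in>S2. g x = q} \<and> connected_component (- ?G) r (k x))" for r
    have \<rho>: "\<rho> r \<in> {x\<in>S2. g x = q} \<and> connected_component (- ?G) r (k (\<rho> r))" if "r \<notin> ?G" for r
      unfolding \<rho>_def by (rule someI_ex) (use reach[OF that] in \<open>simp only: Bex_def\<close>)
    have "inj_on \<rho> R"
    proof (rule inj_onI)
      fix a c assume ac: "a \<in> R" "c \<in> R" "\<rho> a = \<rho> c"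
      have "connected_component (- ?G) a (k (\<rho> a))" "connected_component (- ?G) c (k (\<rho> a))"
        using \<rho>[of a] \<rho>[of c] ac R(3) by (metis ComplD subsetD)+
      then have "connected_component (- ?G) a c"
        by (meson connected_component_sym connected_component_trans)
      then show "a = c" using R(4) ac unfolding pairwise_def by blast
    qed
    moreover have "\<rho> ` R \<subseteq> {x\<in>S2. g x = q}" using \<rho> R(3) by (meson ComplD image_subsetI subsetD)
    ultimately have "card R \<le> card {x\<in>S2. g x = q}" using ff card_inj_on_le by blast
    then show ?thesis using R(2) cardD[OF qB] by simp
  qed
  then have "(n - 1) * D + 2 \<le> D + card A" using m(2) ckA cardI by linarith
  then show ?thesis using n1 unfolding D_def[symmetric] n_def[symmetric]
    by (cases n) (auto simp: algebra_simps)
qed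

section \<open>Transport of local models and coverings along homeomorphisms\<close>

lemma local_model_transport:
  assumes a: "homeomorphism S T a a'" and c: "homeomorphism S' T' c c'"
    and lm: "local_model S S' f x d"
  shows "local_model T T' (c \<circ> f \<circ> a') (a x) d"
proof -
  from lm obtain U W \<phi> \<phi>' \<psi> \<psi>' where d: "d \<ge> 1" and
    U: "openin (top_of_set S) U" "x \<in> U" and W: "openin (top_of_set S') W"
    and fU: "f ` U \<subseteq> W"
    and \<phi>: "homeomorphism U (ball (0::complex) 1) \<phi> \<phi>'"
    and \<psi>: "homeomorphism W (ball (0::complex) 1) \<psi> \<psi>'"
    and 0: "\<phi> x = 0" "\<psi> (f x) = 0" and pw: "\<And>y. y\<in>U \<Longrightarrow> \<psi> (f y) = (\<phi> y) ^ d"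
    unfolding local_model_def by blast
  have US: "U \<subseteq> S" and WS: "W \<subseteq> S'" using U W openin_imp_subset by blast+
  have aU: "a' (a u) = u" if "u \<in> U" for u using a US that by (auto simp: homeomorphism_def)
  have cW: "c' (c w) = w" if "w \<in> W" for w using c WS that by (auto simp: homeomorphism_def)
  have h1: "homeomorphism (a ` U) U a' a"
    by (rule homeomorphism_of_subsets[OF homeomorphism_symD[OF a]]) (use US a aU in \<open>auto simp: homeomorphism_def image_iff\<close>)
  have h2: "homeomorphism (c ` W) W c' c"
    by (rule homeomorphism_of_subsets[OF homeomorphism_symD[OF c]]) (use WS c cW in \<open>auto simp: homeomorphism_def image_iff\<close>)
  have o: "openin (top_of_set T) (a ` U)" "openin (top_of_set T') (c ` W)"
    using homeomorphism_imp_open_map[OF a U(1)] homeomorphism_imp_open_map[OF c W(1)] by auto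
  show ?thesis
    unfolding local_model_def
  proof (intro conjI exI)
    show "homeomorphism (a ` U) (ball 0 1) (\<phi> \<circ> a') (a \<circ> \<phi>')" by (rule homeomorphism_compose[OF h1 \<phi>])
    show "homeomorphism (c ` W) (ball 0 1) (\<psi> \<circ> c') (c \<circ> \<psi>')" by (rule homeomorphism_compose[OF h2 \<psi>])
    show "(c \<circ> f \<circ> a') ` (a ` U) \<subseteq> c ` W" using fU aU by auto
    show "\<forall>y\<in>a ` U. (\<psi> \<circ> c') ((c \<circ> f \<circ> a') y) = (\<phi> \<circ> a') y ^ d" using aU cW fU pw by auto
    show "(\<psi> \<circ> c') ((c \<circ> f \<circ> a') (a x)) = 0" "(\<phi> \<circ> a') (a x) = 0" using aU cW fU 0 U by auto
  qed (use d U o in auto)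
qed

lemma covering_space_transport:
  assumes a: "homeomorphism C C1 a a'" and c: "homeomorphism D D1 c c'"
    and cov: "covering_space C f D"
  shows "covering_space C1 (c \<circ> f \<circ> a') D1"
proof
  have cont: "continuous_on C f" and im: "f ` C = D" using cov by (auto simp: covering_space_def)
  have a1: "\<And>x. x \<in> C \<Longrightarrow> a' (a x) = x \<and> a x \<in> C1" "\<And>x. x \<in> C1 \<Longrightarrow> a (a' x) = x \<and> a' x \<in> C" "continuous_on C1 a'" "a' ` C1 = C"
    and c1: "\<And>x. x \<in> D \<Longrightarrow> c' (c x) = x \<and> c x \<in> D1" "\<And>x. x \<in> D1 \<Longrightarrow> c (c' x) = x \<and> c' x \<in> D" "continuous_on D c" "c ` D = D1"
    using a c by (auto simp: homeomorphism_def)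
  show "continuous_on C1 (c \<circ> f \<circ> a')"
    using a1 c1 cont im by (intro continuous_on_compose) auto
  show "(c \<circ> f \<circ> a') ` C1 = D1" by (simp only: image_comp[symmetric] a1(4) im c1(4))
  fix y assume y: "y \<in> D1"
  then obtain T v where T: "c' y \<in> T" "openin (top_of_set D) T" "\<Union>v = C \<inter> f -` T"
     "\<And>u. u \<in> v \<Longrightarrow> openin (top_of_set C) u" "pairwise disjnt v" "\<And>u. u \<in> v \<Longrightarrow> \<exists>q. homeomorphism u T f q"
    using cov c1(2) unfolding covering_space_def by metis
  have TD: "T \<subseteq> D" using T(2) openin_imp_subset by blast
  have uC: "u \<subseteq> C" if "u \<in> v" for u using T(4)[OF that] openin_imp_subset by blast
  show "\<exists>T. y \<in> T \<and> openin (top_of_set D1) T \<and> (\<exists>v. \<Union>v = C1 \<inter> (c \<circ> f \<circ> a') -` T \<and>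
      (\<forall>u\<in>v. openin (top_of_set C1) u) \<and> pairwise disjnt v \<and> (\<forall>u\<in>v. \<exists>q. homeomorphism u T (c \<circ> f \<circ> a') q))"
  proof (intro exI[of _ "c ` T"] conjI exI[of _ "(`) a ` v"] ballI)
    show "y \<in> c ` T" using T(1) c1(2)[OF y] by (metis imageI)
    show "openin (top_of_set D1) (c ` T)" using homeomorphism_imp_open_map[OF c T(2)] .
    show "\<Union>((`) a ` v) = C1 \<inter> (c \<circ> f \<circ> a') -` (c ` T)"
    proof
      show "\<Union>((`) a ` v) \<subseteq> C1 \<inter> (c \<circ> f \<circ> a') -` (c ` T)"
      proof
        fix z assume "z \<in> \<Union>((`) a ` v)"
        then obtain u x where "u \<in> v" "x \<in> u" "z = a x" by blast
        moreover have "x \<in> C \<inter> f -` T" using T(3) calculation by blast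
        ultimately show "z \<in> C1 \<inter> (c \<circ> f \<circ> a') -` (c ` T)" using a1 by auto
      qed
      show "C1 \<inter> (c \<circ> f \<circ> a') -` (c ` T) \<subseteq> \<Union>((`) a ` v)"
      proof
        fix z assume z: "z \<in> C1 \<inter> (c \<circ> f \<circ> a') -` (c ` T)"
        then obtain t where t: "t \<in> T" "c (f (a' z)) = c t" by auto
        have "f (a' z) \<in> D" using z a1 im by auto
        then have "f (a' z) = t" using t c1 TD by (metis subsetD)
        then have "a' z \<in> \<Union>v" using T(3) t z a1 by auto
        then show "z \<in> \<Union>((`) a ` v)" using a1(2)[of z] z by (metis IntD1 UnionE UnionI imageI)
      qed
    qed
    show "pairwise disjnt ((`) a ` v)"
    proof -
      have "disjnt (a ` u) (a ` w)" if "u \<in> v" "w \<in> v" "a ` u \<noteq> a ` w" for u w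
      proof -
        have "disjnt u w" using T(5) that by (auto simp: pairwise_def)
        moreover have "inj_on a C" using a1 by (metis inj_on_inverseI)
        ultimately show ?thesis using uC that unfolding disjnt_def inj_on_def by blast
      qed
      then show ?thesis by (auto simp: pairwise_def)
    qed
    fix u1 assume "u1 \<in> (`) a ` v"
    then obtain u where u: "u \<in> v" "u1 = a ` u" by auto
    show "openin (top_of_set C1) u1" using homeomorphism_imp_open_map[OF a T(4)] u by auto
    obtain q where q: "homeomorphism u T f q" using T(6) u by blast
    have h1: "homeomorphism u1 u a' a"
    proof (rule homeomorphism_of_subsets[OF homeomorphism_symD[OF a], where T'' = u])
      show "u1 \<subseteq> C1" using u uC[OF u(1)] a1(1) by auto
      show "u \<subseteq> C" by (rule uC[OF u(1)])
      have "a' ` a ` u = (\<lambda>x. x) ` u" unfolding image_image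
        by (rule image_cong) (use uC[OF u(1)] a1(1) in auto)
      then show "a' ` u1 = u" using u by simp
    qed
    have h2: "homeomorphism T (c ` T) c c'"
      by (rule homeomorphism_of_subsets[OF c]) (use TD c1 in auto)
    have "homeomorphism u1 (c ` T) (c \<circ> (f \<circ> a')) ((a \<circ> q) \<circ> c')"
      by (rule homeomorphism_compose[OF homeomorphism_compose[OF h1 q] h2])
    then show "\<exists>q. homeomorphism u1 (c ` T) (c \<circ> f \<circ> a') q" unfolding comp_assoc by blast
  qed
qed

section \<open>Branched coverings between abstract topological spheres\<close>

context
  fixes S S' :: "'p::topological_space set" and f :: "'p \<Rightarrow> 'p"
  assumes S: "S homeomorphic S2" and S': "S' homeomorphic S2" and bc: "branched_covering S S' f"
begin

text \<open>The spheres live in a bare topological space. The metric and planar arguments are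
  carried out on \<open>S2\<close>, and degrees and fibres are compared through charts.\<close>

lemma sphere_model:
  obtains a a' c c' where "homeomorphism S S2 a a'" "homeomorphism S' S2 c c'"
    "branched_covering S2 S2 (c \<circ> f \<circ> a')" "bc_degree S2 S2 (c \<circ> f \<circ> a') = bc_degree S S' f"
    "\<And>x. x \<in> S \<Longrightarrow> local_degree S2 S2 (c \<circ> f \<circ> a') (a x) = local_degree S S' f x"
    "\<And>y. y \<in> S' \<Longrightarrow> bij_betw a {x\<in>S. f x = y} {x\<in>S2. (c \<circ> f \<circ> a') x = c y}"
proof -
  note [simp del] = mem_sphere mem_sphere_0
  obtain a a' c c' where a: "homeomorphism S S2 a a'" and c: "homeomorphism S' S2 c c'"
    using S S' unfolding homeomorphic_def by blast
  let ?g = "c \<circ> f \<circ> a'"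
  have cont: "continuous_on S f" and im: "f ` S = S'" using bc by (auto simp: branched_covering_def)
  have a1: "\<And>x. x \<in> S \<Longrightarrow> a' (a x) = x \<and> a x \<in> S2" "\<And>x. x \<in> S2 \<Longrightarrow> a (a' x) = x \<and> a' x \<in> S" "continuous_on S2 a'" "a' ` S2 = S"
    and c1: "\<And>x. x \<in> S' \<Longrightarrow> c' (c x) = x \<and> c x \<in> S2" "\<And>x. x \<in> S2 \<Longrightarrow> c (c' x) = x \<and> c' x \<in> S'" "continuous_on S' c" "c ` S' = S2"
    using a c unfolding homeomorphism_def by blast+
  have fS: "f x \<in> S'" if "x \<in> S" for x using im that by blast
  have lm: "local_model S2 S2 ?g (a x) (local_degree S S' f x)" if "x \<in> S" for x
    using local_model_transport[OF a c local_model_local_degree[OF bc that]] .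
  have bcg: "branched_covering S2 S2 ?g" unfolding branched_covering_def
  proof (intro conjI ballI)
    show "continuous_on S2 ?g" using a1 c1 cont im by (intro continuous_on_compose) auto
    show "?g ` S2 = S2" by (simp only: image_comp[symmetric] a1(4) im c1(4))
    fix x assume "x \<in> S2"
    then show "\<exists>d. local_model S2 S2 ?g x d" using lm[of "a' x"] a1(2)[of x] by auto
  qed
  have ld: "local_degree S2 S2 ?g (a x) = local_degree S S' f x" if "x \<in> S" for x
    using lm[OF that] by (rule local_degree_eq)
  have bij: "bij_betw a {x\<in>S. f x = y} {x\<in>S2. ?g x = c y}" if "y \<in> S'" for y
  proof (rule bij_betw_byWitness[where f' = a'])
    show "a ` {x \<in> S. f x = y} \<subseteq> {x \<in> S2. ?g x = c y}" using a1 by auto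
    show "a' ` {x \<in> S2. ?g x = c y} \<subseteq> {x \<in> S. f x = y}"
    proof
      fix z assume "z \<in> a' ` {x \<in> S2. ?g x = c y}"
      then obtain x where x: "x \<in> S2" "?g x = c y" "z = a' x" by blast
      have "a' x \<in> S" using a1(2)[OF x(1)] by blast
      moreover have "f (a' x) = y" using c1(1)[OF fS[OF \<open>a' x \<in> S\<close>]] c1(1)[OF that] x(2) by (metis comp_apply)
      ultimately show "z \<in> {x \<in> S. f x = y}" using x(3) by simp
    qed
  qed (use a1 in auto)
  have "S2 \<noteq> {}" using infinite_S2 by (metis finite.emptyI)
  then have "S' \<noteq> {}" using c1(4) by blast
  \<comment> \<open>This is the very point at which \<open>bc_degree S S' f\<close> is evaluated;
    constancy of the fibre sum on \<open>S2\<close> allows the degree of the model to be computed at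
    its image \<open>c y\<close>.\<close>
  define y where "y = (SOME y. y \<in> S')"
  have y: "y \<in> S'" unfolding y_def using \<open>S' \<noteq> {}\<close> some_in_eq by blast
  have "bc_degree S2 S2 ?g = (\<Sum>x\<in>{x\<in>S2. ?g x = c y}. local_degree S2 S2 ?g x)"
    by (rule fibre_sum_constant[OF compact_S2 bcg connected_S2, symmetric]) (use c1(1)[OF y] in blast)
  also have "\<dots> = (\<Sum>x\<in>{x\<in>S. f x = y}. local_degree S2 S2 ?g (a x))"
    by (rule sum.reindex_bij_betw[OF bij[OF y], symmetric])
  also have "\<dots> = (\<Sum>x\<in>{x\<in>S. f x = y}. local_degree S S' f x)" using ld by (intro sum.cong) auto
  also have "\<dots> = bc_degree S S' f" unfolding bc_degree_def y_def Let_def ..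
  finally show ?thesis using that[OF a c bcg _ ld bij] by blast
qed

lemma sphere_finite_fibre:
  assumes "y \<in> S'" shows "finite {x\<in>S. f x = y}"
proof -
  obtain a a' c c' where a: "homeomorphism S S2 a a'" and c: "homeomorphism S' S2 c c'"
    and bcg: "branched_covering S2 S2 (c \<circ> f \<circ> a')" and deg_eq: "bc_degree S2 S2 (c \<circ> f \<circ> a') = bc_degree S S' f"
    and ld: "\<And>x. x \<in> S \<Longrightarrow> local_degree S2 S2 (c \<circ> f \<circ> a') (a x) = local_degree S S' f x"
    and bij: "\<And>y. y \<in> S' \<Longrightarrow> bij_betw a {x\<in>S. f x = y} {x\<in>S2. (c \<circ> f \<circ> a') x = c y}"
    by (rule sphere_model) (rule that)
  show ?thesis using branched_covering_finite_fibre[OF compact_S2 bcg] bij_betw_finite[OF bij[OF assms]] by blast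
qed

lemma sphere_fibre_sum:
  assumes "y \<in> S'" shows "(\<Sum>x\<in>{x\<in>S. f x = y}. local_degree S S' f x) = bc_degree S S' f"
proof -
  obtain a a' c c' where a: "homeomorphism S S2 a a'" and c: "homeomorphism S' S2 c c'"
    and bcg: "branched_covering S2 S2 (c \<circ> f \<circ> a')" and deg_eq: "bc_degree S2 S2 (c \<circ> f \<circ> a') = bc_degree S S' f"
    and ld: "\<And>x. x \<in> S \<Longrightarrow> local_degree S2 S2 (c \<circ> f \<circ> a') (a x) = local_degree S S' f x"
    and bij: "\<And>y. y \<in> S' \<Longrightarrow> bij_betw a {x\<in>S. f x = y} {x\<in>S2. (c \<circ> f \<circ> a') x = c y}"
    by (rule sphere_model) (rule that)
  have "c y \<in> S2" using c assms unfolding homeomorphism_def by blast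
  have "(\<Sum>x\<in>{x\<in>S. f x = y}. local_degree S S' f x) = (\<Sum>x\<in>{x\<in>S. f x = y}. local_degree S2 S2 (c \<circ> f \<circ> a') (a x))"
    using ld by (intro sum.cong) auto
  also have "\<dots> = (\<Sum>x\<in>{x\<in>S2. (c \<circ> f \<circ> a') x = c y}. local_degree S2 S2 (c \<circ> f \<circ> a') x)"
    by (rule sum.reindex_bij_betw[OF bij[OF assms]])
  also have "\<dots> = bc_degree S S' f"
    using fibre_sum_constant[OF compact_S2 bcg connected_S2 \<open>c y \<in> S2\<close>] deg_eq by simp
  finally show ?thesis .
qed

lemma sphere_ramified_over_one_point:
  assumes b: "b \<in> S'" and deg: "\<And>x. \<lbrakk>x \<in> S; f x \<noteq> b\<rbrakk> \<Longrightarrow> local_degree S S' f x = 1"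
  shows "bc_degree S S' f = 1"
proof -
  obtain a a' c c' where a: "homeomorphism S S2 a a'" and c: "homeomorphism S' S2 c c'"
    and bcg: "branched_covering S2 S2 (c \<circ> f \<circ> a')" and deg_eq: "bc_degree S2 S2 (c \<circ> f \<circ> a') = bc_degree S S' f"
    and ld: "\<And>x. x \<in> S \<Longrightarrow> local_degree S2 S2 (c \<circ> f \<circ> a') (a x) = local_degree S S' f x"
    and bij: "\<And>y. y \<in> S' \<Longrightarrow> bij_betw a {x\<in>S. f x = y} {x\<in>S2. (c \<circ> f \<circ> a') x = c y}"
    by (rule sphere_model) (rule that)
  have "bc_degree S2 S2 (c \<circ> f \<circ> a') = 1"
  proof (rule S2_ramified_over_one_point[OF bcg])
    show "c b \<in> S2" using c b unfolding homeomorphism_def by blast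
    fix x assume x: "x \<in> S2" "(c \<circ> f \<circ> a') x \<noteq> c b"
    have "a' x \<in> S" "a (a' x) = x" using a x unfolding homeomorphism_def by blast+
    then show "local_degree S2 S2 (c \<circ> f \<circ> a') x = 1" using ld[of "a' x"] deg[of "a' x"] x(2) by auto
  qed
  then show ?thesis using deg_eq by simp
qed

lemma sphere_local_degree_covering:
  assumes "finite A" "A \<subseteq> S" "covering_space (S - A) f D" "x \<in> S - A"
  shows "local_degree S S' f x = 1"
proof -
  obtain a a' where a: "homeomorphism S S2 a a'" using S unfolding homeomorphic_def by blast
  \<comment> \<open>That points are closed in \<open>S\<close> is known only through the chart, so
    openness of \<open>S - A\<close> is pulled back from \<open>S2\<close>.\<close>
  have "openin (top_of_set S2) (S2 - a ` A)"
    using finite_imp_closed[of "a ` A"] assms(1) by (simp add: Diff_eq openin_open_Int open_Compl)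
  then have "openin (top_of_set S) (S \<inter> a -` (S2 - a ` A))"
    using openin_homeomorphism_image[OF a] by auto
  moreover have "S \<inter> a -` (S2 - a ` A) = S - A"
  proof -
    have "a z \<notin> a ` A" if "z \<in> S" "z \<notin> A" for z
      using a that assms(2) unfolding homeomorphism_def by (metis imageE subsetD)
    moreover have "a z \<in> S2" if "z \<in> S" for z using a that unfolding homeomorphism_def by blast
    ultimately show ?thesis by blast
  qed
  ultimately have o: "openin (top_of_set S) (S - A)" by simp
  obtain T u q where T: "x \<in> T" "openin (top_of_set (S - A)) T" "homeomorphism T u f q"
    using covering_space_local_homeomorphism[OF assms(3,4)] by metis
  have "openin (top_of_set S) T" using T(2) o openin_trans by blast
  moreover have "inj_on f T" using T(3) unfolding homeomorphism_def by (metis inj_on_inverseI)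
  ultimately show ?thesis using local_degree_locally_injective[OF bc] T(1) by blast
qed

lemma sphere_hurwitz_inequality:
  assumes B: "finite B" "B \<subseteq> S'" "B \<noteq> {}"
    and A: "A = {x\<in>S. f x \<in> B}" and cov: "covering_space (S - A) f (S' - B)"
  shows "bc_degree S S' f * card B + 2 \<le> card A + 2 * bc_degree S S' f"
proof -
  obtain a a' c c' where a: "homeomorphism S S2 a a'" and c: "homeomorphism S' S2 c c'"
    and bcg: "branched_covering S2 S2 (c \<circ> f \<circ> a')" and deg_eq: "bc_degree S2 S2 (c \<circ> f \<circ> a') = bc_degree S S' f"
    and ld: "\<And>x. x \<in> S \<Longrightarrow> local_degree S2 S2 (c \<circ> f \<circ> a') (a x) = local_degree S S' f x"
    and bij: "\<And>y. y \<in> S' \<Longrightarrow> bij_betw a {x\<in>S. f x = y} {x\<in>S2. (c \<circ> f \<circ> a') x = c y}"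
    by (rule sphere_model) (rule that)
  have im: "f ` S = S'" using bc by (auto simp: branched_covering_def)
  have a1: "\<And>x. x \<in> S \<Longrightarrow> a' (a x) = x \<and> a x \<in> S2" "\<And>x. x \<in> S2 \<Longrightarrow> a (a' x) = x \<and> a' x \<in> S"
    and c1: "\<And>x. x \<in> S' \<Longrightarrow> c' (c x) = x \<and> c x \<in> S2" "\<And>x. x \<in> S2 \<Longrightarrow> c (c' x) = x \<and> c' x \<in> S'"
    using a c unfolding homeomorphism_def by blast+
  have AS: "A \<subseteq> S" using A by blast
  have inja: "inj_on a S" "inj_on c S'" using a1 c1 by (metis inj_on_inverseI)+
  have ima: "a ` S = S2" "c ` S' = S2" using a c unfolding homeomorphism_def by blast+
  have A1: "a ` A = {x\<in>S2. (c \<circ> f \<circ> a') x \<in> c ` B}"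
  proof
    show "a ` A \<subseteq> {x\<in>S2. (c \<circ> f \<circ> a') x \<in> c ` B}" using a1 A by auto
    show "{x\<in>S2. (c \<circ> f \<circ> a') x \<in> c ` B} \<subseteq> a ` A"
    proof
      fix x assume x: "x \<in> {x\<in>S2. (c \<circ> f \<circ> a') x \<in> c ` B}"
      then have "a' x \<in> S" "a (a' x) = x" "c (f (a' x)) \<in> c ` B" using a1(2)[of x] by auto
      moreover have "f (a' x) \<in> S'" using calculation im by blast
      ultimately have "f (a' x) \<in> B" using inja(2) B(2) by (metis inj_on_image_mem_iff)
      then show "x \<in> a ` A" using \<open>a' x \<in> S\<close> \<open>a (a' x) = x\<close> A by (metis (mono_tags, lifting) imageI mem_Collect_eq)
    qed
  qed
  have h1: "homeomorphism (S - A) (S2 - a ` A) a a'"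
    by (rule homeomorphism_of_subsets[OF a]) (use inj_on_image_set_diff[OF inja(1), of S A] AS ima in auto)
  have h2: "homeomorphism (S' - B) (S2 - c ` B) c c'"
    by (rule homeomorphism_of_subsets[OF c]) (use inj_on_image_set_diff[OF inja(2), of S' B] B ima in auto)
  have "bc_degree S2 S2 (c \<circ> f \<circ> a') * card (c ` B) + 2 \<le> card (a ` A) + 2 * bc_degree S2 S2 (c \<circ> f \<circ> a')"
  proof (rule S2_hurwitz_inequality[OF bcg _ _ _ A1 covering_space_transport[OF h1 h2 cov]])
    show "c ` B \<subseteq> S2" using B ima by blast
  qed (use B in auto)
  moreover have "card (c ` B) = card B" "card (a ` A) = card A"
    using inja AS B card_image inj_on_subset by metis+
  ultimately show ?thesis using deg_eq by simp
qed

end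

section \<open>Trees and branches\<close>

text \<open>A walk that runs into an old vertex is cut back to the earlier visit. Cycles are
  distinct lists, so walks must be made simple before acyclicity can be used.\<close>

lemma rtrancl_simple_path:
  assumes "(a, b) \<in> r\<^sup>*"
  obtains xs where "xs \<noteq> []" "hd xs = a" "last xs = b" "distinct xs"
    "\<And>i. Suc i < length xs \<Longrightarrow> (xs ! i, xs ! Suc i) \<in> r"
proof -
  have "\<exists>xs. xs \<noteq> [] \<and> hd xs = a \<and> last xs = b \<and> distinct xs \<and> (\<forall>i. Suc i < length xs \<longrightarrow> (xs ! i, xs ! Suc i) \<in> r)"
    using assms
  proof (induction rule: rtrancl_induct)
    case base
    then show ?case by (intro exI[of _ "[a]"]) auto
  next
    case (step b c)
    then obtain xs where xs: "xs \<noteq> []" "hd xs = a" "last xs = b" "distinct xs"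
        "\<And>i. Suc i < length xs \<Longrightarrow> (xs ! i, xs ! Suc i) \<in> r" by blast
    show ?case
    proof (cases "c \<in> set xs")
      case True
      then obtain ys zs where yz: "xs = ys @ c # zs" by (meson split_list)
      have "((ys @ [c]) ! i, (ys @ [c]) ! Suc i) \<in> r" if "Suc i < length (ys @ [c])" for i
        using xs(5)[of i] that unfolding yz by (auto simp: nth_append split: if_splits)
      then show ?thesis using xs yz by (intro exI[of _ "ys @ [c]"]) (auto simp: hd_append split: if_splits)
    next
      case False
      have "((xs @ [c]) ! i, (xs @ [c]) ! Suc i) \<in> r" if "Suc i < length (xs @ [c])" for i
      proof (cases "Suc i < length xs")
        case True
        then show ?thesis using xs(5)[of i] by (simp add: nth_append)
      next
        case False
        then have i: "i = length xs - 1" using that by simp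
        then have "xs ! i = b" using xs(1,3) by (simp add: last_conv_nth)
        then show ?thesis using step xs(1) i by (simp add: nth_append)
      qed
      then show ?thesis using xs False by (intro exI[of _ "xs @ [c]"]) auto
    qed
  qed
  then show ?thesis using that by blast
qed

lemma adj_in_sym: "(a, b) \<in> adj_in E A \<Longrightarrow> (b, a) \<in> adj_in E A"
  by (auto simp: adj_in_def insert_commute)

lemma conn_sym: "(a, b) \<in> (adj_in E A)\<^sup>* \<Longrightarrow> (b, a) \<in> (adj_in E A)\<^sup>*"
  by (meson adj_in_sym symI sym_rtrancl symD)

lemma conn_mem: "(a, b) \<in> (adj_in E A)\<^sup>* \<Longrightarrow> a \<in> A \<Longrightarrow> b \<in> A"
  by (induction rule: rtrancl_induct) (auto simp: adj_in_def)

lemma conn_avoid: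
  assumes "(a, x) \<in> (adj_in E A)\<^sup>*" "\<And>y. (a, y) \<in> (adj_in E A)\<^sup>* \<Longrightarrow> y \<in> B"
  shows "(a, x) \<in> (adj_in E B)\<^sup>*"
  using assms(1)
proof (induction rule: rtrancl_induct)
  case (step y z)
  have "(a, z) \<in> (adj_in E A)\<^sup>*" using step by (meson rtrancl.rtrancl_into_rtrancl)
  then have "(y, z) \<in> adj_in E B" using step assms(2) by (auto simp: adj_in_def)
  then show ?case using step by (meson rtrancl.rtrancl_into_rtrancl)
qed simp

text \<open>Each return to \<open>v\<close> starts the walk anew; what counts is the step after the
  last visit.\<close>

lemma conn_first_step:
  assumes "(v, x) \<in> (adj_in E A)\<^sup>*" "x \<noteq> v"
  shows "\<exists>u\<in>A - {v}. {v, u} \<in> E \<and> (u, x) \<in> (adj_in E (A - {v}))\<^sup>*"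
  using assms
proof (induction rule: rtrancl_induct)
  case (step y z)
  show ?case
  proof (cases "y = v")
    case True
    then show ?thesis using step by (intro bexI[of _ z]) (auto simp: adj_in_def)
  next
    case False
    then obtain u where u: "u \<in> A - {v}" "{v, u} \<in> E" "(u, y) \<in> (adj_in E (A - {v}))\<^sup>*" using step by blast
    have "(y, z) \<in> adj_in E (A - {v})" using step False by (auto simp: adj_in_def)
    then show ?thesis using u by (meson rtrancl.rtrancl_into_rtrancl)
  qed
qed simp

context
  fixes V :: "'v set" and E :: "'v set set"
  assumes T: "tree V E"
begin

lemma tree_finite: "finite V" "finite E"
proof -
  show "finite V" using T by (auto simp: tree_def graph_def)
  moreover have "E \<subseteq> Pow V" using T by (auto simp: tree_def graph_def)
  ultimately show "finite E" by (meson finite_Pow_iff finite_subset)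
qed

lemma tree_edge: "{u, v} \<in> E \<Longrightarrow> u \<noteq> v \<and> u \<in> V \<and> v \<in> V"
  using T unfolding tree_def graph_def by (metis doubleton_eq_iff)

lemma tree_edges_at:
  assumes "e \<in> edges_at E v" obtains u where "e = {v, u}" "{v, u} \<in> E" "u \<noteq> v" "u \<in> V" "v \<in> V"
proof -
  have "e \<in> E" "v \<in> e" using assms by (auto simp: edges_at_def)
  then obtain a b where "e = {a, b}" "a \<noteq> b" "a \<in> V" "b \<in> V" using T unfolding tree_def graph_def by blast
  then show ?thesis using that[of a] that[of b] \<open>e \<in> E\<close> \<open>v \<in> e\<close> by (auto simp: insert_commute)
qed

lemma edges_atI: "{v, u} \<in> E \<Longrightarrow> {v, u} \<in> edges_at E v" "{v, u} \<in> E \<Longrightarrow> {v, u} \<in> edges_at E u"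
  by (auto simp: edges_at_def)

lemma tree_connected: "u \<in> V \<Longrightarrow> w \<in> V \<Longrightarrow> (u, w) \<in> (adj_in E V)\<^sup>*"
  using T by (auto simp: tree_def connected_graph_def)

lemma branch_eq: "{v, u} \<in> E \<Longrightarrow> branch V E v {v, u} = {w. (u, w) \<in> (adj_in E (V - {v}))\<^sup>*}"
  using tree_edge[of v u] by (auto simp: branch_def)

lemma branch_subset: "{v, u} \<in> E \<Longrightarrow> branch V E v {v, u} \<subseteq> V - {v}"
  using branch_eq[of v u] tree_edge[of v u] conn_mem[of u _ E "V - {v}"] by auto

lemma branch_self: "{v, u} \<in> E \<Longrightarrow> u \<in> branch V E v {v, u}"
  using branch_eq by auto

lemma finite_branch: "{v, u} \<in> E \<Longrightarrow> finite (branch V E v {v, u})"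
  using branch_subset tree_finite finite_subset by blast

text \<open>A simple path off \<open>v\<close> between two of its neighbours, closed up through
  \<open>v\<close>, would be a cycle.\<close>

lemma neighbours_not_connected:
  assumes "{v, u} \<in> E" "{v, u'} \<in> E" "u \<noteq> u'"
  shows "(u, u') \<notin> (adj_in E (V - {v}))\<^sup>*"
proof
  assume "(u, u') \<in> (adj_in E (V - {v}))\<^sup>*"
  then obtain xs where xs: "xs \<noteq> []" "hd xs = u" "last xs = u'" "distinct xs"
    "\<And>i. Suc i < length xs \<Longrightarrow> (xs ! i, xs ! Suc i) \<in> adj_in E (V - {v})"
    by (rule rtrancl_simple_path) (rule that)
  have l2: "length xs \<ge> 2" using xs(1-3) assms(3) by (cases xs; cases "tl xs") auto
  have "v \<notin> set xs"
  proof
    assume "v \<in> set xs"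
    then obtain i where i: "i < length xs" "xs ! i = v" by (auto simp: in_set_conv_nth)
    show False
    proof (cases "Suc i < length xs")
      case True
      then show False using xs(5)[OF True] i by (auto simp: adj_in_def)
    next
      case False
      then obtain j where "i = Suc j" using l2 i by (cases i) auto
      then show False using xs(5)[of j] i by (auto simp: adj_in_def)
    qed
  qed
  have "is_cycle E (v # xs)"
    unfolding is_cycle_def
  proof (intro conjI allI impI)
    show "3 \<le> length (v # xs)" using l2 by simp
    show "distinct (v # xs)" using \<open>v \<notin> set xs\<close> xs(4) by simp
    fix i assume i: "i < length (v # xs)"
    show "{(v # xs) ! i, (v # xs) ! ((i + 1) mod length (v # xs))} \<in> E"
    proof (cases "i = length xs")
      case True
      then have "(v # xs) ! i = u'" "(i + 1) mod length (v # xs) = 0" using xs(1,3) by (auto simp: last_conv_nth nth_Cons')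
      then show ?thesis using assms(2) by (simp add: insert_commute)
    next
      case False
      then have i1: "i < length xs" using i by simp
      then have m: "(i + 1) mod length (v # xs) = Suc i" by simp
      show ?thesis
      proof (cases i)
        case 0
        then show ?thesis unfolding m using xs(1,2) assms(1) by (simp add: hd_conv_nth)
      next
        case (Suc j)
        then show ?thesis unfolding m using xs(5)[of j] i1 by (auto simp: adj_in_def)
      qed
    qed
  qed
  then show False using T by (auto simp: tree_def)
qed

lemma branch_ex1:
  assumes "v \<in> V" "x \<in> V" "x \<noteq> v"
  shows "\<exists>!e. e \<in> edges_at E v \<and> x \<in> branch V E v e"
proof -
  obtain u where u: "{v, u} \<in> E" "(u, x) \<in> (adj_in E (V - {v}))\<^sup>*"
    using conn_first_step[OF tree_connected[OF assms(1,2)] assms(3)] by blast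
  show ?thesis
  proof (rule ex1I[of _ "{v, u}"])
    show "{v, u} \<in> edges_at E v \<and> x \<in> branch V E v {v, u}" using u branch_eq by (auto simp: edges_at_def)
    fix e assume e: "e \<in> edges_at E v \<and> x \<in> branch V E v e"
    then obtain u' where u': "e = {v, u'}" "{v, u'} \<in> E" using tree_edges_at by metis
    then have "(u', x) \<in> (adj_in E (V - {v}))\<^sup>*" using e branch_eq by blast
    then have "(u, u') \<in> (adj_in E (V - {v}))\<^sup>*" using u(2) conn_sym by (metis rtrancl_trans)
    then show "e = {v, u}" using neighbours_not_connected[OF u(1) u'(2)] u' by blast
  qed
qed

lemma branch_neighbour:
  assumes "v \<in> V" "x \<in> V" "x \<noteq> v"
  obtains u where "{v, u} \<in> E" "x \<in> branch V E v {v, u}"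
  using branch_ex1[OF assms] tree_edges_at by metis

lemma branch_unique:
  assumes "{v, u} \<in> E" "{v, u'} \<in> E" "x \<in> branch V E v {v, u}" "x \<in> branch V E v {v, u'}"
  shows "u = u'"
proof (rule ccontr)
  assume "u \<noteq> u'"
  then show False using neighbours_not_connected[OF assms(1,2)] assms(3,4) branch_eq conn_sym
    by (metis assms(1,2) mem_Collect_eq rtrancl_trans)
qed

text \<open>A walk from \<open>v\<close> to \<open>x\<close> that avoids \<open>u\<close> leaves
  \<open>v\<close> for the last time through a neighbour other than \<open>u\<close>, so
  \<open>x\<close> would lie in two branches at \<open>v\<close>.\<close>

lemma branch_opposite_disjoint:
  assumes "{u, v} \<in> E" "x \<in> branch V E v {v, u}" "x \<in> branch V E u {u, v}"
  shows False
proof -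
  have vu: "{v, u} \<in> E" using assms(1) by (simp add: insert_commute)
  have xv: "x \<noteq> v" using branch_subset[OF vu] assms(2) by auto
  have "(v, x) \<in> (adj_in E (V - {u}))\<^sup>*" using branch_eq[OF assms(1)] assms(3) by auto
  then obtain u' where u': "u' \<in> V - {u} - {v}" "{v, u'} \<in> E" "(u', x) \<in> (adj_in E (V - {u} - {v}))\<^sup>*"
    using conn_first_step xv by metis
  have "adj_in E (V - {u} - {v}) \<subseteq> adj_in E (V - {v})" by (auto simp: adj_in_def)
  then have "(u', x) \<in> (adj_in E (V - {v}))\<^sup>*" using u'(3) rtrancl_mono by blast
  then have "x \<in> branch V E v {v, u'}" using branch_eq[OF u'(2)] by auto
  then have "u = u'" using branch_unique[OF vu u'(2) assms(2)] by blast
  then show False using u' by auto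
qed

lemma branch_opposite_cover:
  assumes "{u, v} \<in> E" "x \<in> V"
  shows "x \<in> branch V E v {v, u} \<or> x \<in> branch V E u {u, v}"
proof (cases "x = v")
  case True
  then show ?thesis using branch_self assms by auto
next
  case False
  have uv: "u \<noteq> v" "u \<in> V" "v \<in> V" using tree_edge assms by auto
  have vu: "{v, u} \<in> E" using assms(1) by (simp add: insert_commute)
  obtain u' where u': "{v, u'} \<in> E" "x \<in> branch V E v {v, u'}"
    using branch_neighbour uv(3) assms(2) False by metis
  show ?thesis
  proof (cases "u' = u")
    case False
    have "(u', x) \<in> (adj_in E (V - {v}))\<^sup>*" using u' branch_eq by auto
    then have "(u', x) \<in> (adj_in E (V - {u}))\<^sup>*"
    proof (rule conn_avoid)
      fix y assume y: "(u', y) \<in> (adj_in E (V - {v}))\<^sup>*"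
      then have "y \<in> branch V E v {v, u'}" using branch_eq u' by auto
      then show "y \<in> V - {u}" using branch_subset[OF u'(1)] branch_self[OF vu] branch_unique[OF u'(1) vu] False by blast
    qed
    moreover have "(v, u') \<in> adj_in E (V - {u})" using u' uv False tree_edge[OF u'(1)] by (auto simp: adj_in_def)
    ultimately show ?thesis using branch_eq[OF assms(1)] by (auto intro: converse_rtrancl_into_rtrancl)
  qed (use u' in auto)
qed

text \<open>The inclusion is strict because of \<open>u\<close>; this makes the size of a branch the
  induction measure for arguments moving between a vertex and the leaves beyond it.\<close>

lemma branch_nested:
  assumes "{v, u} \<in> E" "{u, s} \<in> E" "s \<noteq> v"
  shows "branch V E u {u, s} \<subset> branch V E v {v, u}"
proof -
  have uv: "{u, v} \<in> E" using assms(1) by (simp add: insert_commute)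
  have "x \<in> branch V E v {v, u}" if x: "x \<in> branch V E u {u, s}" for x
  proof -
    have "x \<notin> branch V E u {u, v}" using branch_unique[OF assms(2) uv x] assms(3) by blast
    moreover have "x \<in> V" using branch_subset[OF assms(2)] x by blast
    ultimately show ?thesis using branch_opposite_cover[OF uv] by blast
  qed
  moreover have "u \<in> branch V E v {v, u}" "u \<notin> branch V E u {u, s}"
    using branch_self[OF assms(1)] branch_subset[OF assms(2)] by auto
  ultimately show ?thesis by blast
qed

text \<open>From a common vertex, the first branch leads back to its base \<open>w\<close> without
  meeting \<open>w'\<close>, which puts \<open>w\<close> into the second branch. With immortal bases
  this keeps the branches of different grand orbits apart.\<close>

lemma branches_disjoint:
  assumes "{w, u} \<in> E" "{w', u'} \<in> E" "w \<noteq> w'"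
    "w' \<notin> branch V E w {w, u}" "w \<notin> branch V E w' {w', u'}"
  shows "branch V E w {w, u} \<inter> branch V E w' {w', u'} = {}"
proof -
  have False if x: "x \<in> branch V E w {w, u}" "x \<in> branch V E w' {w', u'}" for x
  proof -
    have "(u, x) \<in> (adj_in E (V - {w}))\<^sup>*" using x branch_eq assms(1) by auto
    then have ux: "(u, x) \<in> (adj_in E (V - {w'}))\<^sup>*"
    proof (rule conn_avoid)
      fix y assume y: "(u, y) \<in> (adj_in E (V - {w}))\<^sup>*"
      then have "y \<in> branch V E w {w, u}" using branch_eq assms(1) by auto
      then show "y \<in> V - {w'}" using branch_subset[OF assms(1)] assms(4) by blast
    qed
    have "u \<noteq> w'" using branch_self[OF assms(1)] assms(4) by auto
    then have "(w, u) \<in> adj_in E (V - {w'})" using assms(1,3) tree_edge[OF assms(1)] by (auto simp: adj_in_def)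
    then have "(x, w) \<in> (adj_in E (V - {w'}))\<^sup>*" using ux by (meson conn_sym converse_rtrancl_into_rtrancl)
    then have "w \<in> branch V E w' {w', u'}" using x(2) branch_eq[OF assms(2)] by (metis mem_Collect_eq rtrancl_trans)
    then show False using assms(5) by blast
  qed
  then show ?thesis by blast
qed

lemma other_neighbour:
  assumes "{v, u} \<in> E" "u \<notin> leaves V E"
  obtains s where "{u, s} \<in> E" "s \<noteq> v"
proof -
  have fin: "finite (edges_at E u)" using tree_finite by (auto simp: edges_at_def)
  have e: "{v, u} \<in> edges_at E u" using edges_atI assms by auto
  have "u \<in> V" using tree_edge assms by blast
  then have "card (edges_at E u) \<noteq> 1" using assms(2) by (auto simp: leaves_def val_def)
  then have "edges_at E u \<noteq> {{v, u}}" by auto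
  then obtain e' where e': "e' \<in> edges_at E u" "e' \<noteq> {v, u}" using e by blast
  then obtain s where "e' = {u, s}" "{u, s} \<in> E" using tree_edges_at by metis
  then show ?thesis using that[of s] e'(2) by (auto simp: insert_commute)
qed

lemma branch_has_leaf:
  assumes "{v, u} \<in> E"
  shows "\<exists>y\<in>leaves V E. y \<in> branch V E v {v, u}"
  using assms
proof (induction "card (branch V E v {v, u})" arbitrary: v u rule: less_induct)
  case less
  show ?case
  proof (cases "u \<in> leaves V E")
    case True
    then show ?thesis using branch_self less.prems by blast
  next
    case False
    then obtain s where s: "{u, s} \<in> E" "s \<noteq> v" using other_neighbour less.prems by metis
    have sub: "branch V E u {u, s} \<subset> branch V E v {v, u}" by (rule branch_nested[OF less.prems s])
    then have "card (branch V E u {u, s}) < card (branch V E v {v, u})"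
      using finite_branch[OF less.prems] psubset_card_mono by blast
    then show ?thesis using less.hyps s(1) sub by blast
  qed
qed

section \<open>Counting vertices and edges of a tree\<close>

lemma card_edges:
  assumes "V \<noteq> {}"
  shows "card E + 1 = card V"
proof -
  obtain r where r: "r \<in> V" using assms by blast
  \<comment> \<open>In the tree rooted at \<open>r\<close>, every other vertex owns its edge towards
    the root, and each edge is owned by exactly one of its ends.\<close>
  define up where "up v = (THE e. e \<in> edges_at E v \<and> r \<in> branch V E v e)" for v
  have up: "up v \<in> edges_at E v \<and> r \<in> branch V E v (up v)" if "v \<in> V - {r}" for v
    unfolding up_def by (rule theI'[OF branch_ex1]) (use that r in auto)
  have "bij_betw up (V - {r}) E"
    unfolding bij_betw_def
  proof (intro conjI inj_onI subset_antisym subsetI)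
    fix x y assume xy: "x \<in> V - {r}" "y \<in> V - {r}" "up x = up y"
    show "x = y"
    proof (rule ccontr)
      assume "x \<noteq> y"
      obtain u where u: "up x = {x, u}" "{x, u} \<in> E" using up[OF xy(1)] tree_edges_at by metis
      moreover have "y \<in> up x" using up[OF xy(2)] xy(3) by (auto simp: edges_at_def)
      ultimately have "u = y" using \<open>x \<noteq> y\<close> by auto
      then show False using branch_opposite_disjoint[of y x r] u up[OF xy(1)] up[OF xy(2)] xy(3) by (auto simp: insert_commute)
    qed
  next
    fix e assume "e \<in> up ` (V - {r})"
    then show "e \<in> E" using up by (auto simp: edges_at_def)
  next
    fix e assume e: "e \<in> E"
    then obtain u v where uv: "e = {u, v}" "u \<noteq> v" "u \<in> V" "v \<in> V" using T unfolding tree_def graph_def by blast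
    have "\<exists>v u. e = {v, u} \<and> r \<in> branch V E v {v, u}"
      using branch_opposite_cover[of u v r] e uv r by (metis insert_commute)
    then obtain v u where vu: "e = {v, u}" "r \<in> branch V E v {v, u}" by blast
    have "{v, u} \<in> E" using e vu by simp
    then have v: "v \<in> V - {r}" using branch_subset[of v u] vu tree_edge by blast
    have "e = up v" using branch_ex1[of v r] v r up[OF v] vu \<open>{v, u} \<in> E\<close> by (auto simp: edges_at_def)
    then show "e \<in> up ` (V - {r})" using v by blast
  qed
  then have "card (V - {r}) = card E" by (rule bij_betw_same_card)
  then show ?thesis using r tree_finite by (metis Suc_eq_plus1 card_Suc_Diff1)
qed

lemma sum_val: "(\<Sum>v\<in>V. val E v) = 2 * card E"
proof -
  have "(\<Sum>v\<in>V. val E v) = (\<Sum>v\<in>V. \<Sum>e\<in>E. if v \<in> e then 1 else 0)"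
    using tree_finite by (intro sum.cong refl) (simp add: val_def edges_at_def sum.If_cases Int_def conj_commute)
  also have "\<dots> = (\<Sum>e\<in>E. \<Sum>v\<in>V. if v \<in> e then 1 else 0)" by (rule sum.swap)
  also have "\<dots> = (\<Sum>e\<in>E. 2)"
  proof (rule sum.cong[OF refl])
    fix e assume "e \<in> E"
    then obtain u v where uv: "e = {u, v}" "u \<noteq> v" "u \<in> V" "v \<in> V" using T unfolding tree_def graph_def by blast
    have "(\<Sum>v\<in>V. if v \<in> e then 1 else 0) = card (V \<inter> e)" using tree_finite by (simp add: sum.If_cases Int_def)
    also have "V \<inter> e = {u, v}" using uv by auto
    finally show "(\<Sum>v\<in>V. if v \<in> e then 1 else 0) = (2::nat)" using uv by simp
  qed
  finally show ?thesis by simp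
qed

text \<open>Equivalently, \<open>val - 2\<close> sums to the number of leaves minus 2. In this form
  the inequalities at the vertices add up to one in which only leaves are left.\<close>

lemma sum_val_IV:
  assumes "V \<noteq> {}"
  shows "(\<Sum>v\<in>IV V E. val E v) + 2 = card (leaves V E) + 2 * card (IV V E)"
proof -
  have fin: "finite (leaves V E)" "finite (IV V E)" using tree_finite by (auto simp: leaves_def IV_def)
  have VU: "V = leaves V E \<union> IV V E" "leaves V E \<inter> IV V E = {}" by (auto simp: leaves_def IV_def)
  have "(\<Sum>v\<in>V. val E v) = (\<Sum>v\<in>leaves V E. val E v) + (\<Sum>v\<in>IV V E. val E v)"
    using VU fin by (metis sum.union_disjoint)
  moreover have "(\<Sum>v\<in>leaves V E. val E v) = card (leaves V E)" by (simp add: leaves_def)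
  moreover have "card V = card (leaves V E) + card (IV V E)" using VU fin by (metis card_Un_disjoint)
  ultimately show ?thesis using sum_val card_edges[OF assms] by linarith
qed

lemma leaf_edge:
  assumes "y \<in> leaves V E"
  obtains w where "edges_at E y = {{y, w}}" "{y, w} \<in> E"
proof -
  have "card (edges_at E y) = 1" using assms by (auto simp: leaves_def val_def)
  then obtain e where e: "edges_at E y = {e}" by (auto simp: card_1_singleton_iff)
  then obtain w where "e = {y, w}" "{y, w} \<in> E" using tree_edges_at[of e y] by auto
  then show ?thesis using that e by auto
qed

text \<open>Two adjacent leaves have no branch other than the one towards each other, so they would
  exhaust the tree.\<close>

lemma leaf_neighbour_internal:
  assumes "card (leaves V E) \<ge> 3" "y \<in> leaves V E" "{y, w} \<in> E"
  shows "w \<in> IV V E"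
proof (rule ccontr)
  assume "w \<notin> IV V E"
  then have w: "w \<in> leaves V E" using tree_edge[OF assms(3)] by (auto simp: IV_def)
  have e: "edges_at E w = {{y, w}}"
    using leaf_edge[OF w] edges_atI[OF assms(3)] by (metis singletonD)
  have "V \<subseteq> {y, w}"
  proof
    fix x assume x: "x \<in> V"
    show "x \<in> {y, w}"
    proof (rule ccontr)
      assume n: "x \<notin> {y, w}"
      have wV: "w \<in> V" using tree_edge assms(3) by blast
      obtain s where s: "{w, s} \<in> E" "x \<in> branch V E w {w, s}" using branch_neighbour[OF wV x] n by auto
      then have "s = y" using e edges_atI(1)[OF s(1)] by (auto simp: doubleton_eq_iff)
      obtain s' where s': "edges_at E y = {{y, s'}}" using leaf_edge[OF assms(2)] by metis
      have yV: "y \<in> V" using tree_edge assms(3) by blast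
      obtain t where t: "{y, t} \<in> E" "x \<in> branch V E y {y, t}" using branch_neighbour[OF yV x] n by auto
      have "{y, t} = {y, w}" using s' edges_atI(1)[OF t(1)] edges_atI(1)[OF assms(3)] by auto
      then have "t = w" by (auto simp: doubleton_eq_iff)
      then show False using branch_opposite_disjoint[of y w x] s t \<open>s = y\<close> by auto
    qed
  qed
  then have "leaves V E \<subseteq> {y, w}" by (auto simp: leaves_def)
  then have "card (leaves V E) \<le> 2" using card_mono[of "{y,w}" "leaves V E"] by (simp add: card_insert_if split: if_splits)
  then show False using assms(1) by simp
qed

end

section \<open>Covers of trees of spheres\<close>

locale tos_cover =
  fixes TY TZ :: "('v, 'p::topological_space) tos" and F :: "'v \<Rightarrow> 'v" and f :: "'v \<Rightarrow> 'p \<Rightarrow> 'p"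
  assumes cover: "cover TY TZ F f"
begin

abbreviation "VY \<equiv> verts TY"
abbreviation "EY \<equiv> edgs TY"
abbreviation "VZ \<equiv> verts TZ"
abbreviation "EZ \<equiv> edgs TZ"
abbreviation "dg v \<equiv> bc_degree (sph TY v) (sph TZ (F v)) (f v)"
abbreviation "ldg v x \<equiv> local_degree (sph TY v) (sph TZ (F v)) (f v) x"
abbreviation "edg v e \<equiv> ldg v (inc TY v e)"
abbreviation "D \<equiv> cover_degree TY TZ F f"
abbreviation "vd \<equiv> vdeg TY TZ F f"

lemma tosY: "tree_of_spheres TY" and tosZ: "tree_of_spheres TZ"
  using cover by (auto simp: cover_def)

lemma treeY: "tree VY EY" and treeZ: "tree VZ EZ"
  using tosY tosZ by (auto simp: tree_of_spheres_def stable_tree_def)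

lemma leaves3Y: "card (leaves VY EY) \<ge> 3" and leaves3Z: "card (leaves VZ EZ) \<ge> 3"
  using tosY tosZ by (auto simp: tree_of_spheres_def lvs_def)

lemma nonemptyY: "VY \<noteq> {}" and nonemptyZ: "VZ \<noteq> {}"
  using leaves3Y leaves3Z by (auto simp: leaves_def)

lemma F_leaf: "v \<in> lvs TY \<Longrightarrow> F v \<in> lvs TZ"
  and F_iv: "v \<in> ivs TY \<Longrightarrow> F v \<in> ivs TZ" and F_edge: "{v, w} \<in> EY \<Longrightarrow> {F v, F w} \<in> EZ"
  using cover by (auto simp: cover_def)

lemma vertsY: "v \<in> VY \<longleftrightarrow> v \<in> lvs TY \<or> v \<in> ivs TY" and vertsZ: "v \<in> VZ \<longleftrightarrow> v \<in> lvs TZ \<or> v \<in> ivs TZ"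
  and lvs_ivsY: "v \<in> lvs TY \<Longrightarrow> v \<notin> ivs TY" and lvs_ivsZ: "v \<in> lvs TZ \<Longrightarrow> v \<notin> ivs TZ"
  by (auto simp: lvs_def ivs_def IV_def leaves_def)

lemma F_iv_iff: "v \<in> VY \<Longrightarrow> F v \<in> ivs TZ \<longleftrightarrow> v \<in> ivs TY"
  and F_leaf_iff: "v \<in> VY \<Longrightarrow> F v \<in> lvs TZ \<longleftrightarrow> v \<in> lvs TY"
  using F_leaf F_iv vertsY lvs_ivsZ by blast+

lemma F_edges_at: "e \<in> edges_at EY v \<Longrightarrow> F ` e \<in> edges_at EZ (F v)"
proof -
  assume "e \<in> edges_at EY v"
  then obtain u where "e = {v, u}" "{v, u} \<in> EY" using tree_edges_at[OF treeY] by metis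
  then show ?thesis using F_edge[of v u] by (simp add: edges_at_def)
qed

lemma finite_edges_at: "finite (edges_at EY v)" "finite (edges_at EZ w)"
  using tree_finite[OF treeY] tree_finite[OF treeZ] by (auto simp: edges_at_def)

lemma sphere_map:
  assumes "v \<in> ivs TY"
  shows "sph TY v homeomorphic S2" "sph TZ (F v) homeomorphic S2"
    "branched_covering (sph TY v) (sph TZ (F v)) (f v)"
    "inj_on (inc TY v) (edges_at EY v)" "inc TY v ` edges_at EY v \<subseteq> sph TY v"
    "inj_on (inc TZ (F v)) (edges_at EZ (F v))" "inc TZ (F v) ` edges_at EZ (F v) \<subseteq> sph TZ (F v)"
    "covering_space (sph TY v - marked_pts TY v) (f v) (sph TZ (F v) - marked_pts TZ (F v))"
    "\<And>e. e \<in> edges_at EY v \<Longrightarrow> f v (inc TY v e) = inc TZ (F v) (F ` e)"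
  using assms F_iv[OF assms] tosY tosZ cover by (auto simp: tree_of_spheres_def cover_def)

lemma marked_preimage:
  assumes "v \<in> ivs TY"
  shows "marked_pts TY v = {x\<in>sph TY v. f v x \<in> marked_pts TZ (F v)}"
proof -
  have "f v x \<notin> marked_pts TZ (F v)" if "x \<in> sph TY v - marked_pts TY v" for x
    using cover assms that by (auto simp: cover_def)
  then show ?thesis using sphere_map[OF assms] F_edges_at[of _ v] unfolding marked_pts_def by fastforce
qed

lemma unmarked_degree:
  assumes "v \<in> ivs TY" "x \<in> sph TY v" "x \<notin> marked_pts TY v"
  shows "ldg v x = 1"
  using sphere_local_degree_covering[OF sphere_map(1-3)[OF assms(1)] _ _ sphere_map(8)[OF assms(1)]]
    assms finite_edges_at sphere_map(5)[OF assms(1)] unfolding marked_pts_def by blast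

lemma edg_ge_1: "v \<in> ivs TY \<Longrightarrow> e \<in> edges_at EY v \<Longrightarrow> edg v e \<ge> 1"
  using local_degree_ge_1[OF sphere_map(3)] sphere_map(5) by blast

lemma hurwitz_vertex:
  assumes "v \<in> ivs TY"
  shows "dg v * val EZ (F v) + 2 \<le> val EY v + 2 * dg v"
proof -
  have "F v \<in> ivs TZ" using F_iv assms by auto
  then have "val EZ (F v) \<ge> 3" using tosZ by (auto simp: tree_of_spheres_def stable_tree_def ivs_def)
  then have ne: "edges_at EZ (F v) \<noteq> {}" by (auto simp: val_def)
  have c: "card (marked_pts TY v) = val EY v" "card (marked_pts TZ (F v)) = val EZ (F v)"
    unfolding marked_pts_def val_def using sphere_map[OF assms] by (auto intro: card_image)
  show ?thesis
    unfolding c[symmetric]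
    by (rule sphere_hurwitz_inequality[OF sphere_map(1-3)[OF assms] _ _ _ marked_preimage[OF assms] sphere_map(8)[OF assms]])
       (use sphere_map[OF assms] finite_edges_at ne in \<open>auto simp: marked_pts_def\<close>)
qed

section \<open>Fibre sums over edges and the degree of a cover\<close>

lemma edge_fibre_sum:
  assumes "v \<in> ivs TY" "\<epsilon> \<in> edges_at EZ (F v)"
  shows "(\<Sum>e\<in>{e\<in>edges_at EY v. F ` e = \<epsilon>}. edg v e) = dg v"
proof -
  let ?y = "inc TZ (F v) \<epsilon>"
  note m = sphere_map[OF assms(1)]
  have y: "?y \<in> sph TZ (F v)" using m(7) assms(2) by blast
  have "{x\<in>sph TY v. f v x = ?y} = inc TY v ` {e\<in>edges_at EY v. F ` e = \<epsilon>}"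
  proof
    show "inc TY v ` {e\<in>edges_at EY v. F ` e = \<epsilon>} \<subseteq> {x\<in>sph TY v. f v x = ?y}"
      using m(5,9) by auto
    show "{x\<in>sph TY v. f v x = ?y} \<subseteq> inc TY v ` {e\<in>edges_at EY v. F ` e = \<epsilon>}"
    proof
      fix x assume x: "x \<in> {x\<in>sph TY v. f v x = ?y}"
      then have "x \<in> marked_pts TY v" using marked_preimage[OF assms(1)] assms(2) by (auto simp: marked_pts_def)
      then obtain e where e: "e \<in> edges_at EY v" "x = inc TY v e" by (auto simp: marked_pts_def)
      then have "inc TZ (F v) (F ` e) = ?y" using x m(9) by auto
      then have "F ` e = \<epsilon>" using m(6) F_edges_at[OF e(1)] assms(2) by (auto dest: inj_onD)
      then show "x \<in> inc TY v ` {e\<in>edges_at EY v. F ` e = \<epsilon>}" using e by auto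
    qed
  qed
  moreover have "inj_on (inc TY v) {e\<in>edges_at EY v. F ` e = \<epsilon>}" using m(4) by (auto simp: inj_on_def)
  ultimately have "(\<Sum>e\<in>{e\<in>edges_at EY v. F ` e = \<epsilon>}. edg v e) = (\<Sum>x\<in>{x\<in>sph TY v. f v x = ?y}. ldg v x)"
    by (simp add: sum.reindex)
  then show ?thesis using sphere_fibre_sum[OF m(1-3) y] by simp
qed

lemma edg_sym:
  "{v1, v2} \<in> EY \<Longrightarrow> v1 \<in> ivs TY \<Longrightarrow> v2 \<in> ivs TY \<Longrightarrow> edg v1 {v1, v2} = edg v2 {v1, v2}"
  using cover by (auto simp: cover_def)

lemma vdeg_leaf:
  assumes "y \<in> lvs TY" "{y, w} \<in> EY"
  shows "w \<in> ivs TY" "vd y = edg w {y, w}" "vd y \<ge> 1" "edges_at EY y = {{y, w}}"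
proof -
  have y: "y \<in> leaves VY EY" using assms by (simp add: lvs_def)
  show w: "w \<in> ivs TY" using leaf_neighbour_internal[OF treeY leaves3Y y assms(2)] by (simp add: ivs_def)
  show e: "edges_at EY y = {{y, w}}"
    using leaf_edge[OF treeY y] edges_atI(1)[OF treeY assms(2)] by (metis singletonD)
  have "(THE e. e \<in> edges_at EY y) = {y, w}" using e by simp
  moreover have "(THE u. u \<in> {y, w} - {y}) = w" using tree_edge[OF treeY assms(2)] by (intro the_equality) auto
  ultimately show v: "vd y = edg w {y, w}"
    using lvs_ivsY[OF assms(1)] unfolding vdeg_def Let_def by (simp only: if_False)
  show "vd y \<ge> 1" unfolding v by (rule edg_ge_1[OF w]) (use edges_atI(2)[OF treeY assms(2)] in auto)
qed

lemma vdeg_iv: "v \<in> ivs TY \<Longrightarrow> vd v = dg v"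
  by (simp add: vdeg_def)

text \<open>\<open>SOME\<close> picks an internal end; if both ends are internal, the edge condition
  of a cover makes the choice irrelevant. Edges at leaves get a degree as well, so leaves and
  internal vertices can be counted alike.\<close>

definition edeg :: "'v set \<Rightarrow> nat" where
  "edeg e = edg (SOME v. v \<in> e \<and> v \<in> ivs TY) e"

lemma edeg_eq:
  assumes "e \<in> edges_at EY v" "v \<in> ivs TY"
  shows "edeg e = edg v e"
proof -
  define s where "s = (SOME v. v \<in> e \<and> v \<in> ivs TY)"
  have s: "s \<in> e \<and> s \<in> ivs TY" unfolding s_def by (rule someI[of _ v]) (use assms in \<open>auto simp: edges_at_def\<close>)
  obtain u where u: "e = {v, u}" "{v, u} \<in> EY" using tree_edges_at[OF treeY assms(1)] by metis
  then have "s = v \<or> s = u" using s by auto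
  then show ?thesis using edg_sym[OF u(2) assms(2)] s u unfolding edeg_def s_def[symmetric] by auto
qed

text \<open>At an internal vertex this is the fibre sum over one marked point. A leaf has a single
  edge, and it lies over the single edge at the image leaf.\<close>

lemma vdeg_edge_sum:
  assumes "v \<in> VY" "\<epsilon> \<in> edges_at EZ (F v)"
  shows "vd v = (\<Sum>e\<in>{e\<in>edges_at EY v. F ` e = \<epsilon>}. edeg e)"
proof (cases "v \<in> ivs TY")
  case True
  then show ?thesis using edge_fibre_sum[OF True assms(2)] edeg_eq[OF _ True] vdeg_iv[OF True] by simp
next
  case False
  then have vl: "v \<in> lvs TY" using assms vertsY by auto
  then obtain w where w: "{v, w} \<in> EY" using leaf_edge[OF treeY, of v] by (auto simp: lvs_def)
  note l = vdeg_leaf[OF vl w]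
  have "F v \<in> leaves VZ EZ" using F_leaf[OF vl] by (simp add: lvs_def)
  then obtain w' where "edges_at EZ (F v) = {{F v, w'}}" using leaf_edge[OF treeZ] by metis
  then have "F ` {v, w} = \<epsilon>" using F_edges_at[of "{v,w}" v] l(4) assms(2) by auto
  then have "{e\<in>edges_at EY v. F ` e = \<epsilon>} = {{v, w}}" using l(4) by auto
  then show ?thesis using l(2) edeg_eq[OF edges_atI(2)[OF treeY w] l(1)] by simp
qed

lemma vdeg_ge_1: "v \<in> VY \<Longrightarrow> vd v \<ge> 1"
proof (cases "v \<in> ivs TY")
  case True
  note m = sphere_map[OF True]
  have "F v \<in> ivs TZ" using F_iv True by auto
  then have "val EZ (F v) \<ge> 3" using tosZ by (auto simp: tree_of_spheres_def stable_tree_def ivs_def)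
  then have "edges_at EZ (F v) \<noteq> {}" by (auto simp: val_def)
  then obtain \<epsilon> where \<epsilon>: "\<epsilon> \<in> edges_at EZ (F v)" by blast
  let ?y = "inc TZ (F v) \<epsilon>"
  have y: "?y \<in> sph TZ (F v)" using m(7) \<epsilon> by blast
  then obtain x where x: "x \<in> sph TY v" "f v x = ?y" using m(3) unfolding branched_covering_def by (metis imageE)
  have "ldg v x \<le> dg v"
    unfolding sphere_fibre_sum[OF m(1-3) y, symmetric]
    by (rule member_le_sum) (use x sphere_finite_fibre[OF m(1-3) y] in auto)
  then show ?thesis using local_degree_ge_1[OF m(3) x(1)] vdeg_iv[OF True] by simp
next
  case False
  assume "v \<in> VY"
  then have vl: "v \<in> lvs TY" using False vertsY by auto
  then obtain w where w: "{v, w} \<in> EY" using leaf_edge[OF treeY, of v] by (auto simp: lvs_def)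
  show ?thesis by (rule vdeg_leaf(3)[OF vl w])
qed

text \<open>Each edge over \<open>{w, w'}\<close> has exactly one end over \<open>w\<close>. The
  right side is symmetric in \<open>w\<close> and \<open>w'\<close>, so the fibre sums at adjacent
  vertices agree.\<close>

lemma vdeg_sum_over_edge:
  assumes "{w, w'} \<in> EZ"
  shows "(\<Sum>v\<in>{v\<in>VY. F v = w}. vd v) = (\<Sum>e\<in>{e\<in>EY. F ` e = {w, w'}}. edeg e)"
proof -
  have ww: "w \<noteq> w'" using tree_edge[OF treeZ assms] by auto
  let ?I = "{v\<in>VY. F v = w}"
  let ?A = "\<lambda>v. {e\<in>edges_at EY v. F ` e = {w, w'}}"
  have "(\<Sum>v\<in>?I. vd v) = (\<Sum>v\<in>?I. \<Sum>e\<in>?A v. edeg e)"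
    using vdeg_edge_sum edges_atI(1)[OF treeZ assms] by (intro sum.cong) auto
  also have "\<dots> = (\<Sum>e\<in>(\<Union>v\<in>?I. ?A v). edeg e)"
  proof (rule sum.UNION_disjoint[symmetric])
    show "finite ?I" using tree_finite[OF treeY] by auto
    show "\<forall>v\<in>?I. finite (?A v)" using finite_edges_at by auto
    show "\<forall>i\<in>?I. \<forall>j\<in>?I. i \<noteq> j \<longrightarrow> ?A i \<inter> ?A j = {}"
    proof (intro ballI impI)
      fix i j assume ij: "i \<in> ?I" "j \<in> ?I" "i \<noteq> j"
      have False if e: "e \<in> ?A i" "e \<in> ?A j" for e
      proof -
        obtain u where "e = {i, u}" using e(1) tree_edges_at[OF treeY] by (metis (no_types, lifting) mem_Collect_eq)
        then have "e = {i, j}" using e ij by (auto simp: edges_at_def)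
        then have "F ` e = {w}" using ij by auto
        then show False using e ww by auto
      qed
      then show "?A i \<inter> ?A j = {}" by blast
    qed
  qed
  also have "(\<Union>v\<in>?I. ?A v) = {e\<in>EY. F ` e = {w, w'}}"
  proof
    show "(\<Union>v\<in>?I. ?A v) \<subseteq> {e\<in>EY. F ` e = {w, w'}}" by (auto simp: edges_at_def)
    show "{e\<in>EY. F ` e = {w, w'}} \<subseteq> (\<Union>v\<in>?I. ?A v)"
    proof
      fix e assume e: "e \<in> {e\<in>EY. F ` e = {w, w'}}"
      then obtain v where "v \<in> e" "F v = w" by (metis (mono_tags, lifting) imageE insertI1 mem_Collect_eq)
      moreover have "e \<subseteq> VY" using e treeY by (auto simp: tree_def graph_def)
      ultimately show "e \<in> (\<Union>v\<in>?I. ?A v)" using e by (auto simp: edges_at_def)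
    qed
  qed
  finally show ?thesis .
qed

lemma vdeg_fibre_sum:
  assumes "w \<in> VZ"
  shows "(\<Sum>v\<in>{v\<in>VY. F v = w}. vd v) = D"
proof -
  let ?n = "\<lambda>w. \<Sum>v\<in>{v\<in>VY. F v = w}. vd v"
  have const: "?n a = ?n b" if "(a, b) \<in> (adj_in EZ VZ)\<^sup>*" for a b
    using that
  proof (induction rule: rtrancl_induct)
    case (step b c)
    then have e: "{b, c} \<in> EZ" "{c, b} \<in> EZ" by (auto simp: adj_in_def insert_commute)
    have "?n b = ?n c"
      using vdeg_sum_over_edge[OF e(1)] vdeg_sum_over_edge[OF e(2)] by (simp add: insert_commute)
    then show ?case using step by simp
  qed simp
  define s where "s = (SOME w. w \<in> VZ)"
  have "s \<in> VZ" unfolding s_def by (rule someI[of _ w]) (rule assms)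
  then have "?n w = ?n s" using const tree_connected[OF treeZ assms] by blast
  then show ?thesis unfolding cover_degree_def s_def Let_def .
qed

lemma sum_by_fibres:
  assumes "finite A" "finite B" "F ` A \<subseteq> B"
  shows "(\<Sum>v\<in>A. h v * k (F v)) = (\<Sum>w\<in>B. (\<Sum>v\<in>{v\<in>A. F v = w}. h v) * (k w :: nat))"
proof -
  have "(\<Sum>v\<in>A. h v * k (F v)) = (\<Sum>w\<in>B. \<Sum>v\<in>{v\<in>A. F v = w}. h v * k (F v))"
    by (rule sum.group[OF assms, symmetric])
  also have "\<dots> = (\<Sum>w\<in>B. (\<Sum>v\<in>{v\<in>A. F v = w}. h v) * k w)"
    by (intro sum.cong refl) (simp add: sum_distrib_right)
  finally show ?thesis .
qed

lemma finite_verts: "finite VY" "finite VZ" "finite (lvs TY)" "finite (ivs TY)" "finite (lvs TZ)" "finite (ivs TZ)"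
  using tree_finite[OF treeY] tree_finite[OF treeZ] by (auto simp: lvs_def ivs_def IV_def leaves_def)

text \<open>Summed with the help of the fibre sums, the vertex inequalities give
  \<open>D * card (lvs TZ) + 2 \<le> card (lvs TY) + 2 * D\<close>. The leaf degrees add up to
  \<open>D * card (lvs TZ)\<close>, each is at least 1, and each critical leaf contributes an excess
  of at least 1.\<close>

lemma critical_leaves_bound:
  "card {y\<in>lvs TY. vd y \<ge> 2} + 2 \<le> 2 * D"
proof -
  have fibI: "(\<Sum>v\<in>{v\<in>ivs TY. F v = w}. vd v) = D" if "w \<in> ivs TZ" for w
  proof -
    have "{v\<in>ivs TY. F v = w} = {v\<in>VY. F v = w}" using that F_iv_iff vertsY by auto
    then show ?thesis using vdeg_fibre_sum[of w] that vertsZ by simp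
  qed
  have fibL: "(\<Sum>v\<in>{v\<in>lvs TY. F v = w}. vd v) = D" if "w \<in> lvs TZ" for w
  proof -
    have "{v\<in>lvs TY. F v = w} = {v\<in>VY. F v = w}" using that F_leaf_iff vertsY by auto
    then show ?thesis using vdeg_fibre_sum[of w] that vertsZ by simp
  qed
  have 1: "(\<Sum>v\<in>ivs TY. vd v * val EZ (F v)) = D * (\<Sum>w\<in>ivs TZ. val EZ w)"
    by (subst sum_by_fibres[OF finite_verts(4,6)]) (use F_iv fibI in \<open>auto simp: sum_distrib_left\<close>)
  have "F ` ivs TY \<subseteq> ivs TZ" "F ` lvs TY \<subseteq> lvs TZ" using F_iv F_leaf by auto
  then have 2: "(\<Sum>v\<in>ivs TY. vd v) = D * card (ivs TZ)"
    and 3: "(\<Sum>v\<in>lvs TY. vd v) = D * card (lvs TZ)"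
    using sum_by_fibres[OF finite_verts(4,6), of vd "\<lambda>_. 1"] sum_by_fibres[OF finite_verts(3,5), of vd "\<lambda>_. 1"]
      fibI fibL by (simp_all add: mult.commute)
  have "(\<Sum>v\<in>ivs TY. vd v * val EZ (F v) + 2) \<le> (\<Sum>v\<in>ivs TY. val EY v + 2 * vd v)"
    using hurwitz_vertex vdeg_iv by (intro sum_mono) auto
  then have h: "D * (\<Sum>w\<in>ivs TZ. val EZ w) + 2 * card (ivs TY) \<le> (\<Sum>v\<in>ivs TY. val EY v) + 2 * (D * card (ivs TZ))"
    using 1 2 unfolding sum.distrib by (simp add: sum_distrib_left[symmetric])
  have vY: "(\<Sum>v\<in>ivs TY. val EY v) + 2 = card (lvs TY) + 2 * card (ivs TY)"
    and vZ: "(\<Sum>v\<in>ivs TZ. val EZ v) + 2 = card (lvs TZ) + 2 * card (ivs TZ)"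
    using sum_val_IV[OF treeY nonemptyY] sum_val_IV[OF treeZ nonemptyZ] by (auto simp: lvs_def ivs_def)
  have "D * (\<Sum>w\<in>ivs TZ. val EZ w) + 2 * D = D * card (lvs TZ) + 2 * (D * card (ivs TZ))"
    using arg_cong[OF vZ, of "\<lambda>n. D * n"] by (simp add: algebra_simps)
  then have "D * card (lvs TZ) + 2 \<le> card (lvs TY) + 2 * D" using h vY by linarith
  then have "(\<Sum>v\<in>lvs TY. vd v) + 2 \<le> card (lvs TY) + 2 * D" using 3 by simp
  moreover have "card (lvs TY) + card {y\<in>lvs TY. vd y \<ge> 2} \<le> (\<Sum>v\<in>lvs TY. vd v)"
  proof -
    have "card (lvs TY) + card {y\<in>lvs TY. vd y \<ge> 2} = (\<Sum>v\<in>lvs TY. 1 + (if vd v \<ge> 2 then 1 else 0))"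
      unfolding sum.distrib using finite_verts by (simp add: sum.If_cases Int_def)
    also have "\<dots> \<le> (\<Sum>v\<in>lvs TY. vd v)"
    proof (rule sum_mono)
      fix v assume "v \<in> lvs TY"
      then show "1 + (if vd v \<ge> 2 then 1 else 0) \<le> vd v" using vdeg_ge_1[of v] vertsY by auto
    qed
    finally show ?thesis .
  qed
  ultimately show ?thesis by linarith
qed

section \<open>Branches that contain no critical value\<close>

lemma dg_1_edges:
  assumes "u \<in> ivs TY" "dg u = 1" "e \<in> edges_at EY u"
  shows "edg u e = 1" "\<And>e'. \<lbrakk>e' \<in> edges_at EY u; F ` e' = F ` e\<rbrakk> \<Longrightarrow> e' = e"
proof -
  have s: "(\<Sum>e'\<in>{e'\<in>edges_at EY u. F ` e' = F ` e}. edg u e') = 1"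
    using edge_fibre_sum[OF assms(1) F_edges_at[OF assms(3)]] assms(2) by simp
  have fin: "finite {e'\<in>edges_at EY u. F ` e' = F ` e}" using finite_edges_at by auto
  have "edg u e \<le> 1" unfolding s[symmetric] by (rule member_le_sum) (use assms fin in auto)
  then show "edg u e = 1" using edg_ge_1[OF assms(1,3)] by simp
  fix e' assume e': "e' \<in> edges_at EY u" "F ` e' = F ` e"
  show "e' = e"
  proof (rule ccontr)
    assume "e' \<noteq> e"
    then have "edg u e + edg u e' = (\<Sum>e'\<in>{e, e'}. edg u e')" by simp
    also have "\<dots> \<le> 1" unfolding s[symmetric] by (rule sum_mono2[OF fin]) (use e' assms in auto)
    finally show False using edg_ge_1[OF assms(1,3)] edg_ge_1[OF assms(1) e'(1)] by simp
  qed
qed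

definition critical_over :: "'v set \<Rightarrow> bool" where
  "critical_over B \<longleftrightarrow> (\<exists>y\<in>lvs TY. vd y \<ge> 2 \<and> F y \<in> B)"

lemma critical_over_mono: "critical_over B \<Longrightarrow> B \<subseteq> B' \<Longrightarrow> critical_over B'"
  by (auto simp: critical_over_def)

text \<open>An edge at \<open>u\<close> not lying over \<open>{\<pi>, t}\<close> leads to a
  noncritical leaf or, over a smaller branch, to an internal vertex of degree one by induction. So
  \<open>f u\<close> can ramify only over the marked point in the direction of \<open>\<pi>\<close>,
  which forces degree one.\<close>

lemma degree_1_of_not_critical_over:
  assumes "{\<pi>, t} \<in> EZ" "\<not> critical_over (branch VZ EZ \<pi> {\<pi>, t})" "u \<in> ivs TY" "F u = t"
  shows "dg u = 1"
  using assms
proof (induction "card (branch VZ EZ \<pi> {\<pi>, t})" arbitrary: \<pi> t u rule: less_induct)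
  case less
  note m = sphere_map[OF less.prems(3)]
  have \<epsilon>: "{\<pi>, t} \<in> edges_at EZ (F u)" using edges_atI(2)[OF treeZ less.prems(1)] less.prems(4) by auto
  show ?case
  proof (rule sphere_ramified_over_one_point[OF m(1-3)])
    show "inc TZ (F u) {\<pi>, t} \<in> sph TZ (F u)" using m(7) \<epsilon> by blast
    fix x assume x: "x \<in> sph TY u" "f u x \<noteq> inc TZ (F u) {\<pi>, t}"
    show "ldg u x = 1"
    proof (cases "x \<in> marked_pts TY u")
      case False
      then show ?thesis using unmarked_degree less.prems(3) x(1) by blast
    next
      case True
      then obtain e where e: "e \<in> edges_at EY u" "x = inc TY u e" by (auto simp: marked_pts_def)
      obtain u' where u': "e = {u, u'}" "{u, u'} \<in> EY" "u' \<in> VY" using tree_edges_at[OF treeY e(1)] by metis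
      have Fe: "F ` e \<noteq> {\<pi>, t}" using x(2) e m(9) by auto
      have ts: "{t, F u'} \<in> EZ" "F u' \<noteq> \<pi>" using F_edge[OF u'(2)] less.prems(4) Fe u'(1) by (auto simp: insert_commute)
      have sub: "branch VZ EZ t {t, F u'} \<subset> branch VZ EZ \<pi> {\<pi>, t}"
        by (rule branch_nested[OF treeZ less.prems(1) ts])
      have nc: "\<not> critical_over (branch VZ EZ t {t, F u'})" using critical_over_mono less.prems(2) sub by blast
      have u'u: "{u', u} \<in> EY" using u'(2) by (simp add: insert_commute)
      show ?thesis
      proof (cases "u' \<in> ivs TY")
        case True
        have "card (branch VZ EZ t {t, F u'}) < card (branch VZ EZ \<pi> {\<pi>, t})"
          using sub finite_branch[OF treeZ less.prems(1)] psubset_card_mono by blast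
        then have "dg u' = 1" using less.hyps ts(1) nc True by blast
        then have "edg u' e = 1" using dg_1_edges(1)[OF True] edges_atI(2)[OF treeY u'(2)] u'(1) by auto
        then show ?thesis using edg_sym[OF u'(2) less.prems(3) True] e u' by simp
      next
        case False
        then have l: "u' \<in> lvs TY" using u'(3) vertsY by auto
        have "F u' \<in> branch VZ EZ t {t, F u'}" by (rule branch_self[OF treeZ ts(1)])
        then have "vd u' < 2" using nc l by (auto simp: critical_over_def)
        then have "vd u' = 1" using vdeg_ge_1[OF u'(3)] by simp
        then show ?thesis using vdeg_leaf(2)[OF l u'u] e u' by (simp add: insert_commute)
      qed
    qed
  qed
qed

lemma not_critical_over_edge:
  assumes "{v, u} \<in> EY" "v \<in> ivs TY" "\<not> critical_over (branch VZ EZ (F v) {F v, F u})"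
  shows "edg v {v, u} = 1"
proof -
  have u: "u \<in> VY" using tree_edge[OF treeY assms(1)] by auto
  have uv: "{u, v} \<in> EY" using assms(1) by (simp add: insert_commute)
  show ?thesis
  proof (cases "u \<in> ivs TY")
    case True
    have "dg u = 1" by (rule degree_1_of_not_critical_over[OF F_edge[OF assms(1)] assms(3) True refl])
    then have "edg u {v, u} = 1" using dg_1_edges(1)[OF True] edges_atI(2)[OF treeY assms(1)] by auto
    then show ?thesis using edg_sym[OF assms(1,2) True] by simp
  next
    case False
    then have l: "u \<in> lvs TY" using u vertsY by auto
    have "F u \<in> branch VZ EZ (F v) {F v, F u}" by (rule branch_self[OF treeZ F_edge[OF assms(1)]])
    then have "vd u < 2" using assms(3) l by (auto simp: critical_over_def)
    then have "vd u = 1" using vdeg_ge_1[OF u] by simp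
    then show ?thesis using vdeg_leaf(2)[OF l uv] by (simp add: insert_commute)
  qed
qed

text \<open>Degree one at \<open>u\<close> makes \<open>F\<close> injective on the edges there, so
  no edge other than \<open>{v, u}\<close> is folded back towards \<open>F v\<close> and the images
  keep moving away from \<open>F v\<close>.\<close>

lemma not_critical_over_branch:
  assumes "{v, u} \<in> EY" "\<not> critical_over (branch VZ EZ (F v) {F v, F u})"
  shows "F ` branch VY EY v {v, u} \<subseteq> branch VZ EZ (F v) {F v, F u}"
  using assms
proof (induction "card (branch VY EY v {v, u})" arbitrary: v u rule: less_induct)
  case less
  note Fe = F_edge[OF less.prems(1)]
  have uv: "u \<in> VY" "v \<in> VY" "u \<noteq> v" using tree_edge[OF treeY less.prems(1)] by auto
  have uve: "{u, v} \<in> EY" using less.prems(1) by (simp add: insert_commute)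
  show ?case
  proof
    fix z assume "z \<in> F ` branch VY EY v {v, u}"
    then obtain x where x: "x \<in> branch VY EY v {v, u}" "z = F x" by auto
    show "z \<in> branch VZ EZ (F v) {F v, F u}"
    proof (cases "x = u")
      case True
      then show ?thesis using branch_self[OF treeZ Fe] x by simp
    next
      case False
      have xV: "x \<in> VY" using branch_subset[OF treeY less.prems(1)] x by auto
      obtain s where s: "{u, s} \<in> EY" "x \<in> branch VY EY u {u, s}"
        using branch_neighbour[OF treeY uv(1) xV False] by metis
      have sv: "s \<noteq> v" using branch_opposite_disjoint[OF treeY uve x(1)] s by blast
      have "u \<in> ivs TY"
      proof (rule ccontr)
        assume "u \<notin> ivs TY"
        then have "u \<in> lvs TY" using uv vertsY by auto
        then have "edges_at EY u = {{u, v}}" using vdeg_leaf(4)[OF _ uve] by blast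
        then show False using edges_atI(1)[OF treeY s(1)] sv uv by (auto simp: doubleton_eq_iff)
      qed
      then have "dg u = 1" using degree_1_of_not_critical_over[OF Fe less.prems(2)] by blast
      then have ne: "F ` {u, s} \<noteq> F ` {v, u}"
        using dg_1_edges(2)[OF \<open>u \<in> ivs TY\<close> _ edges_atI(2)[OF treeY less.prems(1)], of "{u,s}"] edges_atI(1)[OF treeY s(1)] sv uv
        by (metis doubleton_eq_iff)
      have Fs: "{F u, F s} \<in> EZ" "F s \<noteq> F v" using F_edge[OF s(1)] ne by (auto simp: insert_commute)
      have sub: "branch VZ EZ (F u) {F u, F s} \<subset> branch VZ EZ (F v) {F v, F u}"
        by (rule branch_nested[OF treeZ Fe Fs])
      have "branch VY EY u {u, s} \<subset> branch VY EY v {v, u}"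
        by (rule branch_nested[OF treeY less.prems(1) s(1) sv])
      then have "card (branch VY EY u {u, s}) < card (branch VY EY v {v, u})"
        using finite_branch[OF treeY less.prems(1)] psubset_card_mono by blast
      moreover have "\<not> critical_over (branch VZ EZ (F u) {F u, F s})" using critical_over_mono less.prems(2) sub by blast
      ultimately have "F ` branch VY EY u {u, s} \<subseteq> branch VZ EZ (F u) {F u, F s}" using less.hyps s(1) by blast
      then show ?thesis using s(2) x(2) sub by blast
    qed
  qed
qed

end

section \<open>Dynamics\<close>

lemma third_component:
  assumes tos: "tree_of_spheres TX" and v: "v \<in> ivs TX"
    and ab: "a \<in> verts TX - {v}" "b \<in> verts TX - {v}"
  obtains c where "c \<in> verts TX - {v}" "(a, c) \<notin> (adj_in (edgs TX) (verts TX - {v}))\<^sup>*"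
    "(b, c) \<notin> (adj_in (edgs TX) (verts TX - {v}))\<^sup>*"
proof -
  let ?V = "verts TX" and ?E = "edgs TX"
  have T: "tree ?V ?E" using tos by (auto simp: tree_of_spheres_def stable_tree_def)
  have vV: "v \<in> ?V" using v by (auto simp: ivs_def IV_def)
  have val: "card (edges_at ?E v) \<ge> 3" using tos v by (auto simp: tree_of_spheres_def stable_tree_def ivs_def val_def)
  obtain ua where ua: "{v, ua} \<in> ?E" "a \<in> branch ?V ?E v {v, ua}" using branch_neighbour[OF T vV] ab by blast
  obtain ub where ub: "{v, ub} \<in> ?E" "b \<in> branch ?V ?E v {v, ub}" using branch_neighbour[OF T vV] ab by blast
  \<comment> \<open>Valence at least 3 leaves a direction containing neither \<open>a\<close> nor
    \<open>b\<close>.\<close>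
  have "\<not> edges_at ?E v \<subseteq> {{v, ua}, {v, ub}}"
  proof
    assume "edges_at ?E v \<subseteq> {{v, ua}, {v, ub}}"
    then have "card (edges_at ?E v) \<le> card {{v, ua}, {v, ub}}" by (intro card_mono) auto
    also have "\<dots> \<le> 2" by (simp add: card_insert_if)
    finally show False using val by simp
  qed
  then obtain e where e: "e \<in> edges_at ?E v" "e \<noteq> {v, ua}" "e \<noteq> {v, ub}" by blast
  then obtain c where c: "e = {v, c}" "{v, c} \<in> ?E" using tree_edges_at[OF T] by metis
  have key: "(x, c) \<notin> (adj_in ?E (?V - {v}))\<^sup>*" if "{v, u} \<in> ?E" "x \<in> branch ?V ?E v {v, u}" "u \<noteq> c" for x u
  proof
    assume "(x, c) \<in> (adj_in ?E (?V - {v}))\<^sup>*"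
    moreover have "(u, x) \<in> (adj_in ?E (?V - {v}))\<^sup>*" using that branch_eq[OF T that(1)] by auto
    ultimately show False using neighbours_not_connected[OF T that(1) c(2) that(3)] by (meson rtrancl_trans)
  qed
  show ?thesis
  proof
    show "c \<in> ?V - {v}" using tree_edge[OF T c(2)] by auto
  qed (use key ua ub e c in blast)+
qed

lemma tos_sub_verts: "tos_sub TX T \<Longrightarrow> verts TX \<subseteq> verts T"
proof -
  assume "tos_sub TX T"
  then have "lvs TX \<subseteq> lvs T" "ivs TX \<subseteq> ivs T" by (auto simp: tos_sub_def compatible_def)
  then show ?thesis by (auto simp: lvs_def ivs_def IV_def leaves_def)
qed

text \<open>Compatibility speaks of triples only. Stability of \<open>TX\<close> supplies vertices
  in further components, so that a statement about a pair can be tested on triples.\<close>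

lemma tos_sub_connected_iff:
  assumes sub: "tos_sub TX T" and v: "v \<in> ivs TX"
    and ab: "a \<in> verts TX - {v}" "b \<in> verts TX - {v}"
  shows "(a, b) \<in> (adj_in (edgs TX) (verts TX - {v}))\<^sup>* \<longleftrightarrow> (a, b) \<in> (adj_in (edgs T) (verts T - {v}))\<^sup>*"
    (is "?X a b \<longleftrightarrow> ?T a b")
proof -
  have tos: "tree_of_spheres TX" using sub by (auto simp: tos_sub_def)
  have vV: "v \<in> verts TX" using v by (auto simp: ivs_def IV_def)
  have sep: "separates (verts TX) (edgs TX) v p q r \<longleftrightarrow> separates (verts T) (edgs T) v p q r"
    if "p \<in> verts TX" "q \<in> verts TX" "r \<in> verts TX" for p q r
    using sub that vV by (auto simp: tos_sub_def compatible_def)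
  note third = third_component[OF tos v]
  have sub': "verts TX \<subseteq> verts T" by (rule tos_sub_verts[OF sub])
  show ?thesis
  proof
    assume "?T a b"
    show "?X a b"
    proof (rule ccontr)
      assume "\<not> ?X a b"
      moreover obtain c where "c \<in> verts TX - {v}" "\<not> ?X a c" "\<not> ?X b c" using third[OF ab] by metis
      ultimately have "separates (verts TX) (edgs TX) v a b c" using ab by (auto simp: separates_def)
      then have "separates (verts T) (edgs T) v a b c" using sep[of a b c] ab \<open>c \<in> verts TX - {v}\<close> by blast
      then show False using \<open>?T a b\<close> by (auto simp: separates_def)
    qed
  next
    assume X: "?X a b"
    show "?T a b"
    proof (rule ccontr)
      assume nT: "\<not> ?T a b"
      \<comment> \<open>Two auxiliary components are used: \<open>a\<close> and \<open>b\<close> are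
        each separated from \<open>c1\<close> and \<open>c2\<close> in \<open>TX\<close>, hence in
        \<open>T\<close>. Were they also apart in \<open>T\<close>, then \<open>a\<close>,
        \<open>b\<close>, \<open>c1\<close> would be separated there, and so in
        \<open>TX\<close>.\<close>
      obtain c1 where c1: "c1 \<in> verts TX - {v}" "\<not> ?X a c1" using third[OF ab(1) ab(1)] by metis
      obtain c2 where c2: "c2 \<in> verts TX - {v}" "\<not> ?X a c2" "\<not> ?X c1 c2" using third[OF ab(1) c1(1)] by metis
      have b: "\<not> ?X b c1" "\<not> ?X b c2" using X c1 c2 by (meson rtrancl_trans)+
      have "separates (verts TX) (edgs TX) v a c1 c2" "separates (verts TX) (edgs TX) v b c1 c2"
        using ab c1 c2 b by (auto simp: separates_def)
      then have "separates (verts T) (edgs T) v a c1 c2" "separates (verts T) (edgs T) v b c1 c2"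
        using sep[of a c1 c2] sep[of b c1 c2] ab c1 c2 by blast+
      then have "separates (verts T) (edgs T) v a b c1" using nT by (auto simp: separates_def)
      then have "separates (verts TX) (edgs TX) v a b c1" using sep[of a b c1] ab c1 by blast
      then show False using X by (auto simp: separates_def)
    qed
  qed
qed

lemma attach_eq:
  assumes T: "tree (verts T) (edgs T)" and "{v, u} \<in> edgs T" "x \<in> branch (verts T) (edgs T) v {v, u}"
  shows "attach T v x = inc T v {v, u}"
proof -
  have "x \<in> verts T" "x \<noteq> v" "v \<in> verts T" using branch_subset[OF T assms(2)] assms(3) tree_edge[OF T assms(2)] by auto
  then have "(THE e. e \<in> edges_at (edgs T) v \<and> x \<in> branch (verts T) (edgs T) v e) = {v, u}"
    by (intro the1_equality[OF branch_ex1[OF T]] conjI) (use edges_atI(1)[OF T assms(2)] assms(3) in auto)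
  then show ?thesis by (simp add: attach_def)
qed

text \<open>The attaching maps are known to agree only on leaves of \<open>TX\<close>. So
  \<open>w\<close> is replaced by a leaf \<open>x\<close> of \<open>TX\<close> in its branch, and
  both larger trees see \<open>w\<close> and \<open>x\<close> in one component off
  \<open>v\<close>.\<close>

lemma tos_sub_branch_transfer:
  assumes subY: "tos_sub TX TY" and subZ: "tos_sub TX TZ"
    and v: "v \<in> ivs TX" and w: "w \<in> verts TX"
    and u: "{v, u} \<in> edgs TZ" "w \<in> branch (verts TZ) (edgs TZ) v {v, u}"
  obtains u' where "{v, u'} \<in> edgs TY" "w \<in> branch (verts TY) (edgs TY) v {v, u'}"
    "inc TY v {v, u'} = inc TZ v {v, u}"
proof -
  have tX: "tree (verts TX) (edgs TX)" and tY: "tree (verts TY) (edgs TY)" and tZ: "tree (verts TZ) (edgs TZ)"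
    using subY subZ by (auto simp: tos_sub_def tree_of_spheres_def stable_tree_def)
  have vV: "v \<in> verts TX" using v by (auto simp: ivs_def IV_def)
  have wv: "w \<noteq> v" using branch_subset[OF tZ u(1)] u(2) by auto
  obtain n where n: "{v, n} \<in> edgs TX" "w \<in> branch (verts TX) (edgs TX) v {v, n}"
    using branch_neighbour[OF tX vV w wv] by metis
  obtain x where x: "x \<in> leaves (verts TX) (edgs TX)" "x \<in> branch (verts TX) (edgs TX) v {v, n}"
    using branch_has_leaf[OF tX n(1)] by blast
  have xX: "x \<in> verts TX - {v}" using branch_subset[OF tX n(1)] x(2) by auto
  have "(w, x) \<in> (adj_in (edgs TX) (verts TX - {v}))\<^sup>*"
    using n(2) x(2) branch_eq[OF tX n(1)] conn_sym by (metis mem_Collect_eq rtrancl_trans)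
  then have wxY: "(w, x) \<in> (adj_in (edgs TY) (verts TY - {v}))\<^sup>*" and wxZ: "(w, x) \<in> (adj_in (edgs TZ) (verts TZ - {v}))\<^sup>*"
    using tos_sub_connected_iff[OF subY v _ xX] tos_sub_connected_iff[OF subZ v _ xX] w wv by auto
  have "w \<in> verts TY" "v \<in> verts TY" using tos_sub_verts[OF subY] w vV by auto
  then obtain u' where u': "{v, u'} \<in> edgs TY" "w \<in> branch (verts TY) (edgs TY) v {v, u'}"
    using branch_neighbour[OF tY _ _ wv] by metis
  have "x \<in> branch (verts TY) (edgs TY) v {v, u'}" using u' wxY branch_eq[OF tY u'(1)] by (metis mem_Collect_eq rtrancl_trans)
  then have "attach TY v x = inc TY v {v, u'}" by (rule attach_eq[OF tY u'(1)])
  moreover have "x \<in> branch (verts TZ) (edgs TZ) v {v, u}" using u wxZ branch_eq[OF tZ u(1)] by (metis mem_Collect_eq rtrancl_trans)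
  then have "attach TZ v x = inc TZ v {v, u}" by (rule attach_eq[OF tZ u(1)])
  moreover have "attach TX v x = attach TY v x" "attach TX v x = attach TZ v x"
    using subY subZ v x(1) by (auto simp: tos_sub_def lvs_def)
  ultimately show ?thesis using that u' by simp
qed

text \<open>The sets \<open>IV_iter\<close> decrease, so an orbit ends once its vertex leaves the
  internal vertices of \<open>TX\<close>; a repeated point makes it periodic from then on. Either
  way it would be finite.\<close>

lemma infinite_orbit:
  assumes "infinite (orbit TX F f p)"
  shows "\<And>k. fst p \<in> IV_iter (ivs TX) F k" "inj (\<lambda>k. (dstep F f ^^ k) p)"
proof -
  let ?p = "\<lambda>k. (dstep F f ^^ k) p"
  have anti: "IV_iter (ivs TX) F (k + j) \<subseteq> IV_iter (ivs TX) F k" for k j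
    by (induction j) auto
  show "fst p \<in> IV_iter (ivs TX) F k" for k
  proof (rule ccontr)
    assume n: "fst p \<notin> IV_iter (ivs TX) F k"
    have "j < k" if "fst p \<in> IV_iter (ivs TX) F j" for j
      using anti[of k "j - k"] n that by (metis le_add_diff_inverse not_le subsetD)
    then have "orbit TX F f p \<subseteq> {p} \<union> (\<lambda>j. ?p (Suc j)) ` {..<k}" unfolding orbit_def by auto
    then show False using assms finite_subset by fastforce
  qed
  show "inj ?p"
  proof (rule ccontr)
    assume "\<not> inj ?p"
    then obtain i j where ij: "i < j" "?p i = ?p j"
      unfolding inj_on_def by (metis linorder_neqE_nat)
    have "?p n \<in> ?p ` {..<j}" for n
    proof (induction n rule: less_induct)
      case (less n)
      show ?case
      proof (cases "n < j")
        case False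
        then have "?p n = (dstep F f ^^ (n - j)) (?p j)" by (metis funpow_add le_add_diff_inverse2 not_le o_apply)
        also have "\<dots> = ?p (n - j + i)" unfolding ij(2)[symmetric] by (simp add: funpow_add)
        finally show ?thesis using less[of "n - j + i"] False ij(1) by simp
      qed auto
    qed
    then have "orbit TX F f p \<subseteq> insert p (?p ` {..<j})" unfolding orbit_def by blast
    then show False using assms finite_subset by blast
  qed
qed

section \<open>Critical orbits and the grand orbits containing them\<close>

locale tos_dynamics =
  fixes TX TY TZ :: "('v, 'p::topological_space) tos" and F :: "'v \<Rightarrow> 'v" and f :: "'v \<Rightarrow> 'p \<Rightarrow> 'p"
  assumes dyn: "dyn_system TX TY TZ F f"
begin

sublocale tos_cover TY TZ F f
  using dyn by unfold_locales (auto simp: dyn_system_def)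

lemma subY: "tos_sub TX TY" and subZ: "tos_sub TX TZ"
  using dyn by (auto simp: dyn_system_def)

lemma ivs_XY: "v \<in> ivs TX \<Longrightarrow> v \<in> ivs TY"
  using subY by (auto simp: tos_sub_def compatible_def)

definition immortal :: "'v \<Rightarrow> bool" where
  "immortal v \<longleftrightarrow> (\<forall>k. (F ^^ k) v \<in> ivs TX)"

lemma immortal_ivs: "immortal v \<Longrightarrow> v \<in> ivs TX"
  unfolding immortal_def by (metis funpow_0)

lemma immortal_funpow: "immortal v \<Longrightarrow> immortal ((F ^^ n) v)"
  unfolding immortal_def by (metis funpow_add o_apply)

abbreviation orb :: "'v \<times> 'p \<Rightarrow> nat \<Rightarrow> 'v \<times> 'p" where
  "orb p k \<equiv> (dstep F f ^^ k) p"

lemma fst_orb: "fst (orb p k) = (F ^^ k) (fst p)"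
  by (induction k) (auto simp: dstep_def)

definition folding_pts :: "('v \<times> 'p) set" where
  "folding_pts = {(v, inc TY v {v, u}) | v u. v \<in> ivs TY \<and> {v, u} \<in> EY \<and>
      critical_over (branch VZ EZ (F v) {F v, F u})}"

lemma finite_folding_pts: "finite folding_pts"
proof -
  have "folding_pts \<subseteq> (\<lambda>(v, e). (v, inc TY v e)) ` (ivs TY \<times> EY)" by (auto simp: folding_pts_def)
  then show ?thesis using finite_verts tree_finite[OF treeY] by (meson finite_SigmaI finite_imageI finite_subset)
qed

lemma critical_pt_folding:
  assumes "critical_pt TY TZ F f p"
  shows "p \<in> folding_pts"
proof -
  obtain v z where p: "p = (v, z)" by (cases p)
  have v: "v \<in> ivs TY" "z \<in> sph TY v" "ldg v z \<ge> 2" using assms by (auto simp: critical_pt_def Sigma_pts_def p)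
  then have "z \<in> marked_pts TY v" using unmarked_degree[OF v(1,2)] by auto
  then obtain e where e: "e \<in> edges_at EY v" "z = inc TY v e" by (auto simp: marked_pts_def)
  then obtain u where u: "e = {v, u}" "{v, u} \<in> EY" using tree_edges_at[OF treeY] by metis
  have "critical_over (branch VZ EZ (F v) {F v, F u})"
    using not_critical_over_edge[OF u(2) v(1)] v(3) e u by auto
  then show ?thesis using p e u v by (auto simp: folding_pts_def)
qed

lemma dstep_marked:
  assumes "v \<in> ivs TY" "{v, u} \<in> EY"
  shows "dstep F f (v, inc TY v {v, u}) = (F v, inc TZ (F v) {F v, F u})"
  using sphere_map(9)[OF assms(1) edges_atI(1)[OF treeY assms(2)]] by (simp add: dstep_def)

text \<open>The branch is taken at the image of the last folding point of the orbit. After that time the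
  branches along the orbit are carried into one another by \<open>F\<close>, so an immortal vertex inside
  would keep the orbit in the finite set of marked points.\<close>

lemma critical_orbit_branch:
  assumes crit: "critical_pt TY TZ F f p" and inf: "infinite (orbit TX F f p)"
  obtains w u where "immortal w" "{w, u} \<in> EZ" "(w, inc TZ w {w, u}) \<in> orbit TX F f p"
    "critical_over (branch VZ EZ w {w, u})" "\<And>s. immortal s \<Longrightarrow> s \<notin> branch VZ EZ w {w, u}"
proof -
  note iter = infinite_orbit(1)[OF inf] and inj = infinite_orbit(2)[OF inf]
  have imm: "immortal (fst p)" unfolding immortal_def
  proof
    fix k show "(F ^^ k) (fst p) \<in> ivs TX" using iter[of k] by (cases k) auto
  qed
  \<comment> \<open>Injectivity of the orbit turns finiteness of \<open>folding_pts\<close> into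
    finiteness of the set of folding times. Time 0 is among them because \<open>p\<close> is
    critical.\<close>
  have fin: "finite {k. orb p k \<in> folding_pts}"
    using finite_vimageI[OF finite_folding_pts inj] by (simp add: vimage_def)
  have "0 \<in> {k. orb p k \<in> folding_pts}" using critical_pt_folding[OF crit] by simp
  then have "Max {k. orb p k \<in> folding_pts} \<in> {k. orb p k \<in> folding_pts}" using fin Max_in by blast
  then obtain k where k: "orb p k \<in> folding_pts" "\<And>j. k < j \<Longrightarrow> orb p j \<notin> folding_pts"
    using Max_ge[OF fin] by (metis (mono_tags, lifting) mem_Collect_eq not_le)
  obtain v u0 where v: "orb p k = (v, inc TY v {v, u0})" "v \<in> ivs TY" "{v, u0} \<in> EY"
      "critical_over (branch VZ EZ (F v) {F v, F u0})" using k(1) unfolding folding_pts_def by blast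
  define w where "w = F v"
  have nxt: "orb p (Suc k) = (w, inc TZ w {w, F u0})" using dstep_marked[OF v(2,3)] v(1) by (simp add: w_def)
  have w: "w = (F ^^ Suc k) (fst p)" using fst_orb[of "Suc k" p] nxt by simp
  show ?thesis
  proof
    show iw: "immortal w" unfolding w by (rule immortal_funpow[OF imm])
    show e: "{w, F u0} \<in> EZ" unfolding w_def by (rule F_edge[OF v(3)])
    show "(w, inc TZ w {w, F u0}) \<in> orbit TX F f p" unfolding nxt[symmetric] orbit_def using iter[of k] by blast
    show "critical_over (branch VZ EZ w {w, F u0})" using v(4) by (simp add: w_def)
    show "s \<notin> branch VZ EZ w {w, F u0}" if s: "immortal s" for s
    proof
      assume sb: "s \<in> branch VZ EZ w {w, F u0}"
      have inv: "\<exists>u. {(F ^^ i) w, u} \<in> EZ \<and> orb p (Suc k + i) = ((F ^^ i) w, inc TZ ((F ^^ i) w) {(F ^^ i) w, u}) \<and>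
            (F ^^ i) s \<in> branch VZ EZ ((F ^^ i) w) {(F ^^ i) w, u}" for i
      proof (induction i)
        case 0
        then show ?case using e nxt sb by auto
      next
        case (Suc i)
        let ?w = "(F ^^ i) w" and ?s = "(F ^^ i) s"
        obtain u where u: "{?w, u} \<in> EZ" "orb p (Suc k + i) = (?w, inc TZ ?w {?w, u})" "?s \<in> branch VZ EZ ?w {?w, u}"
          using Suc by blast
        have wX: "?w \<in> ivs TX" and sX: "?s \<in> verts TX" using immortal_ivs[OF immortal_funpow] iw s by (auto simp: ivs_def IV_def)
        \<comment> \<open>The marked point of \<open>TZ\<close> is read as a marked point of
          \<open>TY\<close>, which is possible because the vertex \<open>?s\<close> of
          \<open>TX\<close> lies in its branch. Only an edge of \<open>TY\<close> can be pushed
          forward by \<open>F\<close>.\<close>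
        obtain u' where u': "{?w, u'} \<in> EY" "?s \<in> branch VY EY ?w {?w, u'}" "inc TY ?w {?w, u'} = inc TZ ?w {?w, u}"
          by (rule tos_sub_branch_transfer[OF subY subZ wX sX u(1,3)]) (rule that)
        have o: "orb p (Suc k + i) = (?w, inc TY ?w {?w, u'})" using u(2) u'(3) by simp
        have wY: "?w \<in> ivs TY" by (rule ivs_XY[OF wX])
        have "orb p (Suc k + i) \<notin> folding_pts" by (rule k(2)) simp
        then have "\<not> critical_over (branch VZ EZ (F ?w) {F ?w, F u'})" unfolding o folding_pts_def using wY u'(1) by blast
        then have "F ?s \<in> branch VZ EZ (F ?w) {F ?w, F u'}" using not_critical_over_branch[OF u'(1)] u'(2) by blast
        moreover have "orb p (Suc k + Suc i) = (F ?w, inc TZ (F ?w) {F ?w, F u'})"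
          using dstep_marked[OF wY u'(1)] o by simp
        moreover have "{F ?w, F u'} \<in> EZ" by (rule F_edge[OF u'(1)])
        ultimately show ?case by (intro exI[of _ "F u'"]) simp
      qed
      let ?M = "(\<lambda>(v, e). (v, inc TZ v e)) ` (VZ \<times> EZ)"
      have "orb p (Suc k + i) \<in> ?M" for i
      proof -
        obtain u where u: "{(F ^^ i) w, u} \<in> EZ" "orb p (Suc k + i) = ((F ^^ i) w, inc TZ ((F ^^ i) w) {(F ^^ i) w, u})"
          using inv[of i] by blast
        have "(F ^^ i) w \<in> VZ" using tree_edge[OF treeZ u(1)] by blast
        then show ?thesis unfolding u(2) using u(1) by (intro image_eqI[of _ _ "((F ^^ i) w, {(F ^^ i) w, u})"]) auto
      qed
      then have "range (\<lambda>i. orb p (Suc k + i)) \<subseteq> ?M" by blast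
      moreover have "finite ?M" using finite_verts tree_finite[OF treeZ] by blast
      moreover have "inj (\<lambda>i. orb p (Suc k + i))"
        using inj unfolding inj_on_def by (metis add_left_cancel UNIV_I)
      ultimately show False using finite_subset range_inj_infinite by blast
    qed
  qed
qed

lemma grand_orbit_equiv:
  "equiv (Sigma_pts TY) ({(p, q). p \<in> Sigma_pts TY \<and> q \<in> Sigma_pts TY \<and> orbit TX F f p \<inter> orbit TX F f q \<noteq> {}}\<^sup>+)"
proof (rule equivI)
  let ?R = "{(p, q). p \<in> Sigma_pts TY \<and> q \<in> Sigma_pts TY \<and> orbit TX F f p \<inter> orbit TX F f q \<noteq> {}}"
  show "?R\<^sup>+ \<subseteq> Sigma_pts TY \<times> Sigma_pts TY" by (rule trancl_subset_Sigma) auto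
  show "refl_on (Sigma_pts TY) (?R\<^sup>+)" by (rule refl_onI) (auto simp: orbit_def)
  have "sym ?R" by (auto simp: sym_def)
  then show "sym (?R\<^sup>+)" by (rule sym_trancl)
qed (rule trans_trancl)

lemma grand_orbits_eq:
  assumes "G \<in> grand_orbits TX TY F f" "G' \<in> grand_orbits TX TY F f" "p \<in> G" "p' \<in> G'"
    "p \<in> Sigma_pts TY" "p' \<in> Sigma_pts TY" "orbit TX F f p \<inter> orbit TX F f p' \<noteq> {}"
  shows "G = G'"
  using quotient_eq_iff[OF grand_orbit_equiv, of G G' p p'] assms unfolding grand_orbits_def by blast

lemma critical_grand_orbits:
  defines "\<G> \<equiv> {G \<in> grand_orbits TX TY F f. \<exists>p\<in>G. critical_pt TY TZ F f p \<and> infinite (orbit TX F f p)}"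
  shows "finite \<G> \<and> card \<G> \<le> 2 * D - 2"
proof -
  define C where "C = {y\<in>lvs TY. vd y \<ge> 2}"
  define P where "P G c \<longleftrightarrow> (\<exists>p w u. p \<in> G \<and> p \<in> Sigma_pts TY \<and> immortal w \<and> {w, u} \<in> EZ \<and>
      (w, inc TZ w {w, u}) \<in> orbit TX F f p \<and> (\<forall>s. immortal s \<longrightarrow> s \<notin> branch VZ EZ w {w, u}) \<and>
      c \<in> branch VZ EZ w {w, u})" for G c
  have ex: "\<exists>c\<in>F ` C. P G c" if G: "G \<in> \<G>" for G
  proof -
    obtain p where p: "p \<in> G" "critical_pt TY TZ F f p" "infinite (orbit TX F f p)" using G by (auto simp: \<G>_def)
    obtain w u where w: "immortal w" "{w, u} \<in> EZ" "(w, inc TZ w {w, u}) \<in> orbit TX F f p"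
      "critical_over (branch VZ EZ w {w, u})" "\<And>s. immortal s \<Longrightarrow> s \<notin> branch VZ EZ w {w, u}"
      by (rule critical_orbit_branch[OF p(2,3)]) (rule that)
    obtain y where y: "y \<in> C" "F y \<in> branch VZ EZ w {w, u}" using w(4) unfolding critical_over_def C_def by blast
    have "p \<in> Sigma_pts TY" using p(2) by (auto simp: critical_pt_def)
    then have "P G (F y)" unfolding P_def using p(1) w(1,2,3,5) y(2) by blast
    then show ?thesis using y(1) by blast
  qed
  have uniq: "G = G'" if G: "G \<in> \<G>" "G' \<in> \<G>" and P: "P G c" "P G' c" for G G' c
  proof -
    obtain p w u where 1: "p \<in> G" "p \<in> Sigma_pts TY" "immortal w" "{w, u} \<in> EZ"
      "(w, inc TZ w {w, u}) \<in> orbit TX F f p" "\<And>s. immortal s \<Longrightarrow> s \<notin> branch VZ EZ w {w, u}"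
      "c \<in> branch VZ EZ w {w, u}" using P(1) unfolding P_def by blast
    obtain p' w' u' where 2: "p' \<in> G'" "p' \<in> Sigma_pts TY" "immortal w'" "{w', u'} \<in> EZ"
      "(w', inc TZ w' {w', u'}) \<in> orbit TX F f p'" "\<And>s. immortal s \<Longrightarrow> s \<notin> branch VZ EZ w' {w', u'}"
      "c \<in> branch VZ EZ w' {w', u'}" using P(2) unfolding P_def by blast
    \<comment> \<open>Both bases are immortal, so neither lies in the branch of the other, and the
      common vertex \<open>c\<close> forces equal bases and then equal edges. The two orbits
      therefore share the marked point \<open>inc TZ w {w, u}\<close>.\<close>
    have "w = w'"
      using branches_disjoint[OF treeZ 1(4) 2(4) _ 1(6)[OF 2(3)] 2(6)[OF 1(3)]] 1(7) 2(7) by blast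
    then have "u = u'" using branch_unique[OF treeZ 1(4) _ 1(7), of u'] 2(4,7) by blast
    then have "orbit TX F f p \<inter> orbit TX F f p' \<noteq> {}" using 1(5) 2(5) \<open>w = w'\<close> by blast
    then show ?thesis using grand_orbits_eq[of G G' p p'] G 1(1,2) 2(1,2) by (auto simp: \<G>_def)
  qed
  obtain \<phi> where \<phi>: "\<And>G. G \<in> \<G> \<Longrightarrow> \<phi> G \<in> F ` C \<and> P G (\<phi> G)" using ex by metis
  have inj: "inj_on \<phi> \<G>" by (rule inj_onI) (metis \<phi> uniq)
  have sub: "\<phi> ` \<G> \<subseteq> F ` C" using \<phi> by blast
  have finC: "finite C" using finite_verts(3) by (simp add: C_def)
  have "finite \<G>" using inj sub finC by (meson finite_imageD finite_imageI finite_subset)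
  moreover have "card \<G> \<le> card (F ` C)" by (rule card_inj_on_le[OF inj sub]) (use finC in auto)
  moreover have "card (F ` C) \<le> card C" by (rule card_image_le[OF finC])
  moreover have "card C + 2 \<le> 2 * D" unfolding C_def by (rule critical_leaves_bound)
  ultimately show ?thesis by linarith
qed

end

theorem theorem3p8:
  fixes TX TY TZ :: "('v, 'p::topological_space) tos"
    and F :: "'v \<Rightarrow> 'v" and f :: "'v \<Rightarrow> 'p \<Rightarrow> 'p"
  assumes "dyn_system TX TY TZ F f"
  shows "finite {G \<in> grand_orbits TX TY F f.
                   \<exists>p\<in>G. critical_pt TY TZ F f p \<and> infinite (orbit TX F f p)}
       \<and> card {G \<in> grand_orbits TX TY F f.
                   \<exists>p\<in>G. critical_pt TY TZ F f p \<and> infinite (orbit TX F f p)}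
         \<le> 2 * cover_degree TY TZ F f - 2"
proof -
  interpret tos_dynamics TX TY TZ F f by unfold_locales (rule assms)
  show ?thesis by (rule critical_grand_orbits)
qed

end
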